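(* Let $\tau,z\in\mathbb{C}$ with $\mathrm{Im}\,\tau>|\mathrm{Im}\,z|\ge 0$, put $\Omega=\begin{pmatrix}\tau & z\\ z&\tau\end{pmatrix}$, and suppose that both $\mathrm{Im}(2\tau+z)$ and $\mathrm{Im}(\tau+2z)$ are integers. Let $L_\Omega=\mathbb{Z}^{(1,2)}\Omega+\mathbb{Z}^{(1,2)}\subset\mathbb{C}^2$ and $A_\Omega=\mathbb{C}^2/L_\Omega$. Let $H_*:\mathbb{C}^2\times\mathbb{C}^2\to\mathbb{C}$ be the Hermitian form on $\mathbb{C}^2$ defined by $$H_*((z_1,z_2),(w_1,w_2)):=2z_1\overline{w}_1+2z_2\overline{w}_2+z_1\overline{w}_2+z_2\overline{w}_1,\qquad (z_1,z_2),(w_1,w_2)\in\mathbb{C}^2.$$ Then: (i) $H_*$ is a positive definite Riemann form for $A_\Omega$. (ii) Let $\chi_*$ be the semi-character of $L_\Omega$ determined uniquely by $H_*$. Then the line bundle $L(H_*,\chi_* )$ is an ample line bundle over $A_\Omega$, and hence the global sections of $L(H_*,\chi_* )^{\otimes n}$ $(n\ge 3)$ give an embedding of $A_\Omega$ into a projective space. (iii) $$\dim H^0(A_\Omega,L(H_*,\chi_* ))=\sqrt{\det E_*}=3\left\{(\mathrm{Im}\,\tau)^2-(\mathrm{Im}\,z)^2\right\},$$ where $E_*$ is the imaginary part of $H_*$.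
   Context: $\mathbb{Z}^{(1,2)}$ denotes integer row vectors of length 2, and $\mathbb{C}^2$ consists of row vectors. The rows of $\Omega$ together with $(1,0),(0,1)$ form a $\mathbb{Z}$-basis of $L_\Omega$, which is a lattice of rank 4 in $\mathbb{C}^2$. Hermitian forms are $\mathbb{C}$-linear in the first variable and antilinear in the second. For a lattice $L\subset\mathbb{C}^2$ and $A=\mathbb{C}^2/L$ an abelian surface, a Riemann form for $A$ is a nondegenerate Hermitian form $H$ on $\mathbb{C}^2$ whose imaginary part $E=\mathrm{Im}\,H$ is integral valued on $L\times L$. Let $T=\{t\in\mathbb{C}: |t|=1\}$. A semi-character of $L$ with respect to $E$ is a map $\chi:L\to T$ with $\chi(\alpha+\beta)=\chi(\alpha)\chi(\beta)\exp\{i\pi E(\alpha,\beta)\}$ for all $\alpha,\beta\in L$. It is taken as given that for any Riemann form $H$ such a semi-character $\chi_H$ with respect to $\mathrm{Im}\,H$ always exists uniquely; this is the sense of "the semi-character determined uniquely by" the form. Given $H$ and $\chi$, put $J_{H,\chi}(\alpha,z)=\chi(\alpha)\exp\{\pi H(z,\alpha)+\frac{\pi}{2}H(\alpha,\alpha)\}$ for $\alpha\in L$, $z\in\mathbb{C}^2$. $L(H,\chi)$ denotes the holomorphic line bundle over $A$ obtained as the quotient of $\mathbb{C}^2\times\mathbb{C}$ by the action of $L$ given by $\alpha\cdot(z,\xi)=(z+\alpha,J_{H,\chi}(\alpha,z)\xi)$. Its space of global sections $H^0(A,L(H,\chi))$ is identified with the space of holomorphic functions $\theta$ on $\mathbb{C}^2$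 such that $\theta(z+\alpha)=J_{H,\chi}(\alpha,z)\theta(z)$ for all $\alpha\in L$, $z\in\mathbb{C}^2$. Ampleness of $L(H,\chi)$ is understood to mean that the holomorphic sections of $L(H,\chi)^{\otimes n}$ $(n\ge 3)$ give an embedding of $A$ as a closed complex submanifold into a projective space. $\det E$ denotes the determinant of the $4\times4$ matrix $(E(e_i,e_j))$ for a $\mathbb{Z}$-basis $e_1,\dots,e_4$ of $L$. *)

theory Defs
  imports "HOL-Analysis.Analysis" "HOL-Library.Function_Algebras"
begin

section \<open>Lattices and complex tori\<close>

definition z_basis :: "(complex^2) set \<Rightarrow> (complex^2)^4 \<Rightarrow> bool" where
  "z_basis L e \<longleftrightarrow>
     bij_betw (\<lambda>c :: int^4. \<Sum>i\<in>UNIV. of_int (c $ i) *s (e $ i)) UNIV L"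

definition lattice4 :: "(complex^2) set \<Rightarrow> bool" where
  "lattice4 L \<longleftrightarrow>
     (\<exists>e. z_basis L e \<and> inj (($) e) \<and> independent (range (($) e)))"

definition period_matrix :: "complex \<Rightarrow> complex \<Rightarrow> complex^2^2" where
  "period_matrix \<tau> z = vector [vector [\<tau>, z], vector [z, \<tau>]]"

definition period_lattice :: "complex^2^2 \<Rightarrow> (complex^2) set" where
  "period_lattice \<Omega> = {m v* \<Omega> + n | m n. (\<forall>i. m $ i \<in> \<int>) \<and> (\<forall>i. n $ i \<in> \<int>)}"

definition torus_point :: "(complex^2) set \<Rightarrow> complex^2 \<Rightarrow> (complex^2) set" where
  "torus_point L z = (\<lambda>\<alpha>. z + \<alpha>) ` L"

definition quotient_top :: "'a topology \<Rightarrow> ('a \<Rightarrow> 'b) \<Rightarrow> 'b topology" where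
  "quotient_top X q =
     topology (\<lambda>U. U \<subseteq> q ` topspace X \<and> openin X {x \<in> topspace X. q x \<in> U})"

lemma openin_quotient_top:
  "openin (quotient_top X q) U \<longleftrightarrow>
     U \<subseteq> q ` topspace X \<and> openin X {x \<in> topspace X. q x \<in> U}"
proof -
  have "istopology (\<lambda>U. U \<subseteq> q ` topspace X \<and> openin X {x \<in> topspace X. q x \<in> U})"
    unfolding istopology_def
  proof (intro conjI allI impI)
    fix S T
    assume S: "S \<subseteq> q ` topspace X \<and> openin X {x \<in> topspace X. q x \<in> S}"
      and T: "T \<subseteq> q ` topspace X \<and> openin X {x \<in> topspace X. q x \<in> T}"
    show "S \<inter> T \<subseteq> q ` topspace X" using S by blast
    have "{x \<in> topspace X. q x \<in> S \<inter> T}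
        = {x \<in> topspace X. q x \<in> S} \<inter> {x \<in> topspace X. q x \<in> T}" by blast
    then show "openin X {x \<in> topspace X. q x \<in> S \<inter> T}" using S T by auto
  next
    fix K
    assume K: "\<forall>S\<in>K. S \<subseteq> q ` topspace X \<and> openin X {x \<in> topspace X. q x \<in> S}"
    then show "\<Union>K \<subseteq> q ` topspace X" by blast
    have "{x \<in> topspace X. q x \<in> \<Union>K} = (\<Union>S\<in>K. {x \<in> topspace X. q x \<in> S})" by blast
    then show "openin X {x \<in> topspace X. q x \<in> \<Union>K}" using K by auto
  qed
  then show ?thesis by (simp add: quotient_top_def topology_inverse')
qed

definition torus :: "(complex^2) set \<Rightarrow> (complex^2) set topology" where
  "torus L = quotient_top euclidean (torus_point L)"

section \<open>Riemann forms, semi-characters and line bundles\<close>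

definition hermitian_form :: "(complex^2 \<Rightarrow> complex^2 \<Rightarrow> complex) \<Rightarrow> bool" where
  "hermitian_form H \<longleftrightarrow>
     (\<forall>x y w. H (x + y) w = H x w + H y w) \<and>
     (\<forall>c x w. H (c *s x) w = c * H x w) \<and>
     (\<forall>x w. H w x = cnj (H x w))"

definition riemann_form ::
    "(complex^2) set \<Rightarrow> (complex^2 \<Rightarrow> complex^2 \<Rightarrow> complex) \<Rightarrow> bool" where
  "riemann_form L H \<longleftrightarrow>
     hermitian_form H \<and>
     (\<forall>x. (\<forall>w. H x w = 0) \<longrightarrow> x = 0) \<and>
     (\<forall>\<alpha>\<in>L. \<forall>\<beta>\<in>L. Im (H \<alpha> \<beta>) \<in> \<int>)"

definition pos_definite :: "(complex^2 \<Rightarrow> complex^2 \<Rightarrow> complex) \<Rightarrow> bool" where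
  "pos_definite H \<longleftrightarrow> (\<forall>x. x \<noteq> 0 \<longrightarrow> H x x \<in> \<real> \<and> Re (H x x) > 0)"

text \<open>Only the values of a semi-character on \<open>L\<close> are relevant. A semi-character for a given \<open>E\<close>
  is unique only up to a character of \<open>L\<close>.\<close>

definition semi_character ::
    "(complex^2) set \<Rightarrow> (complex^2 \<Rightarrow> complex^2 \<Rightarrow> real) \<Rightarrow> (complex^2 \<Rightarrow> complex) \<Rightarrow> bool" where
  "semi_character L E \<psi> \<longleftrightarrow>
     (\<forall>\<alpha>\<in>L. cmod (\<psi> \<alpha>) = 1) \<and>
     (\<forall>\<alpha>\<in>L. \<forall>\<beta>\<in>L. \<psi> (\<alpha> + \<beta>) = \<psi> \<alpha> * \<psi> \<beta> * exp (\<i> * of_real pi * of_real (E \<alpha> \<beta>)))"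

definition auto_factor ::
    "(complex^2 \<Rightarrow> complex^2 \<Rightarrow> complex) \<Rightarrow> (complex^2 \<Rightarrow> complex)
      \<Rightarrow> complex^2 \<Rightarrow> complex^2 \<Rightarrow> complex" where
  "auto_factor H \<psi> \<alpha> z = \<psi> \<alpha> * exp (of_real pi * H z \<alpha> + of_real pi / 2 * H \<alpha> \<alpha>)"

text \<open>Holomorphy in two variables: existence of a complex-linear Frechet derivative.
  It is only used for open \<open>S\<close>.\<close>

definition holomorphic2_on :: "(complex^2 \<Rightarrow> complex) \<Rightarrow> (complex^2) set \<Rightarrow> bool" where
  "holomorphic2_on f S \<longleftrightarrow>
     (\<forall>x\<in>S. \<exists>D. (f has_derivative D) (at x) \<and> (\<forall>c v. D (c *s v) = c * D v))"

text \<open>A line bundle on the torus is given by its factor of automorphy \<open>J\<close>: it is the quotient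
  of \<open>\<complex>\<^sup>2 \<times> \<complex>\<close> by \<open>\<alpha> \<cdot> (z, \<xi>) = (z + \<alpha>, J \<alpha> z \<xi>)\<close>. Its global sections are
  identified with the holomorphic functions below, and its \<open>n\<close>-th tensor power has the
  factor of automorphy \<open>J\<^sup>n\<close>.\<close>

definition sections ::
    "(complex^2) set \<Rightarrow> (complex^2 \<Rightarrow> complex^2 \<Rightarrow> complex) \<Rightarrow> (complex^2 \<Rightarrow> complex) set" where
  "sections L J =
     {\<theta>. holomorphic2_on \<theta> UNIV \<and> (\<forall>\<alpha>\<in>L. \<forall>z. \<theta> (z + \<alpha>) = J \<alpha> z * \<theta> z)}"

definition tensor_power ::
    "(complex^2 \<Rightarrow> complex^2 \<Rightarrow> complex) \<Rightarrow> nat \<Rightarrow> complex^2 \<Rightarrow> complex^2 \<Rightarrow> complex" where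
  "tensor_power J n \<alpha> z = J \<alpha> z ^ n"

definition scale_fun :: "complex \<Rightarrow> ('a \<Rightarrow> complex) \<Rightarrow> 'a \<Rightarrow> complex" where
  "scale_fun c f = (\<lambda>x. c * f x)"

interpretation cfun: vector_space "scale_fun :: complex \<Rightarrow> ('a \<Rightarrow> complex) \<Rightarrow> 'a \<Rightarrow> complex"
  by unfold_locales (auto simp: scale_fun_def fun_eq_iff algebra_simps)

section \<open>Projective space\<close>

text \<open>Homogeneous coordinates on the \<open>N\<close>-dimensional projective space are indexed by
  \<open>0, \<dots>, N\<close> and extended by \<open>0\<close>. A point is the set of its homogeneous coordinate vectors.\<close>

definition hom_coords :: "nat \<Rightarrow> (nat \<Rightarrow> complex) set" where
  "hom_coords N = {x. (\<exists>i\<le>N. x i \<noteq> 0) \<and> (\<forall>i>N. x i = 0)}"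

definition proj_point :: "(nat \<Rightarrow> complex) \<Rightarrow> (nat \<Rightarrow> complex) set" where
  "proj_point x = {(\<lambda>i. c * x i) | c. c \<noteq> 0}"

definition proj_space :: "nat \<Rightarrow> (nat \<Rightarrow> complex) set topology" where
  "proj_space N = quotient_top (top_of_set (hom_coords N)) proj_point"

definition affine_patch :: "nat \<Rightarrow> nat \<Rightarrow> (nat \<Rightarrow> complex) set set" where
  "affine_patch N i = proj_point ` {x \<in> hom_coords N. x i \<noteq> 0}"

definition affine_coord :: "nat \<Rightarrow> nat \<Rightarrow> (nat \<Rightarrow> complex) set \<Rightarrow> complex" where
  "affine_coord i j p = (THE c. \<forall>x\<in>p. x j / x i = c)"

section \<open>Embeddings of a torus into projective space\<close>

text \<open>The projection \<open>torus_point L\<close> provides the holomorphic charts of the torus, and the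
  functions \<open>affine_coord i j\<close>, \<open>j \<le> N\<close>, those of projective space on \<open>affine_patch N i\<close>.\<close>

definition lift_coord ::
    "(complex^2) set \<Rightarrow> ((complex^2) set \<Rightarrow> (nat \<Rightarrow> complex) set) \<Rightarrow> nat \<Rightarrow> nat
      \<Rightarrow> complex^2 \<Rightarrow> complex" where
  "lift_coord L f i j z = affine_coord i j (f (torus_point L z))"

definition holomorphic_map ::
    "(complex^2) set \<Rightarrow> nat \<Rightarrow> ((complex^2) set \<Rightarrow> (nat \<Rightarrow> complex) set) \<Rightarrow> bool" where
  "holomorphic_map L N f \<longleftrightarrow>
     continuous_map (torus L) (proj_space N) f \<and>
     (\<forall>i\<le>N. \<forall>j\<le>N.
        holomorphic2_on (lift_coord L f i j) {z. f (torus_point L z) \<in> affine_patch N i})"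

definition immersive ::
    "(complex^2) set \<Rightarrow> nat \<Rightarrow> ((complex^2) set \<Rightarrow> (nat \<Rightarrow> complex) set) \<Rightarrow> bool" where
  "immersive L N f \<longleftrightarrow>
     (\<forall>z. \<forall>i\<le>N. f (torus_point L z) \<in> affine_patch N i \<longrightarrow>
        (\<forall>v. (\<forall>j\<le>N. frechet_derivative (lift_coord L f i j) (at z) v = 0) \<longrightarrow> v = 0))"

text \<open>Embedding as a closed complex submanifold: a holomorphic immersion that is a
  homeomorphism onto a closed image.\<close>

definition closed_embedding ::
    "(complex^2) set \<Rightarrow> nat \<Rightarrow> ((complex^2) set \<Rightarrow> (nat \<Rightarrow> complex) set) \<Rightarrow> bool" where
  "closed_embedding L N f \<longleftrightarrow>
     holomorphic_map L N f \<and> immersive L N f \<and>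
     embedding_map (torus L) (proj_space N) f \<and>
     closedin (proj_space N) (f ` topspace (torus L))"

definition section_basis ::
    "(complex^2) set \<Rightarrow> (complex^2 \<Rightarrow> complex^2 \<Rightarrow> complex) \<Rightarrow> nat
      \<Rightarrow> (nat \<Rightarrow> complex^2 \<Rightarrow> complex) \<Rightarrow> bool" where
  "section_basis L J N \<theta> \<longleftrightarrow>
     inj_on \<theta> {..N} \<and> cfun.independent (\<theta> ` {..N}) \<and> cfun.span (\<theta> ` {..N}) = sections L J"

text \<open>The map \<open>z \<mapsto> [\<theta>\<^sub>0(z) : \<dots> : \<theta>\<^sub>N(z)]\<close> attached to a basis of the space of
  sections is everywhere defined, and is a closed embedding of the torus. The first conjunct
  says that the space of sections is finite-dimensional and nonzero, so that the second one
  is not vacuous.\<close>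

definition sections_embed ::
    "(complex^2) set \<Rightarrow> (complex^2 \<Rightarrow> complex^2 \<Rightarrow> complex) \<Rightarrow> bool" where
  "sections_embed L J \<longleftrightarrow>
     (\<exists>N \<theta>. section_basis L J N \<theta>) \<and>
     (\<forall>N \<theta>. section_basis L J N \<theta> \<longrightarrow>
        (\<forall>z. \<exists>k\<le>N. \<theta> k z \<noteq> 0) \<and>
        (\<exists>f. (\<forall>z. f (torus_point L z) = proj_point (\<lambda>k. if k \<le> N then \<theta> k z else 0)) \<and>
             closed_embedding L N f))"

definition ample ::
    "(complex^2) set \<Rightarrow> (complex^2 \<Rightarrow> complex^2 \<Rightarrow> complex) \<Rightarrow> bool" where
  "ample L J \<longleftrightarrow> (\<forall>n\<ge>3. sections_embed L (tensor_power J n))"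

section \<open>The form \<open>H\<^sub>*\<close>\<close>

definition H_star :: "complex^2 \<Rightarrow> complex^2 \<Rightarrow> complex" where
  "H_star z w = 2 * z$1 * cnj (w$1) + 2 * z$2 * cnj (w$2) + z$1 * cnj (w$2) + z$2 * cnj (w$1)"

definition E_star :: "complex^2 \<Rightarrow> complex^2 \<Rightarrow> real" where
  "E_star z w = Im (H_star z w)"

definition gram_matrix :: "(complex^2 \<Rightarrow> complex^2 \<Rightarrow> real) \<Rightarrow> (complex^2)^4 \<Rightarrow> real^4^4" where
  "gram_matrix E e = (\<chi> i j. E (e $ i) (e $ j))"

section \<open>The period lattice is a lattice of rank 4\<close>

lemma z_basis_period:
  assumes "Im \<tau> > \<bar>Im z\<bar>"
  defines "e \<equiv> vector [vector [\<tau>, z], vector [z, \<tau>], vector [1, 0], vector [0, 1]] :: (complex^2)^4"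
  shows "z_basis (period_lattice (period_matrix \<tau> z)) e"
    and "inj (($) e)" and "independent (range (($) e))"
proof -
  have e: "e $ 1 $ 1 = \<tau>" "e $ 1 $ 2 = z" "e $ 2 $ 1 = z" "e $ 2 $ 2 = \<tau>"
    "e $ 3 $ 1 = 1" "e $ 3 $ 2 = 0" "e $ 4 $ 1 = 0" "e $ 4 $ 2 = 1"
    by (simp_all add: e_def vector_def)
  have key: "a = 0 \<and> b = 0 \<and> c = 0 \<and> d = 0"
    if 1: "of_real a * \<tau> + of_real b * z + of_real c = 0"
      and 2: "of_real a * z + of_real b * \<tau> + of_real d = 0" for a b c d :: real
  proof -
    have i: "a * Im \<tau> + b * Im z = 0" "a * Im z + b * Im \<tau> = 0"
      using arg_cong[OF 1, of Im] arg_cong[OF 2, of Im] by simp_all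
    have "(a + b) * (Im \<tau> + Im z) = 0" "(a - b) * (Im \<tau> - Im z) = 0"
      using i by (simp_all add: algebra_simps)
    then have "a + b = 0" "a - b = 0" using assms(1) by auto
    then have "a = 0" "b = 0" by auto
    with 1 2 show ?thesis by simp
  qed
  have sum4: "(\<Sum>i\<in>UNIV. of_int (c $ i) *s (e $ i)) =
      vector [of_int (c$1) * \<tau> + of_int (c$2) * z + of_int (c$3),
              of_int (c$1) * z + of_int (c$2) * \<tau> + of_int (c$4)]" for c :: "int^4"
    by (simp add: vec_eq_iff forall_2 sum_4 e)
  have inj: "inj (\<lambda>c :: int^4. \<Sum>i\<in>UNIV. of_int (c $ i) *s (e $ i))"
  proof (rule injI)
    fix c d :: "int^4"
    assume "(\<Sum>i\<in>UNIV. of_int (c $ i) *s (e $ i)) = (\<Sum>i\<in>UNIV. of_int (d $ i) *s (e $ i))"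
    then have h: "of_int (c$1) * \<tau> + of_int (c$2) * z + of_int (c$3)
          = of_int (d$1) * \<tau> + of_int (d$2) * z + of_int (d$3)"
        "of_int (c$1) * z + of_int (c$2) * \<tau> + of_int (c$4)
          = of_int (d$1) * z + of_int (d$2) * \<tau> + of_int (d$4)"
      unfolding sum4 by (simp_all add: vec_eq_iff forall_2)
    have "real_of_int (c$1 - d$1) = 0 \<and> real_of_int (c$2 - d$2) = 0 \<and>
          real_of_int (c$3 - d$3) = 0 \<and> real_of_int (c$4 - d$4) = 0"
      by (rule key) (use h in \<open>simp_all add: algebra_simps\<close>)
    then show "c = d" by (simp add: vec_eq_iff forall_4)
  qed
  have im: "range (\<lambda>c :: int^4. \<Sum>i\<in>UNIV. of_int (c $ i) *s (e $ i))
      = period_lattice (period_matrix \<tau> z)"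
  proof (intro subset_antisym subsetI)
    fix x assume "x \<in> range (\<lambda>c :: int^4. \<Sum>i\<in>UNIV. of_int (c $ i) *s (e $ i))"
    then obtain c :: "int^4" where c: "x = (\<Sum>i\<in>UNIV. of_int (c $ i) *s (e $ i))" by blast
    define m n :: "complex^2" where "m = vector [of_int (c$1), of_int (c$2)]"
      and "n = vector [of_int (c$3), of_int (c$4)]"
    have "x = m v* period_matrix \<tau> z + n"
      by (simp add: c sum4 m_def n_def period_matrix_def vec_eq_iff forall_2
            vector_matrix_mult_def sum_2 algebra_simps)
    moreover have "(\<forall>i. m $ i \<in> \<int>) \<and> (\<forall>i. n $ i \<in> \<int>)" by (simp add: m_def n_def forall_2)
    ultimately show "x \<in> period_lattice (period_matrix \<tau> z)"
      unfolding period_lattice_def by blast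
  next
    fix x assume "x \<in> period_lattice (period_matrix \<tau> z)"
    then obtain m n :: "complex^2" where x: "x = m v* period_matrix \<tau> z + n"
      and "\<forall>i. m $ i \<in> \<int>" "\<forall>i. n $ i \<in> \<int>" unfolding period_lattice_def by blast
    then obtain m1 m2 n1 n2 where
      mn: "m$1 = of_int m1" "m$2 = of_int m2" "n$1 = of_int n1" "n$2 = of_int n2"
      by (meson Ints_cases)
    have v: "(vector [m1, m2, n1, n2] :: int^4) $ 1 = m1"
      "(vector [m1, m2, n1, n2] :: int^4) $ 2 = m2"
      "(vector [m1, m2, n1, n2] :: int^4) $ 3 = n1"
      "(vector [m1, m2, n1, n2] :: int^4) $ 4 = n2" by (simp_all add: vector_def)
    have "x = (\<Sum>i\<in>UNIV. of_int ((vector [m1, m2, n1, n2] :: int^4) $ i) *s (e $ i))"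
      unfolding sum4 v
      by (simp add: x period_matrix_def vec_eq_iff forall_2
            vector_matrix_mult_def sum_2 algebra_simps mn)
    then show "x \<in> range (\<lambda>c :: int^4. \<Sum>i\<in>UNIV. of_int (c $ i) *s (e $ i))" by blast
  qed
  show "z_basis (period_lattice (period_matrix \<tau> z)) e"
    using inj im by (simp add: z_basis_def bij_betw_def)
  have \<tau>: "\<tau> \<noteq> z" "\<tau> \<noteq> 1" "\<tau> \<noteq> 0" using assms(1) by auto
  show inje: "inj (($) e)"
  proof (rule injI)
    fix i j :: 4 assume h: "e $ i = e $ j"
    have "e $ i $ 1 = e $ j $ 1" "e $ i $ 2 = e $ j $ 2" using h by simp_all
    then show "i = j" using exhaust_4[of i] exhaust_4[of j] \<tau> by (auto simp: e)
  qed
  show "independent (range (($) e))"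
  proof (rule independent_if_scalars_zero)
    show "finite (range (($) e))" by simp
    fix f x assume s: "(\<Sum>x\<in>range (($) e). f x *\<^sub>R x) = 0" and x: "x \<in> range (($) e)"
    have "(\<Sum>i\<in>UNIV. f (e $ i) *\<^sub>R (e $ i)) = 0"
      using s inje by (simp add: sum.reindex)
    then have "(\<Sum>i\<in>UNIV. f (e $ i) *\<^sub>R (e $ i)) $ 1 = 0"
        "(\<Sum>i\<in>UNIV. f (e $ i) *\<^sub>R (e $ i)) $ 2 = 0" by simp_all
    then have "f (e$1) = 0 \<and> f (e$2) = 0 \<and> f (e$3) = 0 \<and> f (e$4) = 0"
      by (intro key) (simp_all add: sum_4 e scaleR_conv_of_real[where 'a = complex])
    then have "\<forall>i. f (e $ i) = 0" by (simp add: forall_4)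
    with x show "f x = 0" by blast
  qed
qed

lemma lattice4_period:
  assumes "Im \<tau> > \<bar>Im z\<bar>"
  shows "lattice4 (period_lattice (period_matrix \<tau> z))"
  using z_basis_period[OF assms] unfolding lattice4_def by blast

end

theory Submission
  imports Defs "HOL-Complex_Analysis.Conformal_Mappings" "HOL-Real_Asymp.Real_Asymp"
begin

text \<open>Write \<open>S = (2 1; 1 2)\<close> for the matrix of \<open>H\<^sub>*\<close>. Since \<open>S\<close> and \<open>\<Omega>\<close> are symmetric circulant matrices, they
commute, and \<open>M = S Im \<Omega>\<close> is the circulant matrix with entries \<open>a = Im(2\<tau> + z)\<close> and \<open>b = Im(\<tau> + 2z)\<close>.
In the basis given by the rows of \<open>\<Omega>\<close> and the unit vectors, \<open>E\<^sub>*\<close> has the matrix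
\<open>(0 M; -M 0)\<close>. Hence it is integral exactly because \<open>a\<close> and \<open>b\<close> are integers, and
\<open>sqrt(det E\<^sub>*) = det M = a\<^sup>2 - b\<^sup>2 = 3((Im \<tau>)\<^sup>2 - (Im z)\<^sup>2)\<close>. Positivity is the identity
\<open>H\<^sub>*(x, x) = |x\<^sub>1|\<^sup>2 + |x\<^sub>2|\<^sup>2 + |x\<^sub>1 + x\<^sub>2|\<^sup>2\<close>.

A holomorphic section of the \<open>k\<close>-th power of the line bundle becomes a classical theta function \<open>f\<close> after
a translation and division by the exponential of a quadratic polynomial (\<open>auto_factor_trivialized\<close>): \<open>f\<close> is
periodic under \<open>\<int>\<^sup>2\<close>, and adding \<open>m\<Omega>\<close> to the argument multiplies \<open>f\<close> by an exponential factor. It therefore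
has a Fourier expansion. The quasi-periodicity says that the coefficients, divided by
the Gaussian \<open>exp(\<pi>i p\<Omega>M\<^sup>-\<^sup>1p / k)\<close>, depend only on the class of \<open>p\<close> modulo \<open>kM\<int>\<^sup>2\<close>; and as
\<open>Im(\<Omega>M\<^sup>-\<^sup>1) = S\<^sup>-\<^sup>1\<close> is positive definite, every function on the finite set of classes occurs. So the sections
have dimension \<open>k\<^sup>2 det M\<close> (\<open>theta_space_basis\<close>), which for \<open>k = 1\<close> is the dimension formula.

For the embedding by the \<open>n\<close>-th power, \<open>n \<ge> 3\<close>, the argument of Lefschetz is used. If \<open>t\<close> is a theta function
for \<open>k = 1\<close>, then \<open>t(y - u) t(y - v) t(y - (s - u - v)) t(y - c)\<^bsup>n-3\<^esup>\<close>, with \<open>s = -(n - 3)c\<close>, is one for \<open>k = n\<close>,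
whatever \<open>u\<close> and \<open>v\<close> are (\<open>theta_product_in\<close>). Suitable \<open>u\<close> and \<open>v\<close> show that there are no
base points. If \<open>y1\<close> and \<open>y2\<close> have the same image, then \<open>F(u) = t(y1 - u)\<close> and \<open>G(u) = t(y2 - u)\<close>
satisfy \<open>F(u)F(v)F(s - u - v) = l G(u)G(v)G(s - u - v)\<close>, and such an identity forces \<open>F / G\<close> to be the exponential
of an affine function (\<open>product_rigidity\<close>). Thus translation by \<open>y1 - y2\<close> acts on the Fourier coefficients of
\<open>t\<close> by a shift and a character. Applied to the theta series of a single coset and to the one
with all coefficients nonzero, this puts \<open>y1 - y2\<close> into the lattice (\<open>theta_space_separates_points\<close>). The same
argument for the logarithmic derivative shows that the differential is injective
(\<open>theta_space_separates_tangents\<close>). Finally, a continuous injective map from the compact torus to the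
Hausdorff projective space is a closed embedding (\<open>closed_embedding_criterion\<close>).\<close>

section \<open>Rigidity of entire functions\<close>

text \<open>Holomorphy along every complex line reduces the rigidity argument to one complex variable. It passes
  to quotients of functions at once, since only the points of one line have to be considered.\<close>

definition line_holomorphic :: "(complex^2 \<Rightarrow> complex) \<Rightarrow> bool" where
  "line_holomorphic f \<longleftrightarrow> (\<forall>x v. (\<lambda>t. f (x + t *s v)) holomorphic_on UNIV)"

lemma line_holomorphicD: "line_holomorphic f \<Longrightarrow> (\<lambda>t. f (x + t *s v)) holomorphic_on UNIV"
  by (simp add: line_holomorphic_def)

lemma line_holomorphic_const [intro]: "line_holomorphic (\<lambda>x. c)"
  by (simp add: line_holomorphic_def)

lemma line_holomorphic_add [intro]:
  "line_holomorphic f \<Longrightarrow> line_holomorphic g \<Longrightarrow> line_holomorphic (\<lambda>x. f x + g x)"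
  by (auto simp: line_holomorphic_def intro!: holomorphic_intros)

lemma line_holomorphic_diff [intro]:
  "line_holomorphic f \<Longrightarrow> line_holomorphic g \<Longrightarrow> line_holomorphic (\<lambda>x. f x - g x)"
  by (auto simp: line_holomorphic_def intro!: holomorphic_intros)

lemma line_holomorphic_mult [intro]:
  "line_holomorphic f \<Longrightarrow> line_holomorphic g \<Longrightarrow> line_holomorphic (\<lambda>x. f x * g x)"
  by (auto simp: line_holomorphic_def intro!: holomorphic_intros)

lemma line_holomorphic_reflect:
  assumes "line_holomorphic f" shows "line_holomorphic (\<lambda>x. f (c - x))"
proof -
  have "c - (x + t *s v) = (c - x) + t *s (- v)" for x v :: "complex^2" and t
    by (simp add: vec_eq_iff algebra_simps)
  note eq = this
  show ?thesis
    unfolding line_holomorphic_def eq using line_holomorphicD[OF assms] by blast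
qed

lemma line_holomorphic_reflect2:
  assumes "line_holomorphic f" shows "line_holomorphic (\<lambda>x. f (c - x - d))"
  using line_holomorphic_reflect[OF assms, of "c - d"] by (simp add: algebra_simps)

lemma entire_mult_eq_0:
  fixes f g :: "complex \<Rightarrow> complex"
  assumes f: "f holomorphic_on UNIV" and g: "g holomorphic_on UNIV"
    and 0: "\<And>t. f t * g t = 0" and s: "f s \<noteq> 0"
  shows "g t = 0"
proof -
  have "continuous_on UNIV f" using f by (rule holomorphic_on_imp_continuous_on)
  then have "open {t. f t \<noteq> 0}"
    by (intro open_Collect_neq) auto
  moreover have "\<And>t. t \<in> {t. f t \<noteq> 0} \<Longrightarrow> g t = 0" using 0 by auto
  ultimately show ?thesis
    using analytic_continuation_open[of "{t. f t \<noteq> 0}" UNIV g "\<lambda>_. 0" t] s g by auto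
qed

text \<open>Two points lie on a common complex line, and the entire functions of one variable form an integral
  domain; hence so do the functions considered here, although their zeros need not be isolated.\<close>

lemma line_holomorphic_mult_eq_0:
  assumes f: "line_holomorphic f" and g: "line_holomorphic g"
    and 0: "\<And>x. f x * g x = 0" and s: "f s \<noteq> 0"
  shows "g x = 0"
proof -
  have "(\<lambda>t. g (s + t *s (x - s))) 1 = 0"
    by (rule entire_mult_eq_0[OF line_holomorphicD[OF f] line_holomorphicD[OF g], of s "x - s" s "x-s" 0])
       (use 0 s in auto)
  then show ?thesis by simp
qed

lemma line_holomorphic_common_nonzero:
  assumes "line_holomorphic f" "line_holomorphic g" "f s \<noteq> 0" "g t \<noteq> 0"
  shows "\<exists>x. f x \<noteq> 0 \<and> g x \<noteq> 0"
  using line_holomorphic_mult_eq_0[OF assms(1,2) _ assms(3)] assms(4) mult_eq_0_iff by metis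

text \<open>If \<open>D\<close> and \<open>F\<close> have proportional companions \<open>Q\<close> and \<open>P\<close>, depending on a parameter \<open>b\<close> that
  can be chosen so that \<open>P\<close> does not vanish at a given point, then \<open>D / F = Q / P\<close> has no poles. Two
  choices of \<open>b\<close> give the same quotient: cancel \<open>F\<close> from \<open>F (Q P' - Q' P) = 0\<close>.\<close>

lemma line_holomorphic_quotient:
  assumes D: "line_holomorphic D" and F: "line_holomorphic F" "F x0 \<noteq> 0"
    and P: "\<And>b. line_holomorphic (\<lambda>a. P a b)" and Q: "\<And>b. line_holomorphic (\<lambda>a. Q a b)"
    and eq: "\<And>a b. D a * P a b = Q a b * F a" and ex: "\<And>a. \<exists>b. P a b \<noteq> 0"
  obtains h where "line_holomorphic h" "\<And>a. D a = h a * F a"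
proof -
  have QP: "Q a b * P a b' - Q a b' * P a b = 0" for a b b'
  proof (rule line_holomorphic_mult_eq_0[OF F(1) _ _ F(2), where g = "\<lambda>a. Q a b * P a b' - Q a b' * P a b"])
    show "line_holomorphic (\<lambda>a. Q a b * P a b' - Q a b' * P a b)"
      using P Q by (intro line_holomorphic_diff line_holomorphic_mult)
    show "F x * (Q x b * P x b' - Q x b' * P x b) = 0" for x
    proof -
      have "F x * (Q x b * P x b' - Q x b' * P x b)
          = (Q x b * F x) * P x b' - (Q x b' * F x) * P x b" by (simp add: algebra_simps)
      also have "\<dots> = 0" unfolding eq[symmetric] by (simp add: mult_ac)
      finally show ?thesis .
    qed
  qed
  obtain \<beta> where \<beta>: "\<And>a. P a (\<beta> a) \<noteq> 0" using ex by metis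
  define h where "h a = Q a (\<beta> a) / P a (\<beta> a)" for a
  have hP: "Q a b = h a * P a b" for a b
    using QP[of a b "\<beta> a"] \<beta>[of a] by (simp add: h_def field_simps)
  have "line_holomorphic h"
    unfolding line_holomorphic_def
  proof (intro allI)
    fix x v :: "complex^2"
    have "(\<lambda>t. h (x + t *s v)) field_differentiable at t0" for t0
    proof -
      define b where "b = \<beta> (x + t0 *s v)"
      have hp: "(\<lambda>t. P (x + t *s v) b) holomorphic_on UNIV" "(\<lambda>t. Q (x + t *s v) b) holomorphic_on UNIV"
        using P Q line_holomorphicD by blast+
      have op: "open {t. P (x + t *s v) b \<noteq> 0}"
        by (intro open_Collect_neq holomorphic_on_imp_continuous_on[OF hp(1)]) auto
      have "(\<lambda>t. Q (x + t *s v) b / P (x + t *s v) b) holomorphic_on {t. P (x + t *s v) b \<noteq> 0}"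
        using hp by (intro holomorphic_on_divide) (auto intro: holomorphic_on_subset)
      then have "(\<lambda>t. h (x + t *s v)) holomorphic_on {t. P (x + t *s v) b \<noteq> 0}"
        by (rule holomorphic_transform) (simp add: hP)
      then show ?thesis
        using op \<beta> by (auto simp: holomorphic_on_open field_differentiable_def b_def)
    qed
    then show "(\<lambda>t. h (x + t *s v)) holomorphic_on UNIV"
      by (simp add: holomorphic_on_def)
  qed
  moreover have "D a = h a * F a" for a
    using eq[of a "\<beta> a"] \<beta>[of a] by (simp add: hP)
  ultimately show thesis by (rule that)
qed

lemma entire_exponential:
  fixes k :: "complex \<Rightarrow> complex"
  assumes k: "k holomorphic_on UNIV" and eq: "\<And>s t. k (s + t) = k s * k t" and 1: "k 0 = 1"
  obtains c where "\<And>t. k t = exp (c * t)"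
proof -
  define c where "c = deriv k 0"
  have d: "(k has_field_derivative deriv k t) (at t)" for t
    using k by (simp add: holomorphic_derivI)
  have kd: "deriv k t = k t * c" for t
  proof -
    have "((\<lambda>u. k (u + t)) has_field_derivative deriv k t) (at 0)"
      using d[of t] DERIV_shift[of k _ 0 t] by simp
    moreover have "((\<lambda>u. k (u + t)) has_field_derivative c * k t) (at 0)"
      unfolding eq c_def by (intro DERIV_cmult_right d)
    ultimately show ?thesis using DERIV_unique by (metis mult.commute)
  qed
  have "((\<lambda>t. k t * exp (- c * t)) has_field_derivative 0) (at t)" for t
    by (rule derivative_eq_intros d refl | simp add: kd algebra_simps)+
  then obtain C where C: "\<And>t. k t * exp (- c * t) = C"
    using has_field_derivative_zero_constant[of UNIV "\<lambda>t. k t * exp (- c * t)"] by auto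
  have "C = 1" using C[of 0] 1 by simp
  then have "k t = exp (c * t)" for t using C[of t] by (simp add: exp_minus field_simps)
  then show thesis by (rule that)
qed

lemma entire_additive:
  fixes k :: "complex \<Rightarrow> complex"
  assumes k: "k holomorphic_on UNIV" and eq: "\<And>s t. k (s + t) = k s + k t"
  obtains c where "\<And>t. k t = c * t"
proof -
  define c where "c = deriv k 0"
  have d: "(k has_field_derivative deriv k t) (at t)" for t
    using k by (simp add: holomorphic_derivI)
  have kd: "deriv k t = c" for t
  proof -
    have "((\<lambda>u. k (u + t)) has_field_derivative deriv k t) (at 0)"
      using d[of t] DERIV_shift[of k _ 0 t] by simp
    moreover have "((\<lambda>u. k (u + t)) has_field_derivative c + 0) (at 0)"
      unfolding eq c_def by (intro DERIV_add DERIV_const d)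
    ultimately show ?thesis using DERIV_unique by force
  qed
  have "((\<lambda>t. k t - c * t) has_field_derivative 0) (at t)" for t
    by (rule derivative_eq_intros d refl | simp add: kd)+
  then obtain C where C: "\<And>t. k t - c * t = C"
    using has_field_derivative_zero_constant[of UNIV "\<lambda>t. k t - c * t"] by auto
  have "C = 0" using C[of 0] eq[of 0 0] by simp
  then have "k t = c * t" for t using C[of t] by simp
  then show thesis by (rule that)
qed

lemma vec2_eq_axes: "(x::complex^2) = x$1 *s axis 1 1 + x$2 *s axis 2 (1::complex)"
  by (simp add: vec_eq_iff forall_2 axis_def)

text \<open>The sum \<open>g(a) + g(b)\<close> depends on \<open>a + b\<close> only, so \<open>g - g(0)\<close> is additive; being entire along
  the two axes, it is complex linear.\<close>

lemma line_holomorphic_translation_sum_const: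
  assumes g: "line_holomorphic g" and eq: "\<And>a b. g a + g b + g (s - a - b) = l"
  shows "\<exists>c d1 d2. \<forall>x. g x = c + d1 * x$1 + d2 * x$2"
proof -
  define k where "k x = g x - g 0" for x
  have kadd: "k (x + y) = k x + k y" for x y
  proof -
    have "g x + g y + g (s - x - y) = g (x + y) + g 0 + g (s - x - y)"
      using eq[of x y] eq[of "x + y" 0] by (simp add: diff_diff_eq)
    then have "g x + g y = g (x + y) + g 0" by (simp only: add_right_cancel)
    then show ?thesis by (simp add: k_def algebra_simps)
  qed
  have lin: "\<exists>c. \<forall>t. k (t *s v) = c * t" for v
  proof -
    have "(\<lambda>t. k (0 + t *s v)) holomorphic_on UNIV"
      unfolding k_def by (intro holomorphic_intros line_holomorphicD[OF g])
    then show ?thesis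
      by (rule entire_additive[of "\<lambda>t. k (0 + t *s v)"]) (auto simp: kadd vector_sadd_rdistrib)
  qed
  obtain d1 d2 where d: "\<And>t. k (t *s axis 1 1) = d1 * t" "\<And>t. k (t *s axis 2 1) = d2 * t"
    using lin by metis
  have "g x = g 0 + d1 * x$1 + d2 * x$2" for x
  proof -
    have "k x = k (x$1 *s axis 1 1) + k (x$2 *s axis 2 1)"
      by (subst vec2_eq_axes[of x]) (rule kadd)
    then show ?thesis by (simp add: d) (simp add: k_def algebra_simps)
  qed
  then show ?thesis by blast
qed

lemma line_holomorphic_translation_prod_const:
  assumes h: "line_holomorphic h" and eq: "\<And>a b. h a * h b * h (s - a - b) = l" and l: "l \<noteq> 0"
  shows "\<exists>C d1 d2. C \<noteq> 0 \<and> (\<forall>x. h x = C * exp (d1 * x$1 + d2 * x$2))"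
proof -
  have nz: "h x \<noteq> 0" for x using eq[of x 0] l by auto
  define k where "k x = h x / h 0" for x
  have kmult: "k (x + y) = k x * k y" for x y
  proof -
    have "h x * h y * h (s - x - y) = h (x + y) * h 0 * h (s - x - y)"
      using eq[of x y] eq[of "x + y" 0] by (simp add: diff_diff_eq)
    then have "h x * h y = h (x + y) * h 0" using nz[of "s - x - y"] by simp
    then show ?thesis using nz[of 0] by (simp add: k_def field_simps)
  qed
  have lin: "\<exists>c. \<forall>t. k (t *s v) = exp (c * t)" for v
  proof -
    have "(\<lambda>t. k (0 + t *s v)) holomorphic_on UNIV"
      unfolding k_def by (intro holomorphic_intros line_holomorphicD[OF h]) (simp add: nz)
    then show ?thesis
      by (rule entire_exponential[of "\<lambda>t. k (0 + t *s v)"])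
         (use nz in \<open>auto simp: kmult vector_sadd_rdistrib k_def[of 0]\<close>)
  qed
  obtain d1 d2 where d: "\<And>t. k (t *s axis 1 1) = exp (d1 * t)" "\<And>t. k (t *s axis 2 1) = exp (d2 * t)"
    using lin by metis
  have "h x = h 0 * exp (d1 * x$1 + d2 * x$2)" for x
  proof -
    have "k x = k (x$1 *s axis 1 1) * k (x$2 *s axis 2 1)"
      by (subst vec2_eq_axes[of x]) (rule kmult)
    then show ?thesis using nz[of 0] by (simp add: d exp_add) (simp add: k_def field_simps)
  qed
  with nz show ?thesis by blast
qed

text \<open>The factor \<open>F(a)F(b)F(s - a - b)\<close> is cancelled one variable at a time.\<close>

lemma line_holomorphic_triple_mult_eq_0:
  assumes F: "line_holomorphic F" "F x0 \<noteq> 0"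
    and X: "\<And>b. line_holomorphic (\<lambda>a. X a b)" "\<And>a. line_holomorphic (\<lambda>b. X a b)"
    and eq: "\<And>a b. X a b * (F a * F b * F (s - a - b)) = 0"
  shows "X a b = 0"
proof -
  have X1: "X a b * F b = 0" for a b
  proof -
    have "F (s - (s - b - x0) - b) \<noteq> 0" using F(2) by simp
    from line_holomorphic_common_nonzero[OF F(1) line_holomorphic_reflect2[OF F(1)] F(2) this]
    obtain u where u: "F u \<noteq> 0" "F (s - u - b) \<noteq> 0" by blast
    show ?thesis
    proof (rule line_holomorphic_mult_eq_0[where f = "\<lambda>a. F a * F (s - a - b)" and g = "\<lambda>a. X a b * F b" and s = u])
      show "line_holomorphic (\<lambda>a. F a * F (s - a - b))" "line_holomorphic (\<lambda>a. X a b * F b)"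
        by (intro line_holomorphic_mult F(1) line_holomorphic_reflect2[OF F(1)] X(1) line_holomorphic_const)+
      show "F x * F (s - x - b) * (X x b * F b) = 0" for x using eq[of x b] by auto
    qed (use u in simp)
  qed
  show ?thesis
    by (rule line_holomorphic_mult_eq_0[OF F(1) X(2) _ F(2)]) (simp add: X1 mult.commute[of "F _"])
qed

text \<open>The quotient \<open>h = F / G\<close> is entire: near a given \<open>a\<close>, choose \<open>b\<close> such that the other two factors on
  the left do not vanish. Then \<open>h(a)h(b)h(s - a - b) = l\<close>, which forces \<open>h\<close> to be the exponential of an
  affine function.\<close>

lemma product_rigidity:
  assumes F: "line_holomorphic F" "F x0 \<noteq> 0" and G: "line_holomorphic G" "G y0 \<noteq> 0" and l: "l \<noteq> 0"
    and eq: "\<And>a b. F a * F b * F (s - a - b) = l * (G a * G b * G (s - a - b))"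
  shows "\<exists>C d1 d2. C \<noteq> 0 \<and> (\<forall>x. F x = C * exp (d1 * x$1 + d2 * x$2) * G x)"
proof -
  have r: "line_holomorphic (\<lambda>b. f (s - a - b))" if "line_holomorphic f" for f a
    using line_holomorphic_reflect[OF that] .
  have ex: "\<exists>b. F b * F (s - a - b) \<noteq> 0" for a
  proof -
    have "F (s - a - (s - a - x0)) \<noteq> 0" using F(2) by simp
    from line_holomorphic_common_nonzero[OF F(1) r[OF F(1)] F(2) this] show ?thesis by auto
  qed
  obtain h where h: "line_holomorphic h" "\<And>a. F a = h a * G a"
  proof (rule line_holomorphic_quotient[OF F(1) G, of "\<lambda>a b. F b * F (s - a - b)"
        "\<lambda>a b. l * (G b * G (s - a - b))"])
    show "line_holomorphic (\<lambda>a. F b * F (s - a - b))" "line_holomorphic (\<lambda>a. l * (G b * G (s - a - b)))" for b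
      by (intro line_holomorphic_mult line_holomorphic_const F(1) G(1)
          line_holomorphic_reflect2[OF F(1)] line_holomorphic_reflect2[OF G(1)])+
    show "F a * (F b * F (s - a - b)) = l * (G b * G (s - a - b)) * G a" for a b
      using eq[of a b] by (simp add: mult_ac)
    show "\<exists>b. F b * F (s - a - b) \<noteq> 0" for a by (rule ex)
    fix h assume "line_holomorphic h" "\<And>a. F a = h a * G a"
    then show thesis by (rule that)
  qed
  have "h a * h b * h (s - a - b) - l = 0" for a b
  proof (rule line_holomorphic_triple_mult_eq_0[OF G, where X = "\<lambda>a b. h a * h b * h (s - a - b) - l"])
    show "line_holomorphic (\<lambda>a. h a * h b * h (s - a - b) - l)"
        "line_holomorphic (\<lambda>b. h a * h b * h (s - a - b) - l)" for a b
      by (intro line_holomorphic_diff line_holomorphic_mult line_holomorphic_const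
            h(1) line_holomorphic_reflect2[OF h(1)] line_holomorphic_reflect[OF h(1)])+
    show "(h a * h b * h (s - a - b) - l) * (G a * G b * G (s - a - b)) = 0" for a b
      using eq[of a b] h(2) by (simp add: algebra_simps)
  qed
  then have hc: "h a * h b * h (s - a - b) = l" for a b by simp
  have "\<exists>C d1 d2. C \<noteq> 0 \<and> (\<forall>x. h x = C * exp (d1 * x$1 + d2 * x$2))"
    by (rule line_holomorphic_translation_prod_const[where h = h and s = s and l = l, OF h(1) _ l]) (rule hc)
  then obtain C d1 d2 where C: "C \<noteq> 0" "\<And>x. h x = C * exp (d1 * x$1 + d2 * x$2)"
    by blast
  then have "F x = C * exp (d1 * x$1 + d2 * x$2) * G x" for x by (simp add: h(2))
  with C(1) show ?thesis by blast
qed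

text \<open>The infinitesimal form of \<open>product_rigidity\<close>, with \<open>D\<close> in the role of a derivative of \<open>F\<close>: the
  logarithmic derivative \<open>D / F\<close> is entire, and its values at \<open>a\<close>, \<open>b\<close> and \<open>s - a - b\<close> have a
  constant sum.\<close>

lemma derivation_rigidity:
  assumes F: "line_holomorphic F" "F x0 \<noteq> 0" and D: "line_holomorphic D"
    and eq: "\<And>a b. D a * F b * F (s - a - b) + F a * D b * F (s - a - b) + F a * F b * D (s - a - b)
        = l * (F a * F b * F (s - a - b))"
  shows "\<exists>c d1 d2. \<forall>x. D x = (c + d1 * x$1 + d2 * x$2) * F x"
proof -
  have r: "line_holomorphic (\<lambda>b. f (s - a - b))" if "line_holomorphic f" for f a
    using line_holomorphic_reflect[OF that] .
  have ex: "\<exists>b. F b * F (s - a - b) \<noteq> 0" for a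
  proof -
    have "F (s - a - (s - a - x0)) \<noteq> 0" using F(2) by simp
    from line_holomorphic_common_nonzero[OF F(1) r[OF F(1)] F(2) this] show ?thesis by auto
  qed
  obtain g where g: "line_holomorphic g" "\<And>a. D a = g a * F a"
  proof (rule line_holomorphic_quotient[OF D F, of "\<lambda>a b. F b * F (s - a - b)"
        "\<lambda>a b. l * (F b * F (s - a - b)) - D b * F (s - a - b) - F b * D (s - a - b)"])
    show "line_holomorphic (\<lambda>a. F b * F (s - a - b))"
      "line_holomorphic (\<lambda>a. l * (F b * F (s - a - b)) - D b * F (s - a - b) - F b * D (s - a - b))" for b
      by (intro line_holomorphic_mult line_holomorphic_const line_holomorphic_diff F(1) D
          line_holomorphic_reflect2[OF F(1)] line_holomorphic_reflect2[OF D])+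
    show "D a * (F b * F (s - a - b)) =
        (l * (F b * F (s - a - b)) - D b * F (s - a - b) - F b * D (s - a - b)) * F a" for a b
      using eq[of a b] by (simp add: algebra_simps)
    show "\<exists>b. F b * F (s - a - b) \<noteq> 0" for a by (rule ex)
    fix h assume "line_holomorphic h" "\<And>a. D a = h a * F a"
    then show thesis by (rule that)
  qed
  have "g a + g b + g (s - a - b) - l = 0" for a b
  proof (rule line_holomorphic_triple_mult_eq_0[OF F, where X = "\<lambda>a b. g a + g b + g (s - a - b) - l"])
    show "line_holomorphic (\<lambda>a. g a + g b + g (s - a - b) - l)"
        "line_holomorphic (\<lambda>b. g a + g b + g (s - a - b) - l)" for a b
      by (intro line_holomorphic_diff line_holomorphic_add line_holomorphic_const
            g(1) line_holomorphic_reflect2[OF g(1)] line_holomorphic_reflect[OF g(1)])+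
    show "(g a + g b + g (s - a - b) - l) * (F a * F b * F (s - a - b)) = 0" for a b
      using eq[of a b] g(2) by (simp add: algebra_simps)
  qed
  then have gc: "g a + g b + g (s - a - b) = l" for a b by simp
  have "\<exists>c d1 d2. \<forall>x. g x = c + d1 * x$1 + d2 * x$2"
    by (rule line_holomorphic_translation_sum_const[where g = g and s = s and l = l, OF g(1)]) (rule gc)
  then obtain c d1 d2 where c: "\<And>x. g x = c + d1 * x$1 + d2 * x$2"
    by blast
  then have "D x = (c + d1 * x$1 + d2 * x$2) * F x" for x by (simp add: g(2))
  then show ?thesis by blast
qed

section \<open>Holomorphic functions of two variables\<close>

lemma bounded_linear_scale_vec: "bounded_linear (\<lambda>t::complex. t *s (v::complex^2))"
  by (rule linear_conv_bounded_linear[THEN iffD1])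
     (auto intro!: linearI simp: vec_eq_iff algebra_simps)

lemma holomorphic2_on_const: "holomorphic2_on (\<lambda>x. c) S"
  unfolding holomorphic2_on_def by (intro ballI exI[of _ "\<lambda>_. 0"]) auto

lemma holomorphic2_on_nth: "holomorphic2_on (\<lambda>x. x $ i) S"
  unfolding holomorphic2_on_def
  by (intro ballI exI[of _ "\<lambda>x. x $ i"] conjI bounded_linear.has_derivative[OF bounded_linear_vec_nth]
        has_derivative_ident) auto

lemma holomorphic2_on_add:
  assumes "holomorphic2_on f S" "holomorphic2_on g S"
  shows "holomorphic2_on (\<lambda>x. f x + g x) S"
  unfolding holomorphic2_on_def
proof
  fix x assume "x \<in> S"
  then obtain D E where "(f has_derivative D) (at x)" "\<And>c v. D (c *s v) = c * D v"
    "(g has_derivative E) (at x)" "\<And>c v. E (c *s v) = c * E v"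
    using assms unfolding holomorphic2_on_def by metis
  then show "\<exists>D. ((\<lambda>x. f x + g x) has_derivative D) (at x) \<and> (\<forall>c v. D (c *s v) = c * D v)"
    by (intro exI[of _ "\<lambda>v. D v + E v"]) (auto intro!: derivative_eq_intros simp: algebra_simps)
qed

lemma holomorphic2_on_mult:
  assumes "holomorphic2_on f S" "holomorphic2_on g S"
  shows "holomorphic2_on (\<lambda>x. f x * g x) S"
  unfolding holomorphic2_on_def
proof
  fix x assume "x \<in> S"
  then obtain D E where "(f has_derivative D) (at x)" "\<And>c v. D (c *s v) = c * D v"
    "(g has_derivative E) (at x)" "\<And>c v. E (c *s v) = c * E v"
    using assms unfolding holomorphic2_on_def by metis
  then show "\<exists>D. ((\<lambda>x. f x * g x) has_derivative D) (at x) \<and> (\<forall>c v. D (c *s v) = c * D v)"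
    by (intro exI[of _ "\<lambda>v. f x * E v + D v * g x"]) (auto intro!: derivative_eq_intros simp: algebra_simps)
qed

lemma holomorphic2_on_power: "holomorphic2_on f S \<Longrightarrow> holomorphic2_on (\<lambda>x. f x ^ n) S"
  by (induction n) (auto intro: holomorphic2_on_const holomorphic2_on_mult)

lemma holomorphic2_on_compose:
  assumes "holomorphic2_on f S" and g: "\<And>x. x \<in> S \<Longrightarrow> (g has_field_derivative g' x) (at (f x))"
  shows "holomorphic2_on (\<lambda>x. g (f x)) S"
  unfolding holomorphic2_on_def
proof
  fix x assume x: "x \<in> S"
  then obtain D where D: "(f has_derivative D) (at x)" "\<And>c v. D (c *s v) = c * D v"
    using assms unfolding holomorphic2_on_def by metis
  have "((\<lambda>x. g (f x)) has_derivative (\<lambda>v. g' x * D v)) (at x)"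
    using has_derivative_compose[OF D(1) g[OF x, unfolded has_field_derivative_def]] by simp
  then show "\<exists>D. ((\<lambda>x. g (f x)) has_derivative D) (at x) \<and> (\<forall>c v. D (c *s v) = c * D v)"
    by (intro exI[of _ "\<lambda>v. g' x * D v"]) (auto simp: D(2))
qed

lemma holomorphic2_on_exp: "holomorphic2_on f S \<Longrightarrow> holomorphic2_on (\<lambda>x. exp (f x)) S"
  by (rule holomorphic2_on_compose) (auto intro!: derivative_eq_intros)

lemma holomorphic2_on_divide:
  assumes "holomorphic2_on f S" "holomorphic2_on g S" "\<And>x. x \<in> S \<Longrightarrow> g x \<noteq> 0"
  shows "holomorphic2_on (\<lambda>x. f x / g x) S"
proof -
  have "holomorphic2_on (\<lambda>x. inverse (g x)) S"
    by (rule holomorphic2_on_compose[OF assms(2), of inverse "\<lambda>x. - (inverse (g x) * inverse (g x))"])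
       (use assms(3) in \<open>auto intro!: derivative_eq_intros\<close>)
  from holomorphic2_on_mult[OF assms(1) this] show ?thesis by (simp add: divide_inverse)
qed

lemma holomorphic2_on_translate:
  assumes "holomorphic2_on f UNIV"
  shows "holomorphic2_on (\<lambda>x. f (x + w)) S"
  unfolding holomorphic2_on_def
proof
  fix x assume "x \<in> S"
  obtain D where D: "(f has_derivative D) (at (x + w))" "\<And>c v. D (c *s v) = c * D v"
    using assms unfolding holomorphic2_on_def by blast
  have "((\<lambda>x. x + w) has_derivative (\<lambda>v. v)) (at x)" by (auto intro!: derivative_eq_intros)
  from has_derivative_compose[OF this D(1)]
  show "\<exists>D. ((\<lambda>x. f (x + w)) has_derivative D) (at x) \<and> (\<forall>c v. D (c *s v) = c * D v)"
    using D(2) by blast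
qed

lemma holomorphic2_on_subset: "holomorphic2_on f S \<Longrightarrow> T \<subseteq> S \<Longrightarrow> holomorphic2_on f T"
  by (auto simp: holomorphic2_on_def)

lemma holomorphic2_on_imp_continuous_on: "holomorphic2_on f S \<Longrightarrow> continuous_on S f"
  unfolding holomorphic2_on_def
  by (meson continuous_at_imp_continuous_on has_derivative_continuous)

lemma holomorphic2_along_line:
  fixes x v :: "complex^2"
  assumes "(f has_derivative D) (at (x + t *s v))" "\<And>c v. D (c *s v) = c * D v"
  shows "((\<lambda>t. f (x + t *s v)) has_field_derivative D v) (at t)"
proof -
  have "((\<lambda>t. x + t *s v) has_derivative (\<lambda>h. h *s v)) (at t)"
    using has_derivative_add[OF has_derivative_const[of x]
        bounded_linear.has_derivative[OF bounded_linear_scale_vec[of v] has_derivative_ident], of "at t"] by simp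
  from has_derivative_compose[OF this assms(1)] show ?thesis
    unfolding has_field_derivative_def by (simp add: assms(2) mult_commute_abs)
qed

lemma holomorphic2_imp_line_holomorphic:
  assumes "holomorphic2_on f UNIV"
  shows "line_holomorphic f"
  unfolding line_holomorphic_def holomorphic_on_def
proof (intro allI ballI)
  fix x v t
  obtain D where D: "(f has_derivative D) (at (x + t *s v))" "\<And>c v. D (c *s v) = c * D v"
    using assms unfolding holomorphic2_on_def by blast
  show "(\<lambda>t. f (x + t *s v)) field_differentiable at t within UNIV"
    using holomorphic2_along_line[OF D] by (auto simp: field_differentiable_def)
qed

text \<open>Cauchy's estimate bounds the difference of the directional derivatives at two points by the
  difference of the function on the unit circles around them; so uniform continuity on compact
  sets gives continuity of the directional derivative.\<close>

lemma continuous_directional_deriv: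
  assumes f: "holomorphic2_on f UNIV"
  shows "continuous_on UNIV (\<lambda>x. deriv (\<lambda>t. f (x + t *s v)) 0)"
proof (rule continuous_at_imp_continuous_on, rule ballI)
  fix x0 :: "complex^2"
  have hol: "(\<lambda>t. f (x + t *s v)) holomorphic_on UNIV" for x
    using holomorphic2_imp_line_holomorphic[OF f] by (rule line_holomorphicD)
  define K where "K = cball x0 (1 + norm v)"
  have "continuous_on K f"
    using holomorphic2_on_imp_continuous_on[OF f] continuous_on_subset by blast
  then have uc: "uniformly_continuous_on K f"
    by (intro compact_uniformly_continuous) (auto simp: K_def)
  show "isCont (\<lambda>x. deriv (\<lambda>t. f (x + t *s v)) 0) x0"
    unfolding continuous_at_eps_delta
  proof (intro allI impI)
    fix e :: real assume e: "e > 0"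
    then obtain d where d: "d > 0" "\<And>x y. x \<in> K \<Longrightarrow> y \<in> K \<Longrightarrow> dist x y < d \<Longrightarrow> dist (f x) (f y) < e/2"
      using uc unfolding uniformly_continuous_on_def by (metis half_gt_zero)
    show "\<exists>d>0. \<forall>x. dist x x0 < d \<longrightarrow> dist (deriv (\<lambda>t. f (x + t *s v)) 0) (deriv (\<lambda>t. f (x0 + t *s v)) 0) < e"
    proof (intro exI[of _ "min d 1"] conjI allI impI)
      fix x assume x: "dist x x0 < min d 1"
      define g where "g t = f (x + t *s v) - f (x0 + t *s v)" for t
      have g: "g holomorphic_on UNIV" unfolding g_def using hol by (intro holomorphic_intros) auto
      have "cmod ((deriv ^^ 1) g 0) \<le> fact 1 * (e/2) / 1 ^ 1"
      proof (rule Cauchy_inequality)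
        show "g holomorphic_on ball 0 1" "continuous_on (cball 0 1) g"
          using g holomorphic_on_imp_continuous_on[OF g] holomorphic_on_subset continuous_on_subset by blast+
        fix t :: complex assume t: "cmod (0 - t) = 1"
        have nv: "norm (t *s v) = norm v"
          using t by (simp add: norm_vec_def L2_set_def norm_mult)
        have "x0 + t *s v \<in> K" using nv by (simp add: K_def dist_norm)
        moreover have "x + t *s v \<in> K"
          using nv x norm_triangle_ineq[of "x - x0" "t *s v"]
          by (simp add: K_def dist_norm norm_minus_commute[of x0] algebra_simps)
        moreover have "dist (x + t *s v) (x0 + t *s v) < d" using x by (simp add: dist_norm)
        ultimately show "norm (g t) \<le> e/2"
          using d(2) by (simp add: g_def dist_norm less_imp_le)
      qed auto
      moreover have "deriv g 0 = deriv (\<lambda>t. f (x + t *s v)) 0 - deriv (\<lambda>t. f (x0 + t *s v)) 0"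
        unfolding g_def using hol
        by (intro deriv_diff) (auto simp: holomorphic_on_def)
      ultimately show "dist (deriv (\<lambda>t. f (x + t *s v)) 0) (deriv (\<lambda>t. f (x0 + t *s v)) 0) < e"
        using e by (simp add: dist_norm)
    qed (simp add: d(1))
  qed
qed

section \<open>Fourier coefficients of periodic entire functions\<close>

definition fcoeff :: "int \<Rightarrow> (complex \<Rightarrow> complex) \<Rightarrow> complex" where
  "fcoeff j g = integral {0..1} (\<lambda>t. g (of_real t) * exp (- (2 * pi * \<i> * of_int j * of_real t)))"

lemma exp_2pi_int: "exp (2 * of_real pi * \<i> * of_int j) = 1"
  using exp_eq_1 by (auto simp: exp_eq_1)

lemma exp_2pi_eq_1_iff: "exp (2 * pi * \<i> * t) = 1 \<longleftrightarrow> t \<in> \<int>"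
proof
  assume "exp (2 * pi * \<i> * t) = 1"
  then obtain n :: int where n: "Re (2 * pi * \<i> * t) = 0" "Im (2 * pi * \<i> * t) = of_int (2 * n) * pi"
    unfolding exp_eq_1 by (elim conjE exE)
  have "Im t = 0" using n(1) by simp
  moreover have "Re t = of_int n" using n(2) by simp
  ultimately have "t = of_int n" using complex_eqI[of t "of_int n"] by simp
  then show "t \<in> \<int>" by simp
next
  assume "t \<in> \<int>"
  then obtain n where "t = of_int n" by (rule Ints_cases)
  then show "exp (2 * pi * \<i> * t) = 1" using exp_2pi_int[of n] by simp
qed

text \<open>With a primitive \<open>K\<close> of \<open>k\<close>, the integral over \<open>[w, w + 1]\<close> is \<open>K(w + 1) - K(w)\<close>. Its derivative in
  \<open>w\<close> is \<open>k(w + 1) - k(w) = 0\<close>, so no contour has to be deformed.\<close>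

lemma integral_periodic_shift:
  fixes k :: "complex \<Rightarrow> complex"
  assumes k: "k holomorphic_on UNIV" and per: "\<And>t. k (t + 1) = k t"
  shows "integral {0..1} (\<lambda>t. k (of_real t + w)) = integral {0..1} (\<lambda>t. k (of_real t))"
proof -
  obtain K where "\<And>z. z \<in> UNIV \<Longrightarrow> (K has_field_derivative k z) (at z within UNIV)"
    using holomorphic_convex_primitive'[OF convex_UNIV open_UNIV k] by blast
  then have K: "(K has_field_derivative k z) (at z)" for z by simp
  have int: "integral {0..1} (\<lambda>t. k (of_real t + w)) = K (w + 1) - K w" for w
  proof -
    have "((\<lambda>t. K (of_real t + w)) has_vector_derivative k (of_real t + w)) (at t within {0..1})" for t :: real
      using K[of "of_real t + w"]
      by (intro has_vector_derivative_real_field[where f = "\<lambda>u. K (u + w)"]) (simp add: DERIV_shift)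
    then have "((\<lambda>t. k (of_real t + w)) has_integral (K (of_real 1 + w) - K (of_real 0 + w))) {0..1}"
      by (intro fundamental_theorem_of_calculus) auto
    then show ?thesis by (simp add: integral_unique add.commute)
  qed
  have "((\<lambda>w. K (w + 1) - K w) has_field_derivative 0) (at w)" for w
  proof -
    have "((\<lambda>w. K (w + 1)) has_field_derivative k (w + 1)) (at w)"
      using K[of "w + 1"] by (simp add: DERIV_shift)
    then have "((\<lambda>w. K (w + 1) - K w) has_field_derivative k (w + 1) - k w) (at w)"
      using K[of w] by (rule DERIV_diff)
    then show ?thesis by (simp add: per)
  qed
  then obtain c where c: "\<And>w. K (w + 1) - K w = c"
    using has_field_derivative_zero_constant[of UNIV "\<lambda>w. K (w + 1) - K w"] by auto
  show ?thesis using int[of w] int[of 0] c[of w] c[of 0] by simp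
qed

lemma fcoeff_shift:
  assumes g: "g holomorphic_on UNIV" and per: "\<And>t. g (t + 1) = g t"
  shows "fcoeff j (\<lambda>t. g (t + w)) = exp (2 * pi * \<i> * of_int j * w) * fcoeff j g"
proof -
  define k where "k t = g t * exp (- (2 * pi * \<i> * of_int j * t))" for t
  have k: "k holomorphic_on UNIV" unfolding k_def by (intro holomorphic_intros g)
  have kper: "k (t + 1) = k t" for t
  proof -
    have "exp (- (2 * pi * \<i> * of_int j * (t + 1))) = exp (- (2 * pi * \<i> * of_int j * t)) / exp (2 * pi * \<i> * of_int j)"
      unfolding exp_diff[symmetric] by (simp add: distrib_left)
    then show ?thesis by (simp add: k_def per exp_2pi_int)
  qed
  have "fcoeff j (\<lambda>t. g (t + w)) = integral {0..1} (\<lambda>t. exp (2 * pi * \<i> * of_int j * w) * k (of_real t + w))"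
    unfolding fcoeff_def k_def
    by (intro integral_cong) (simp add: algebra_simps exp_add[symmetric])
  also have "\<dots> = exp (2 * pi * \<i> * of_int j * w) * integral {0..1} (\<lambda>t. k (of_real t + w))"
    by (rule integral_mult_right)
  also have "integral {0..1} (\<lambda>t. k (of_real t + w)) = fcoeff j g"
    using integral_periodic_shift[OF k kper, of w] by (simp add: k_def fcoeff_def)
  finally show ?thesis .
qed

lemma fcoeff_mult_exp: "fcoeff j (\<lambda>t. exp (2 * pi * \<i> * of_int l * t) * g t) = fcoeff (j - l) g"
  unfolding fcoeff_def by (intro integral_cong) (simp add: algebra_simps exp_add[symmetric] exp_diff)

lemma continuous_on_real_line:
  fixes g :: "complex \<Rightarrow> complex"
  assumes "continuous_on UNIV g" shows "continuous_on S (\<lambda>t::real. g (of_real t))"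
  by (rule continuous_on_compose2[OF assms]) (auto intro!: continuous_intros)

lemma fcoeff_integrable:
  fixes g :: "complex \<Rightarrow> complex"
  assumes "continuous_on UNIV g"
  shows "(\<lambda>t. g (of_real t) * exp (- (2 * pi * \<i> * of_int j * of_real t))) integrable_on {0..1}"
  by (intro integrable_continuous_real continuous_intros continuous_on_real_line assms)

lemma fcoeff_add:
  "continuous_on UNIV f \<Longrightarrow> continuous_on UNIV g \<Longrightarrow> fcoeff j (\<lambda>t. f t + g t) = fcoeff j f + fcoeff j g"
  unfolding fcoeff_def distrib_right by (intro integral_add fcoeff_integrable)

lemma fcoeff_cmult: "fcoeff j (\<lambda>t. c * f t) = c * fcoeff j f"
  unfolding fcoeff_def by (simp add: mult.assoc)

lemma fcoeff_norm_le:
  fixes g :: "complex \<Rightarrow> complex"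
  assumes "continuous_on UNIV g" "\<And>t. t \<in> {0..1} \<Longrightarrow> cmod (g (of_real t)) \<le> B"
  shows "cmod (fcoeff j g) \<le> B"
proof -
  have "cmod (fcoeff j g) \<le> integral {0..1} (\<lambda>t::real. B)"
    unfolding fcoeff_def
  proof (rule integral_norm_bound_integral)
    fix t :: real assume "t \<in> {0..1}"
    then show "cmod (g (of_real t) * exp (- (2 * pi * \<i> * of_int j * of_real t))) \<le> B"
      using assms(2)[of t] by (simp add: norm_mult)
  qed (use fcoeff_integrable[OF assms(1)] in auto)
  then show ?thesis by simp
qed

lemma fcoeff_exp: "fcoeff j (\<lambda>t. exp (2 * pi * \<i> * of_int l * t)) = (if j = l then 1 else 0)"
proof (cases "j = l")
  case True
  have "fcoeff j (\<lambda>t. exp (2 * pi * \<i> * of_int l * t)) = integral {0..1} (\<lambda>t::real. 1 :: complex)"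
    unfolding fcoeff_def True by (intro integral_cong) (simp add: exp_minus)
  then show ?thesis using True by simp
next
  case False
  define c where "c = 2 * pi * \<i> * of_int (l - j)"
  have c: "c \<noteq> 0" using False by (simp add: c_def)
  have "fcoeff j (\<lambda>t. exp (2 * pi * \<i> * of_int l * t)) = integral {0..1} (\<lambda>t::real. exp (c * of_real t))"
    unfolding fcoeff_def c_def by (intro integral_cong) (simp add: exp_add[symmetric] algebra_simps exp_diff exp_minus field_simps)
  also have "((\<lambda>t::real. exp (c * of_real t)) has_integral (exp (c * of_real 1) / c - exp (c * of_real 0) / c)) {0..1}"
  proof (rule fundamental_theorem_of_calculus)
    show "((\<lambda>t::real. exp (c * of_real t) / c) has_vector_derivative exp (c * of_real t)) (at t within {0..1})" for t
      using c by (auto intro!: derivative_eq_intros has_vector_derivative_real_field)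
  qed simp
  then have "integral {0..1} (\<lambda>t::real. exp (c * of_real t)) = exp c / c - 1 / c"
    by (simp add: integral_unique)
  also have "exp c = 1" using exp_2pi_int[of "l - j"] by (simp add: c_def)
  finally show ?thesis using False by simp
qed

text \<open>If all Fourier coefficients of \<open>f\<close> vanish, those of the entire function
  \<open>q(t) = (f(t) - f(0)) / (e\<^bsup>2\<pi>it\<^esup> - 1)\<close> do not change from one nonnegative index to the next, nor
  from one negative index to the next. Shifting the contour shows that they decay, hence they are
  all zero; and then so is \<open>f(0)\<close>, which is the jump at the index \<open>0\<close>.\<close>

lemma fcoeff_eq_0_imp_value_0:
  assumes f: "f holomorphic_on UNIV" and per: "\<And>t. f (t + 1) = f t" and 0: "\<And>j. fcoeff j f = 0"
  shows "f 0 = 0"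
proof -
  define E where "E t = exp (2 * pi * \<i> * t)" for t :: complex
  have E1: "E t = 1 \<longleftrightarrow> t \<in> \<int>" for t
    unfolding E_def by (rule exp_2pi_eq_1_iff)
  have fnat: "f (t + of_nat n) = f t" for n :: nat and t
  proof (induction n)
    case (Suc n)
    show ?case using per[of "t + of_nat n"] unfolding Suc.IH by (simp add: add_ac)
  qed simp
  have fint: "f (of_int n + t) = f t" for n :: int and t
  proof (cases "n \<ge> 0")
    case True
    then show ?thesis using fnat[of t "nat n"] by (simp add: add.commute)
  next
    case False
    then show ?thesis using fnat[of "of_int n + t" "nat (- n)"] by simp
  qed
  \<comment> \<open>At the integers the quotient is given its limit, by l'Hopital's rule.\<close>
  define q where "q t = (if t \<in> \<int> then deriv f 0 / (2 * pi * \<i>) else (f t - f 0) / (E t - 1))" for t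
  have Eper: "E (t + 1) = E t" for t
    using exp_2pi_int[of 1] by (simp add: E_def distrib_left exp_add)
  have Zper: "t + 1 \<in> \<int> \<longleftrightarrow> t \<in> \<int>" for t :: complex
  proof
    assume "t + 1 \<in> \<int>" then show "t \<in> \<int>" using Ints_diff[of "t + 1" 1] by simp
  qed simp
  have qper: "q (t + 1) = q t" for t
    by (simp add: q_def Zper per Eper)
  have q0: "q holomorphic_on ball 0 1"
  proof (rule no_isolated_singularity[where K = "{0}"])
    have int0: "t \<in> ball 0 1 \<Longrightarrow> t \<in> \<int> \<Longrightarrow> t = 0" for t :: complex
      by (auto elim!: Ints_cases)
    have "(\<lambda>t. (f t - f 0) / (E t - 1)) holomorphic_on ball 0 1 - {0}"
      using int0 E1 unfolding E_def
      by (intro holomorphic_intros holomorphic_on_subset[OF f]) auto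
    then show hol: "q holomorphic_on ball 0 1 - {0}"
      by (rule holomorphic_transform) (use int0 in \<open>auto simp: q_def\<close>)
    have "isCont q 0"
    proof -
      have fd: "(f has_field_derivative deriv f 0) (at 0)" using f by (simp add: holomorphic_derivI)
      have Ed: "(E has_field_derivative 2 * pi * \<i>) (at 0)" unfolding E_def
        by (auto intro!: derivative_eq_intros)
      have "((\<lambda>t. ((f t - f 0) / (t - 0)) / ((E t - E 0) / (t - 0))) \<longlongrightarrow> deriv f 0 / (2 * pi * \<i>)) (at 0)"
        using fd Ed unfolding has_field_derivative_iff by (intro tendsto_divide) auto
      moreover have "\<forall>\<^sub>F t in at 0. ((f t - f 0) / (t - 0)) / ((E t - E 0) / (t - 0)) = q t"
      proof -
        have "\<forall>\<^sub>F t in at 0. t \<in> ball 0 1 - {0::complex}"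
          by (intro eventually_at_in_open) auto
        then show ?thesis
        proof eventually_elim
          case (elim t)
          then have "t \<notin> \<int>" "t \<noteq> 0" using int0 by auto
          then show ?case by (simp add: q_def E_def)
        qed
      qed
      ultimately have "(q \<longlongrightarrow> deriv f 0 / (2 * pi * \<i>)) (at 0)"
        by (rule Lim_transform_eventually)
      then show ?thesis by (simp add: isCont_def q_def)
    qed
    then have "isCont q x" if "x \<in> ball 0 1" for x
    proof (cases "x = 0")
      case False
      have "open (ball 0 1 - {0::complex})" by (intro open_Diff) auto
      with that False show ?thesis
        using holomorphic_on_imp_continuous_on[OF hol] continuous_on_eq_continuous_at by blast
    qed simp
    then show "continuous_on (ball 0 1) q" by (intro continuous_at_imp_continuous_on) auto
  qed auto
  have q: "q holomorphic_on UNIV"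
    unfolding holomorphic_on_def
  proof
    fix t :: complex
    show "q field_differentiable at t within UNIV"
    proof (cases "t \<in> \<int>")
      case True
      then obtain n where n: "t = of_int n" by (auto elim: Ints_cases)
      have qint: "q (u - of_int n) = q u" for u
      proof -
        have "u - of_int n \<in> \<int> \<longleftrightarrow> u \<in> \<int>"
          using Ints_diff[of u "of_int n"] Ints_add[of "u - of_int n" "of_int n"] by auto
        moreover have "f (u - of_int n) = f u" using fint[of n "u - of_int n"] by simp
        moreover have "E (u - of_int n) = E u"
          using exp_2pi_int[of n] by (simp add: E_def algebra_simps exp_diff)
        ultimately show ?thesis by (simp add: q_def)
      qed
      have "(q has_field_derivative deriv q 0) (at (t - of_int n))"
        using q0 by (simp add: n holomorphic_derivI[of q "ball 0 1"])
      then have "((\<lambda>u. q (u + - of_int n)) has_field_derivative deriv q 0) (at t)"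
        using DERIV_shift[of q _ t "- of_int n"] by simp
      then show ?thesis by (auto simp: qint field_differentiable_def)
    next
      case False
      have "open (- (\<int> :: complex set))" by (simp add: closed_Ints open_Compl)
      moreover have "(\<lambda>t. (f t - f 0) / (E t - 1)) holomorphic_on - \<int>"
        unfolding E_def using E1 unfolding E_def
        by (intro holomorphic_intros holomorphic_on_subset[OF f]) auto
      then have "q holomorphic_on - \<int>" by (rule holomorphic_transform) (auto simp: q_def)
      ultimately show ?thesis
        using False by (auto simp: holomorphic_on_open field_differentiable_def)
    qed
  qed
  have qc: "continuous_on UNIV q" using q by (rule holomorphic_on_imp_continuous_on)
  have eq: "f t = (f 0 + E t * q t) + (- 1) * q t" for t
  proof (cases "t \<in> \<int>")
    case True
    then have "f t = f 0" using fint[of _ 0] by (auto elim: Ints_cases)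
    then show ?thesis using True E1 by simp
  next
    case False
    then have "(E t - 1) * q t = f t - f 0" using E1[of t] by (simp add: q_def)
    then show ?thesis by (simp add: algebra_simps)
  qed
  have rec: "0 = f 0 * (if j = 0 then 1 else 0) + fcoeff (j - 1) q - fcoeff j q" for j
  proof -
    have cE: "continuous_on UNIV (\<lambda>t. E t * q t)" unfolding E_def by (intro continuous_intros qc)
    have "0 = fcoeff j (\<lambda>t. (f 0 + E t * q t) + (- 1) * q t)"
      unfolding eq[symmetric] using 0[of j] by simp
    also have "\<dots> = fcoeff j (\<lambda>t. f 0 + E t * q t) + fcoeff j (\<lambda>t. (-1) * q t)"
      by (intro fcoeff_add continuous_intros qc cE)
    also have "fcoeff j (\<lambda>t. f 0 + E t * q t) = fcoeff j (\<lambda>t. f 0) + fcoeff j (\<lambda>t. E t * q t)"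
      by (intro fcoeff_add continuous_intros cE)
    also have "fcoeff j (\<lambda>t. f 0) = f 0 * (if j = 0 then 1 else 0)"
      using fcoeff_exp[of j 0] fcoeff_cmult[of j "f 0" "\<lambda>_. 1"] by simp
    also have "fcoeff j (\<lambda>t. E t * q t) = fcoeff (j - 1) q"
      unfolding E_def using fcoeff_mult_exp[of j 1 q] by simp
    also have "fcoeff j (\<lambda>t. (-1) * q t) = - fcoeff j q"
      using fcoeff_cmult[of j "-1" q] by simp
    finally show ?thesis by simp
  qed
  \<comment> \<open>Integration along the horizontal line at height \<open>s\<close> instead of the real line.\<close>
  have decay: "\<exists>B. \<forall>j. cmod (fcoeff j q) \<le> B * exp (2 * pi * s * of_int j)" for s :: real
  proof -
    define w where "w = of_real s * \<i>"
    have cw: "continuous_on UNIV (\<lambda>t. q (t + w))"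
      by (rule continuous_on_compose2[OF qc]) (auto intro!: continuous_intros)
    have "compact ((\<lambda>t::real. q (of_real t + w)) ` {0..1})"
      by (rule compact_continuous_image[OF continuous_on_real_line[OF cw] compact_Icc])
    then have "bounded ((\<lambda>t::real. q (of_real t + w)) ` {0..1})" by (rule compact_imp_bounded)
    then obtain B where "\<forall>y\<in>(\<lambda>t::real. q (of_real t + w)) ` {0..1}. cmod y \<le> B"
      unfolding bounded_iff by blast
    then have B: "cmod (q (of_real t + w)) \<le> B" if "t \<in> {0..1}" for t :: real using that by auto
    have "cmod (fcoeff j q) \<le> B * exp (2 * pi * s * of_int j)" for j
    proof -
      have "exp (- (2 * pi * s * of_int j)) * cmod (fcoeff j q) = cmod (fcoeff j (\<lambda>t. q (t + w)))"
        unfolding fcoeff_shift[OF q qper] norm_mult by (simp add: w_def)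
      also have "\<dots> \<le> B" by (intro fcoeff_norm_le cw B)
      finally show ?thesis by (simp add: exp_minus field_simps)
    qed
    then show ?thesis by blast
  qed
  have small: "x = 0" if "\<And>n::nat. cmod x \<le> B * exp (- (2 * pi * n))" for x B
  proof -
    have "(\<lambda>n::nat. B * exp (- (2 * pi * n))) \<longlonglongrightarrow> B * 0"
      by (intro tendsto_mult tendsto_const) real_asymp
    then have "cmod x \<le> B * 0"
      by (rule LIMSEQ_le_const) (use that in auto)
    then show ?thesis by simp
  qed
  have pos: "fcoeff (int n) q = fcoeff 0 q" for n
  proof (induction n)
    case (Suc n) then show ?case using rec[of "int (Suc n)"] by (simp add: algebra_simps)
  qed simp
  have neg: "fcoeff (- 1 - int n) q = fcoeff (-1) q" for n
  proof (induction n)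
    case (Suc n) then show ?case using rec[of "- 1 - int n"] by (simp add: algebra_simps)
  qed simp
  obtain B where B: "\<And>j. cmod (fcoeff j q) \<le> B * exp (2 * pi * (- 1) * of_int j)"
    using decay[of "-1"] by auto
  have "fcoeff 0 q = 0"
  proof (rule small)
    fix n :: nat
    show "cmod (fcoeff 0 q) \<le> B * exp (- (2 * pi * n))" using B[of "int n"] pos[of n] by simp
  qed
  moreover obtain B' where B': "\<And>j. cmod (fcoeff j q) \<le> B' * exp (2 * pi * 1 * of_int j)"
    using decay[of 1] by auto
  have "fcoeff (-1) q = 0"
  proof (rule small)
    fix n :: nat
    have "cmod (fcoeff (-1) q) \<le> B' * exp (2 * pi * 1 * of_int (- 1 - int n))"
      using B'[of "-1 - int n"] neg[of n] by simp
    also have "\<dots> = B' * exp (- 2 * pi) * exp (- (2 * pi * n))"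
      by (simp add: algebra_simps exp_diff exp_minus divide_inverse)
    finally show "cmod (fcoeff (-1) q) \<le> B' * exp (- 2 * pi) * exp (- (2 * pi * n))" .
  qed
  ultimately show ?thesis using rec[of 0] by simp
qed

lemma fcoeff_eq_0_imp_eq_0:
  assumes f: "f holomorphic_on UNIV" and per: "\<And>t. f (t + 1) = f t" and 0: "\<And>j. fcoeff j f = 0"
  shows "f w = 0"
proof -
  have "(\<lambda>t. f (t + w)) 0 = 0"
  proof (rule fcoeff_eq_0_imp_value_0)
    show "(\<lambda>t. f (t + w)) holomorphic_on UNIV"
    proof -
      have "(\<lambda>t. t + w) holomorphic_on UNIV" by (intro holomorphic_intros)
      then show ?thesis using holomorphic_on_compose_gen[of "\<lambda>t. t + w" UNIV f UNIV] f by (simp add: o_def)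
    qed
    show "f (t + 1 + w) = f (t + w)" for t using per[of "t + w"] by (simp add: algebra_simps)
    show "fcoeff j (\<lambda>t. f (t + w)) = 0" for j using fcoeff_shift[OF f per] 0 by simp
  qed
  then show ?thesis by simp
qed

section \<open>Fourier coefficients in two variables\<close>

definition vec2 :: "complex \<Rightarrow> complex \<Rightarrow> complex^2" where
  "vec2 s t = vector [s, t]"

lemma vec2_nth [simp]: "vec2 s t $ 1 = s" "vec2 s t $ 2 = t"
  by (simp_all add: vec2_def)

lemma vec2_eta [simp]: "vec2 (x $ 1) (x $ 2) = x"
  by (simp add: vec_eq_iff forall_2)

lemma vec2_add: "vec2 s t + x = vec2 (s + x $ 1) (t + x $ 2)"
  by (simp add: vec_eq_iff forall_2)

definition fcoeff2 :: "int \<times> int \<Rightarrow> (complex^2 \<Rightarrow> complex) \<Rightarrow> complex" where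
  "fcoeff2 p f = fcoeff (fst p) (\<lambda>s. fcoeff (snd p) (\<lambda>t. f (vec2 s t)))"

text \<open>The characters of \<open>\<complex>\<^sup>2 / \<int>\<^sup>2\<close>.\<close>

definition echar :: "int \<times> int \<Rightarrow> complex^2 \<Rightarrow> complex" where
  "echar p x = exp (2 * pi * \<i> * (of_int (fst p) * x $ 1 + of_int (snd p) * x $ 2))"

lemma echar_nonzero [simp]: "echar p x \<noteq> 0"
  by (simp add: echar_def)

lemma echar_add_vec: "echar p (x + y) = echar p x * echar p y"
  by (simp add: echar_def exp_add[symmetric] algebra_simps)

lemma holomorphic2_echar: "holomorphic2_on (echar p) S"
  unfolding echar_def
  by (intro holomorphic2_on_exp holomorphic2_on_mult holomorphic2_on_const holomorphic2_on_add holomorphic2_on_nth)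

lemma vec2_line: "vec2 s t = vec2 s 0 + t *s axis 2 1" "vec2 s t = vec2 0 t + s *s axis 1 1"
  by (simp_all add: vec_eq_iff forall_2 axis_def)

lemma continuous_on_vec2: "continuous_on S (\<lambda>t. vec2 s t)"
proof -
  have "continuous_on S (\<lambda>t. vec2 s 0 + t *s axis 2 1)"
    by (intro continuous_on_add continuous_on_const bounded_linear.continuous_on[OF bounded_linear_scale_vec] continuous_on_id)
  then show ?thesis by (simp only: vec2_line(1)[symmetric])
qed

lemma holomorphic_vec2:
  assumes "holomorphic2_on f UNIV"
  shows "(\<lambda>t. f (vec2 s t)) holomorphic_on UNIV" "(\<lambda>s. f (vec2 s t)) holomorphic_on UNIV"
proof -
  note h = line_holomorphicD[OF holomorphic2_imp_line_holomorphic[OF assms]]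
  show "(\<lambda>t. f (vec2 s t)) holomorphic_on UNIV"
    using h[of "vec2 s 0" "axis 2 1"] by (simp only: vec2_line(1)[symmetric])
  show "(\<lambda>s. f (vec2 s t)) holomorphic_on UNIV"
    using h[of "vec2 0 t" "axis 1 1"] by (simp only: vec2_line(2)[symmetric])
qed

lemma continuous_vec2:
  assumes "continuous_on UNIV f"
  shows "continuous_on UNIV (\<lambda>t. f (vec2 s t))"
  by (rule continuous_on_compose2[OF assms continuous_on_vec2]) auto

lemma continuous_on_vec2_pair: "continuous_on S (\<lambda>z::complex \<times> real. vec2 (fst z) (of_real (snd z)))"
proof -
  have "vec2 s t = s *s axis 1 1 + t *s axis 2 1" for s t
    by (simp add: vec_eq_iff forall_2 axis_def)
  then show ?thesis
    by (simp only:) (intro continuous_on_add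
        bounded_linear.continuous_on[OF bounded_linear_scale_vec] continuous_intros)
qed

text \<open>Differentiation under the integral sign; the continuity of the partial derivative that it requires
  is not part of the notion of holomorphy used here and comes from Cauchy's estimate.\<close>

lemma holomorphic_inner_fcoeff:
  assumes f: "holomorphic2_on f UNIV"
  shows "(\<lambda>s. fcoeff q (\<lambda>t. f (vec2 s t))) holomorphic_on UNIV"
proof -
  define d where "d x = deriv (\<lambda>u. f (x + u *s axis 1 1)) 0" for x
  have dc: "continuous_on UNIV d" unfolding d_def by (rule continuous_directional_deriv[OF f])
  have D: "((\<lambda>s. f (vec2 s t)) has_field_derivative d (vec2 s t)) (at s)" for s t
  proof -
    have "(\<lambda>u. f (vec2 s t + u *s axis 1 1)) holomorphic_on UNIV"
      by (rule line_holomorphicD[OF holomorphic2_imp_line_holomorphic[OF f]])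
    then have "((\<lambda>u. f (vec2 s t + u *s axis 1 1)) has_field_derivative d (vec2 s t)) (at 0)"
      unfolding d_def by (simp add: holomorphic_derivI)
    moreover have "vec2 s t + u *s axis 1 1 = vec2 (u + s) t" for u
      by (simp add: vec_eq_iff forall_2 axis_def)
    ultimately show ?thesis using DERIV_shift[of "\<lambda>s. f (vec2 s t)" _ 0 s] by simp
  qed
  let ?e = "\<lambda>t::real. exp (- (2 * pi * \<i> * of_int q * of_real t))"
  have "(\<lambda>s. integral (cbox 0 1) (\<lambda>t::real. f (vec2 s (of_real t)) * ?e t)) holomorphic_on UNIV"
  proof (rule leibniz_rule_holomorphic[where fx = "\<lambda>s t. d (vec2 s (of_real t)) * ?e t"])
    fix s :: complex and t :: real
    show "((\<lambda>s. f (vec2 s (of_real t)) * ?e t) has_field_derivative d (vec2 s (of_real t)) * ?e t) (at s within UNIV)"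
      using DERIV_cmult_right[OF D] by simp
  next
    fix s :: complex
    have "continuous_on UNIV (\<lambda>t. f (vec2 s t))"
      by (rule continuous_vec2[OF holomorphic2_on_imp_continuous_on[OF f]])
    then show "(\<lambda>t::real. f (vec2 s (of_real t)) * ?e t) integrable_on cbox 0 1"
      using fcoeff_integrable[of "\<lambda>t. f (vec2 s t)" q] by simp
  next
    have "continuous_on (UNIV \<times> cbox 0 1) (\<lambda>z::complex \<times> real. d (vec2 (fst z) (of_real (snd z))) * ?e (snd z))"
      by (intro continuous_on_mult continuous_on_compose2[OF dc continuous_on_vec2_pair] continuous_intros) auto
    then show "continuous_on (UNIV \<times> cbox 0 1) (\<lambda>(s, t::real). d (vec2 s (of_real t)) * ?e t)"
      by (simp add: case_prod_unfold)
  qed auto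
  then show ?thesis by (simp add: fcoeff_def)
qed

definition biperiodic :: "(complex^2 \<Rightarrow> complex) \<Rightarrow> bool" where
  "biperiodic f \<longleftrightarrow> (\<forall>s t. f (vec2 (s + 1) t) = f (vec2 s t) \<and> f (vec2 s (t + 1)) = f (vec2 s t))"

lemma fcoeff2_shift:
  assumes f: "holomorphic2_on f UNIV" and per: "biperiodic f"
  shows "fcoeff2 p (\<lambda>x. f (x + w)) = echar p w * fcoeff2 p f"
proof -
  have p1: "f (vec2 (s + 1) t) = f (vec2 s t)" and p2: "f (vec2 s (t + 1)) = f (vec2 s t)" for s t
    using per by (auto simp: biperiodic_def)
  let ?I = "\<lambda>s. fcoeff (snd p) (\<lambda>t. f (vec2 s t))"
  have "fcoeff2 p (\<lambda>x. f (x + w))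
      = fcoeff (fst p) (\<lambda>s. fcoeff (snd p) (\<lambda>t. f (vec2 (s + w$1) (t + w$2))))"
    by (simp add: fcoeff2_def vec2_add)
  also have "\<dots> = fcoeff (fst p) (\<lambda>s. exp (2 * pi * \<i> * of_int (snd p) * w$2) * ?I (s + w$1))"
    by (subst fcoeff_shift[OF holomorphic_vec2(1)[OF f] p2]) (rule refl)
  also have "\<dots> = exp (2 * pi * \<i> * of_int (snd p) * w$2) * (exp (2 * pi * \<i> * of_int (fst p) * w$1) * fcoeff2 p f)"
    unfolding fcoeff_cmult fcoeff2_def
    by (subst fcoeff_shift[OF holomorphic_inner_fcoeff[OF f]]) (simp_all add: p1)
  also have "\<dots> = echar p w * fcoeff2 p f"
    by (simp add: echar_def exp_add distrib_left mult_ac)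
  finally show ?thesis .
qed

text \<open>Uniqueness in one variable is used twice: first for the entire function
  \<open>s \<mapsto> \<integral> f(s, t) e\<^bsup>-2\<pi>iqt\<^esup> dt\<close>, then for \<open>t \<mapsto> f(s, t)\<close>.\<close>

lemma fcoeff2_eq_0_imp_eq_0:
  assumes f: "holomorphic2_on f UNIV" and per: "biperiodic f" and 0: "\<And>p. fcoeff2 p f = 0"
  shows "f x = 0"
proof -
  have p1: "f (vec2 (s + 1) t) = f (vec2 s t)" and p2: "f (vec2 s (t + 1)) = f (vec2 s t)" for s t
    using per by (auto simp: biperiodic_def)
  have "fcoeff q (\<lambda>t. f (vec2 s t)) = 0" for s q
  proof (rule fcoeff_eq_0_imp_eq_0[OF holomorphic_inner_fcoeff[OF f]])
    show "fcoeff j (\<lambda>s. fcoeff q (\<lambda>t. f (vec2 s t))) = 0" for j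
      using 0[of "(j, q)"] by (simp add: fcoeff2_def)
  qed (simp add: p1)
  then have "f (vec2 (x$1) (x$2)) = 0"
    by (intro fcoeff_eq_0_imp_eq_0[OF holomorphic_vec2(1)[OF f]] p2)
  then show ?thesis by simp
qed

lemma fcoeff2_cmult: "fcoeff2 p (\<lambda>x. c * f x) = c * fcoeff2 p f"
  by (simp add: fcoeff2_def fcoeff_cmult)

lemma fcoeff2_add:
  assumes f: "holomorphic2_on f UNIV" and g: "holomorphic2_on g UNIV"
  shows "fcoeff2 p (\<lambda>x. f x + g x) = fcoeff2 p f + fcoeff2 p g"
proof -
  note c = holomorphic_on_imp_continuous_on[OF holomorphic_vec2(1)]
    and ci = holomorphic_on_imp_continuous_on[OF holomorphic_inner_fcoeff]
  have "fcoeff2 p (\<lambda>x. f x + g x)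
      = fcoeff (fst p) (\<lambda>s. fcoeff (snd p) (\<lambda>t. f (vec2 s t)) + fcoeff (snd p) (\<lambda>t. g (vec2 s t)))"
    unfolding fcoeff2_def by (subst fcoeff_add[OF c[OF f] c[OF g]]) (rule refl)
  also have "\<dots> = fcoeff2 p f + fcoeff2 p g"
    unfolding fcoeff2_def by (rule fcoeff_add[OF ci[OF f] ci[OF g]])
  finally show ?thesis .
qed

lemma fcoeff2_mult_echar:
  "fcoeff2 p (\<lambda>x. echar q x * f x) = fcoeff2 (fst p - fst q, snd p - snd q) f"
proof -
  have "echar q (vec2 s t) * f (vec2 s t)
      = exp (2 * pi * \<i> * of_int (fst q) * s) * (exp (2 * pi * \<i> * of_int (snd q) * t) * f (vec2 s t))" for s t
    by (simp add: echar_def distrib_left exp_add mult.assoc)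
  then show ?thesis
    unfolding fcoeff2_def by (simp only: fcoeff_cmult fcoeff_mult_exp fst_conv snd_conv)
qed

lemma fcoeff2_echar: "fcoeff2 p (echar q) = (if p = q then 1 else 0)"
proof -
  have "echar q (vec2 s t)
      = exp (2 * pi * \<i> * of_int (fst q) * s) * exp (2 * pi * \<i> * of_int (snd q) * t)" for s t
    by (simp add: echar_def distrib_left exp_add mult.assoc)
  then have "fcoeff2 p (echar q) = fcoeff (fst p) (\<lambda>s. exp (2 * pi * \<i> * of_int (fst q) * s) *
      (if snd p = snd q then 1 else 0))"
    unfolding fcoeff2_def by (simp only: fcoeff_cmult fcoeff_exp)
  also have "\<dots> = (if snd p = snd q then 1 else 0) * (if fst p = fst q then 1 else 0)"
    by (simp only: mult.commute[of "exp _"] fcoeff_cmult fcoeff_exp)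
  also have "\<dots> = (if p = q then 1 else 0)" by (simp add: prod_eq_iff)
  finally show ?thesis .
qed

lemma fcoeff2_norm_le:
  assumes f: "holomorphic2_on f UNIV" and B: "\<And>s t::real. cmod (f (vec2 (of_real s) (of_real t))) \<le> B"
  shows "cmod (fcoeff2 p f) \<le> B"
  unfolding fcoeff2_def
proof (rule fcoeff_norm_le[OF holomorphic_on_imp_continuous_on[OF holomorphic_inner_fcoeff[OF f]]])
  show "cmod (fcoeff (snd p) (\<lambda>t. f (vec2 (of_real s) t))) \<le> B" for s :: real
    by (rule fcoeff_norm_le[OF holomorphic_on_imp_continuous_on[OF holomorphic_vec2(1)[OF f]]]) (rule B)
qed

lemma holomorphic2_sum:
  "finite F \<Longrightarrow> (\<And>q. q \<in> F \<Longrightarrow> holomorphic2_on (f q) S) \<Longrightarrow> holomorphic2_on (\<lambda>x. \<Sum>q\<in>F. f q x) S"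
proof (induction F rule: finite_induct)
  case empty
  show ?case by (simp add: holomorphic2_on_const)
next
  case (insert a F)
  then have "holomorphic2_on (\<lambda>x. f a x + (\<Sum>q\<in>F. f q x)) S"
    by (intro holomorphic2_on_add) simp_all
  then show ?case using insert by simp
qed

lemma fcoeff2_sum:
  assumes "finite F" "\<And>q. q \<in> F \<Longrightarrow> holomorphic2_on (f q) UNIV"
  shows "fcoeff2 p (\<lambda>x. \<Sum>q\<in>F. c q * f q x) = (\<Sum>q\<in>F. c q * fcoeff2 p (f q))"
  using assms
proof (induction F rule: finite_induct)
  case empty
  show ?case using fcoeff2_cmult[of p 0 "\<lambda>_. 0"] by simp
next
  case (insert a F)
  have "fcoeff2 p (\<lambda>x. c a * f a x + (\<Sum>q\<in>F. c q * f q x)) = c a * fcoeff2 p (f a) + (\<Sum>q\<in>F. c q * fcoeff2 p (f q))"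
  proof -
    have h: "holomorphic2_on (\<lambda>x. c q * f q x) UNIV" if "q \<in> insert a F" for q
      by (rule holomorphic2_on_mult[OF holomorphic2_on_const]) (use insert.prems that in blast)
    have "holomorphic2_on (\<lambda>x. \<Sum>q\<in>F. c q * f q x) UNIV"
      by (rule holomorphic2_sum[OF insert.hyps(1)]) (rule h, simp)
    from fcoeff2_add[OF h[OF insertI1] this] show ?thesis
      using insert.IH insert.prems by (simp add: fcoeff2_cmult)
  qed
  then show ?case using insert by simp
qed

section \<open>Rapidly decaying exponential series\<close>

definition weight :: "int \<times> int \<Rightarrow> real" where
  "weight p = \<bar>of_int (fst p)\<bar> + \<bar>of_int (snd p)\<bar>"

lemma weight_nonneg [simp]: "0 \<le> weight p"
  by (simp add: weight_def)

text \<open>Faster decay than every exponential is what makes the series \<open>expser b\<close> below converge on all of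
  \<open>\<complex>\<^sup>2\<close>, and it survives multiplication of the coefficients by polynomials.\<close>

definition rapid :: "(int \<times> int \<Rightarrow> complex) \<Rightarrow> bool" where
  "rapid b \<longleftrightarrow> (\<forall>R. (\<lambda>p. cmod (b p) * exp (R * weight p)) summable_on UNIV)"

definition expser :: "(int \<times> int \<Rightarrow> complex) \<Rightarrow> complex^2 \<Rightarrow> complex" where
  "expser b x = (\<Sum>\<^sub>\<infinity>p. b p * echar p x)"

lemma abs_summable_majorant:
  fixes f :: "'a \<Rightarrow> 'b :: banach"
  assumes g: "g summable_on A" and le: "\<And>x. x \<in> A \<Longrightarrow> norm (f x) \<le> g x"
  shows "f summable_on A" "norm (infsum f A) \<le> infsum g A"
proof -
  have g0: "0 \<le> g x" if "x \<in> A" for x using le[OF that] norm_ge_zero[of "f x"] by linarith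
  have "(\<lambda>x. norm (g x)) summable_on A" using g summable_on_iff_abs_summable_on_real by blast
  then have f: "(\<lambda>x. norm (f x)) summable_on A"
    by (rule Infinite_Sum.abs_summable_on_comparison_test) (use le g0 in auto)
  then show "f summable_on A" by (rule Infinite_Sum.abs_summable_summable)
  have "norm (infsum f A) \<le> infsum (\<lambda>x. norm (f x)) A" by (rule norm_infsum_bound[OF f])
  also have "\<dots> \<le> infsum g A" by (rule infsum_mono[OF f g le])
  finally show "norm (infsum f A) \<le> infsum g A" .
qed

lemma norm_index_le:
  "cmod (of_int (fst p) * x $ 1 + of_int (snd p) * x $ 2) \<le> weight p * norm x"
proof -
  have "cmod (of_int (fst p) * x $ 1) \<le> \<bar>of_int (fst p)\<bar> * norm x"
       "cmod (of_int (snd p) * x $ 2) \<le> \<bar>of_int (snd p)\<bar> * norm x"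
    unfolding norm_mult norm_of_int by (intro mult_left_mono Finite_Cartesian_Product.norm_nth_le; simp)+
  then show ?thesis
    using norm_triangle_ineq[of "of_int (fst p) * x $ 1" "of_int (snd p) * x $ 2"]
    by (simp add: weight_def distrib_right)
qed

lemma norm_2pi_i: "cmod (2 * pi * \<i> * e) = 2 * pi * cmod e"
  by (simp add: norm_mult)

lemma norm_echar_le: "cmod (echar p x) \<le> exp (2 * pi * norm x * weight p)"
proof -
  have "cmod (echar p x) \<le> exp (cmod (2 * pi * \<i> * (of_int (fst p) * x $ 1 + of_int (snd p) * x $ 2)))"
    unfolding echar_def by (rule norm_exp)
  also have "\<dots> \<le> exp (2 * pi * norm x * weight p)"
    using mult_left_mono[OF norm_index_le[of p x], of "2 * pi"] unfolding norm_2pi_i by (simp add: mult_ac)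
  finally show ?thesis .
qed

lemma rapid_le:
  assumes "rapid b" "\<And>p. cmod (c p) \<le> K * cmod (b p) * exp (R * weight p)"
  shows "rapid c"
  unfolding rapid_def
proof
  fix S
  have "(\<lambda>p. K * (cmod (b p) * exp ((R + S) * weight p))) summable_on UNIV"
    using assms(1) unfolding rapid_def by (intro summable_on_cmult_right) blast
  then show "(\<lambda>p. cmod (c p) * exp (S * weight p)) summable_on UNIV"
  proof (rule abs_summable_majorant(1))
    fix p
    have e: "exp ((R + S) * weight p) = exp (R * weight p) * exp (S * weight p)"
      by (simp add: distrib_right exp_add)
    have "cmod (c p) * exp (S * weight p) \<le> K * cmod (b p) * exp (R * weight p) * exp (S * weight p)"
      by (intro mult_right_mono assms(2)) simp
    then show "norm (cmod (c p) * exp (S * weight p)) \<le> K * (cmod (b p) * exp ((R + S) * weight p))"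
      unfolding e by (simp add: mult.assoc)
  qed
qed

lemma rapid_summable:
  assumes "rapid b"
  shows "(\<lambda>p. b p * echar p x) summable_on UNIV"
proof (rule abs_summable_majorant(1))
  show "(\<lambda>p. cmod (b p) * exp (2 * pi * norm x * weight p)) summable_on UNIV"
    using assms unfolding rapid_def by blast
  show "cmod (b p * echar p x) \<le> cmod (b p) * exp (2 * pi * norm x * weight p)" for p
    by (simp add: norm_mult mult_left_mono norm_echar_le)
qed

lemma rapid_index:
  assumes "rapid b"
  shows "rapid (\<lambda>p. 2 * pi * \<i> * of_int (fst p) * b p)" "rapid (\<lambda>p. 2 * pi * \<i> * of_int (snd p) * b p)"
proof -
  have w: "weight p \<le> exp (1 * weight p)" for p
    using exp_ge_add_one_self[of "weight p"] by (simp only: mult_1)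
  have "\<bar>of_int (fst p)\<bar> \<le> exp (1 * weight p)" "\<bar>of_int (snd p)\<bar> \<le> exp (1 * weight p)" for p
    using w[of p] unfolding weight_def by linarith+
  then show "rapid (\<lambda>p. 2 * pi * \<i> * of_int (fst p) * b p)" "rapid (\<lambda>p. 2 * pi * \<i> * of_int (snd p) * b p)"
    by (intro rapid_le[OF assms, of _ "2 * pi" 1]; simp add: norm_mult mult_ac mult_left_mono)+
qed

lemma norm_exp_remainder: "cmod (exp z - 1 - z) \<le> exp (cmod z) * (cmod z)\<^sup>2" for z :: complex
  using Taylor_exp_field[of z 1] by (simp add: diff_diff_eq power2_eq_square)

lemma infsum_diff_complex:
  fixes f g :: "'a \<Rightarrow> complex"
  assumes "f summable_on A" "g summable_on A"
  shows "infsum f A - infsum g A = infsum (\<lambda>x. f x - g x) A" "(\<lambda>x. f x - g x) summable_on A"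
  using infsum_add[OF assms(1) summable_on_cmult_right[OF assms(2), of "-1"]]
    summable_on_add[OF assms(1) summable_on_cmult_right[OF assms(2), of "-1"]]
  unfolding infsum_cmult_right' by simp_all

text \<open>Subtracting the termwise derivative leaves the series with the factors
  \<open>e\<^bsup>\<theta>\<^esup> - 1 - \<theta>\<close>, which are quadratically small in the increment.\<close>

lemma expser_has_derivative:
  assumes b: "rapid b"
  shows "(expser b has_derivative (\<lambda>v. v $ 1 * expser (\<lambda>p. 2 * pi * \<i> * of_int (fst p) * b p) x
      + v $ 2 * expser (\<lambda>p. 2 * pi * \<i> * of_int (snd p) * b p) x)) (at x)"
proof -
  define S1 where "S1 = expser (\<lambda>p. 2 * pi * \<i> * of_int (fst p) * b p) x"
  define S2 where "S2 = expser (\<lambda>p. 2 * pi * \<i> * of_int (snd p) * b p) x"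
  define \<theta> where "\<theta> p h = 2 * pi * \<i> * (of_int (fst p) * h $ 1 + of_int (snd p) * h $ 2)" for p and h :: "complex^2"
  \<comment> \<open>The factor \<open>e\<^bsup>2\<pi>|x| weight\<^esup>\<close> bounds the characters at \<open>x\<close>, and with \<open>y = 2\<pi> weight\<close> the
    remainders are bounded by \<open>y\<^sup>2 e\<^sup>y \<le> e\<^bsup>3y\<^esup>\<close> times the square of the increment.\<close>
  define R where "R = 2 * pi * norm x + 6 * pi"
  define K where "K = (\<Sum>\<^sub>\<infinity>p. cmod (b p) * exp (R * weight p))"
  have Ks: "(\<lambda>p. cmod (b p) * exp (R * weight p)) summable_on UNIV" using b by (simp add: rapid_def)
  have K0: "K \<ge> 0" unfolding K_def by (intro infsum_nonneg) simp
  have rem: "expser b (x + h) - expser b x - (h $ 1 * S1 + h $ 2 * S2)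
      = (\<Sum>\<^sub>\<infinity>p. b p * echar p x * (exp (\<theta> p h) - 1 - \<theta> p h))" for h
  proof -
    note s0 = rapid_summable[OF b, of x] rapid_summable[OF b, of "x + h"]
      summable_on_cmult_right[OF rapid_summable[OF rapid_index(1)[OF b], of x], of "h$1"]
      summable_on_cmult_right[OF rapid_summable[OF rapid_index(2)[OF b], of x], of "h$2"]
    have "expser b (x + h) - expser b x - (h $ 1 * S1 + h $ 2 * S2)
      = (\<Sum>\<^sub>\<infinity>p. b p * echar p (x + h)) - (\<Sum>\<^sub>\<infinity>p. b p * echar p x)
        - ((\<Sum>\<^sub>\<infinity>p. h $ 1 * (2 * pi * \<i> * of_int (fst p) * b p * echar p x))
        + (\<Sum>\<^sub>\<infinity>p. h $ 2 * (2 * pi * \<i> * of_int (snd p) * b p * echar p x)))"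
      unfolding S1_def S2_def expser_def by (simp only: infsum_cmult_right')
    also have "\<dots> = (\<Sum>\<^sub>\<infinity>p. b p * echar p (x + h) - b p * echar p x
        - (h $ 1 * (2 * pi * \<i> * of_int (fst p) * b p * echar p x)
          + h $ 2 * (2 * pi * \<i> * of_int (snd p) * b p * echar p x)))"
      unfolding infsum_diff_complex(1)[OF s0(2,1)] infsum_add[OF s0(3,4), symmetric]
      by (rule infsum_diff_complex(1)[OF infsum_diff_complex(2)[OF s0(2,1)] summable_on_add[OF s0(3,4)]])
    also have "\<dots> = (\<Sum>\<^sub>\<infinity>p. b p * echar p x * (exp (\<theta> p h) - 1 - \<theta> p h))"
      by (intro infsum_cong) (simp add: \<theta>_def echar_add_vec echar_def[of _ h] algebra_simps)
    finally show ?thesis .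
  qed
  have bound: "cmod (expser b (x + h) - expser b x - (h $ 1 * S1 + h $ 2 * S2)) \<le> K * (norm h)\<^sup>2"
    if h: "norm h \<le> 1" for h
  proof -
    have "cmod (b p * echar p x * (exp (\<theta> p h) - 1 - \<theta> p h)) \<le> cmod (b p) * exp (R * weight p) * (norm h)\<^sup>2" for p
    proof -
      define y where "y = 2 * pi * weight p"
      have y0: "y \<ge> 0" by (simp add: y_def)
      have th: "cmod (\<theta> p h) \<le> y * norm h"
        using mult_left_mono[OF norm_index_le[of p h], of "2 * pi"]
        unfolding \<theta>_def y_def norm_2pi_i by (simp add: mult_ac)
      have th1: "cmod (\<theta> p h) \<le> y"
        using th mult_left_mono[OF h y0] by simp
      have yexp: "y \<le> exp y" using exp_ge_add_one_self[of y] by linarith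
      have "cmod (exp (\<theta> p h) - 1 - \<theta> p h) \<le> exp (cmod (\<theta> p h)) * (cmod (\<theta> p h))\<^sup>2"
        by (rule norm_exp_remainder)
      also have "\<dots> \<le> exp y * (y * norm h)\<^sup>2"
        using th th1 by (intro mult_mono power_mono) auto
      also have "\<dots> = exp y * y\<^sup>2 * (norm h)\<^sup>2" by (simp add: power_mult_distrib)
      also have "\<dots> \<le> exp y * (exp y)\<^sup>2 * (norm h)\<^sup>2"
        using yexp y0 by (intro mult_right_mono mult_left_mono power_mono) auto
      also have "\<dots> = exp (3 * y) * (norm h)\<^sup>2"
        by (simp add: power2_eq_square exp_add[symmetric])
      finally have r: "cmod (exp (\<theta> p h) - 1 - \<theta> p h) \<le> exp (3 * y) * (norm h)\<^sup>2" .
      have "cmod (b p * echar p x * (exp (\<theta> p h) - 1 - \<theta> p h))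
          \<le> cmod (b p) * exp (2 * pi * norm x * weight p) * (exp (3 * y) * (norm h)\<^sup>2)"
        unfolding norm_mult by (intro mult_mono norm_echar_le r) auto
      also have "\<dots> = cmod (b p) * (exp (2 * pi * norm x * weight p) * exp (3 * y)) * (norm h)\<^sup>2"
        by (simp only: mult_ac)
      also have "exp (2 * pi * norm x * weight p) * exp (3 * y) = exp (R * weight p)"
        unfolding exp_add[symmetric] R_def y_def by (simp add: distrib_right)
      finally show ?thesis .
    qed
    then have "cmod (\<Sum>\<^sub>\<infinity>p. b p * echar p x * (exp (\<theta> p h) - 1 - \<theta> p h))
        \<le> (\<Sum>\<^sub>\<infinity>p. cmod (b p) * exp (R * weight p) * (norm h)\<^sup>2)"
      by (intro abs_summable_majorant(2) summable_on_cmult_left Ks)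
    also have "\<dots> = K * (norm h)\<^sup>2" unfolding K_def by (rule infsum_cmult_left')
    finally show ?thesis unfolding rem .
  qed
  have bl: "bounded_linear (\<lambda>v::complex^2. v $ 1 * S1 + v $ 2 * S2)"
    by (intro bounded_linear_add bounded_linear_mult_const bounded_linear_vec_nth)
  have lim: "((\<lambda>h. norm (expser b (x + h) - expser b x - (h $ 1 * S1 + h $ 2 * S2)) / norm h) \<longlongrightarrow> 0) (at 0)"
  proof (rule Lim_null_comparison)
    show "((\<lambda>h::complex^2. K * norm h) \<longlongrightarrow> 0) (at 0)"
      by (intro tendsto_mult_right_zero tendsto_norm_zero tendsto_ident_at)
    have "\<forall>\<^sub>F h in at 0. h \<in> ball 0 1 - {0 :: complex^2}"
      by (intro eventually_at_in_open) auto
    then show "\<forall>\<^sub>F h in at 0. norm (norm (expser b (x + h) - expser b x - (h $ 1 * S1 + h $ 2 * S2)) / norm h) \<le> K * norm h"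
    proof eventually_elim
      case (elim h)
      then have h: "h \<noteq> 0" "norm h \<le> 1" by auto
      from bound[OF h(2)] h(1) show ?case by (simp add: power2_eq_square divide_simps mult_ac)
    qed
  qed
  show ?thesis using bl lim unfolding has_derivative_at S1_def S2_def by blast
qed

lemma holomorphic2_expser:
  assumes "rapid b" shows "holomorphic2_on (expser b) S"
  unfolding holomorphic2_on_def
proof
  fix x
  show "\<exists>D. (expser b has_derivative D) (at x) \<and> (\<forall>c v. D (c *s v) = c * D v)"
    by (rule exI, rule conjI[OF expser_has_derivative[OF assms]]) (simp add: algebra_simps)
qed

lemma echar_period: "echar p (vec2 (s + 1) t) = echar p (vec2 s t)" "echar p (vec2 s (t + 1)) = echar p (vec2 s t)"
proof -
  have "vec2 (s + 1) t = vec2 s t + vec2 1 0" "vec2 s (t + 1) = vec2 s t + vec2 0 1"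
    by (simp_all add: vec_eq_iff forall_2)
  moreover have "echar p (vec2 1 0) = 1" "echar p (vec2 0 1) = 1"
    using exp_2pi_int[of "fst p"] exp_2pi_int[of "snd p"] by (simp_all add: echar_def)
  ultimately show "echar p (vec2 (s + 1) t) = echar p (vec2 s t)" "echar p (vec2 s (t + 1)) = echar p (vec2 s t)"
    by (simp_all only: echar_add_vec mult_1_right)
qed

text \<open>On the real points all characters have modulus one, so the tail of the series beyond a finite set
  of indices is uniformly small there, and so are its Fourier coefficients.\<close>

lemma fcoeff2_expser:
  assumes b: "rapid b" shows "fcoeff2 p (expser b) = b p"
proof -
  have bs: "(\<lambda>p. cmod (b p)) summable_on UNIV" using b[unfolded rapid_def, rule_format, of 0] by simp
  define S where "S = (\<Sum>\<^sub>\<infinity>p. cmod (b p))"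
  have le: "cmod (fcoeff2 p (expser b) - b p) \<le> e" if e: "e > 0" for e
  proof -
    have "\<forall>\<^sub>F F in finite_subsets_at_top UNIV. dist (\<Sum>q\<in>F. cmod (b q)) S < e"
      using has_sum_infsum[OF bs] e unfolding has_sum_def S_def tendsto_iff by blast
    then obtain F0 where F0: "finite F0" "\<And>F. finite F \<Longrightarrow> F0 \<subseteq> F \<Longrightarrow> dist (\<Sum>q\<in>F. cmod (b q)) S < e"
      unfolding eventually_finite_subsets_at_top by auto
    define F where "F = insert p F0"
    have F: "finite F" "p \<in> F" "F0 \<subseteq> F" using F0 by (auto simp: F_def)
    define c where "c q = (if q \<in> F then 0 else b q)" for q
    have c: "rapid c" by (rule rapid_le[OF b, of _ 1 0]) (simp add: c_def)
    have cs: "(\<lambda>p. cmod (c p)) summable_on UNIV" using c[unfolded rapid_def, rule_format, of 0] by simp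
    have split: "expser b x = (\<Sum>q\<in>F. b q * echar q x) + expser c x" for x
    proof -
      have hs: "((\<lambda>q. if q \<in> F then b q * echar q x else 0) has_sum (\<Sum>q\<in>F. b q * echar q x)) UNIV"
        by (rule has_sum_finite_neutralI[OF F(1)]) simp_all
      note s1 = has_sum_imp_summable[OF hs] and e1 = infsumI[OF hs]
      have "expser b x = (\<Sum>\<^sub>\<infinity>q. (if q \<in> F then b q * echar q x else 0) + c q * echar q x)"
        unfolding expser_def by (intro infsum_cong) (simp add: c_def)
      also have "\<dots> = (\<Sum>q\<in>F. b q * echar q x) + expser c x"
        unfolding infsum_add[OF s1 rapid_summable[OF c]] e1 expser_def ..
      finally show ?thesis .
    qed
    have tail: "(\<Sum>\<^sub>\<infinity>q. cmod (c q)) = S - (\<Sum>q\<in>F. cmod (b q))"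
    proof -
      have hs: "((\<lambda>q. if q \<in> F then cmod (b q) else 0) has_sum (\<Sum>q\<in>F. cmod (b q))) UNIV"
        by (rule has_sum_finite_neutralI[OF F(1)]) simp_all
      note s1 = has_sum_imp_summable[OF hs] and e1 = infsumI[OF hs]
      have "S = (\<Sum>\<^sub>\<infinity>q. (if q \<in> F then cmod (b q) else 0) + cmod (c q))"
        unfolding S_def by (intro infsum_cong) (simp add: c_def)
      also have "\<dots> = (\<Sum>q\<in>F. cmod (b q)) + (\<Sum>\<^sub>\<infinity>q. cmod (c q))"
        unfolding infsum_add[OF s1 cs] e1 ..
      finally show ?thesis by simp
    qed
    have "cmod (fcoeff2 p (expser c)) \<le> (\<Sum>\<^sub>\<infinity>q. cmod (c q))"
    proof (rule fcoeff2_norm_le[OF holomorphic2_expser[OF c]])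
      fix s t :: real
      have "cmod (echar q (vec2 (of_real s) (of_real t))) = 1" for q
        by (simp add: echar_def)
      then show "cmod (expser c (vec2 (of_real s) (of_real t))) \<le> (\<Sum>\<^sub>\<infinity>q. cmod (c q))"
        unfolding expser_def by (intro abs_summable_majorant(2) cs) (simp add: norm_mult)
    qed
    also have "\<dots> < e" using F0(2)[OF F(1,3)] unfolding tail dist_real_def by linarith
    finally have "cmod (fcoeff2 p (expser c)) < e" .
    moreover have "fcoeff2 p (expser b) = b p + fcoeff2 p (expser c)"
    proof -
      have "fcoeff2 p (expser b) = fcoeff2 p (\<lambda>x. (\<Sum>q\<in>F. b q * echar q x) + expser c x)"
        by (rule arg_cong[where f = "fcoeff2 p"]) (rule ext, rule split)
      also have "\<dots> = fcoeff2 p (\<lambda>x. (\<Sum>q\<in>F. b q * echar q x)) + fcoeff2 p (expser c)"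
        by (intro fcoeff2_add holomorphic2_expser c holomorphic2_sum[OF F(1)]
            holomorphic2_on_mult[OF holomorphic2_on_const holomorphic2_echar])
      also have "fcoeff2 p (\<lambda>x. (\<Sum>q\<in>F. b q * echar q x)) = (\<Sum>q\<in>F. b q * (if p = q then 1 else 0))"
        unfolding fcoeff2_sum[OF F(1) holomorphic2_echar] fcoeff2_echar ..
      also have "\<dots> = (\<Sum>q\<in>F. if p = q then b q else 0)" by (intro sum.cong) auto
      also have "\<dots> = b p" using F(1,2) by simp
      finally show ?thesis .
    qed
    ultimately show "cmod (fcoeff2 p (expser b) - b p) \<le> e" by simp
  qed
  have "cmod (fcoeff2 p (expser b) - b p) \<le> 0"
  proof (rule field_le_epsilon)
    fix e :: real assume "0 < e"
    from le[OF this] show "cmod (fcoeff2 p (expser b) - b p) \<le> 0 + e" by simp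
  qed
  then show ?thesis by simp
qed

section \<open>Cosets of a circulant sublattice of the integer plane\<close>

definition circ_lattice :: "int \<Rightarrow> int \<Rightarrow> (int \<times> int) set" where
  "circ_lattice a b = {(a * m + b * n, b * m + a * n) | m n. True}"

text \<open>The Hermite normal form: with \<open>g = gcd(a, b)\<close>, the lattice spanned by \<open>(a, b)\<close> and \<open>(b, a)\<close> has the
  triangular basis \<open>(r, g)\<close>, \<open>(d, 0)\<close>. Here \<open>g d = a\<^sup>2 - b\<^sup>2\<close>, so the integer points of a \<open>d\<close> by \<open>g\<close> box
  represent the cosets.\<close>

lemma circ_lattice_triangular:
  fixes a b g a' b' u v d r :: int
  assumes ab: "a = g * a'" "b = g * b'" and bez: "u * a' + v * b' = 1"
    and d: "d = a * a' - b * b'" and r: "r = a * v + b * u"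
  shows "(p, q) \<in> circ_lattice a b \<longleftrightarrow> (\<exists>t j. q = g * t \<and> p = r * t + d * j)"
proof
  assume "(p, q) \<in> circ_lattice a b"
  then obtain m n where p: "p = a * m + b * n" and q: "q = b * m + a * n"
    by (auto simp: circ_lattice_def)
  have "q = g * (b' * m + a' * n)" by (simp add: q ab algebra_simps)
  moreover have "p = r * (b' * m + a' * n) + d * (u * m - v * n)"
  proof -
    have "r * (b' * m + a' * n) + d * (u * m - v * n)
        = a * m * (u * a' + v * b') + b * n * (u * a' + v * b')"
      by (simp add: r d algebra_simps)
    then show ?thesis by (simp add: bez p)
  qed
  ultimately show "\<exists>t j. q = g * t \<and> p = r * t + d * j" by blast
next
  assume "\<exists>t j. q = g * t \<and> p = r * t + d * j"
  then obtain t j where q: "q = g * t" and p: "p = r * t + d * j" by blast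
  have "p = a * (v * t + a' * j) + b * (u * t - b' * j)" by (simp add: p r d algebra_simps)
  moreover have "q = b * (v * t + a' * j) + a * (u * t - b' * j)"
  proof -
    have "b * (v * t + a' * j) + a * (u * t - b' * j) = g * t * (u * a' + v * b')"
      by (simp add: ab algebra_simps)
    then show ?thesis by (simp add: bez q)
  qed
  ultimately show "(p, q) \<in> circ_lattice a b" unfolding circ_lattice_def by blast
qed

lemma circ_lattice_reps:
  assumes "\<bar>b\<bar> < a"
  obtains R where "finite R" "card R = nat (a\<^sup>2 - b\<^sup>2)"
    "\<And>p q. \<exists>!r. r \<in> R \<and> (p - fst r, q - snd r) \<in> circ_lattice a b"
proof -
  define g where "g = gcd a b"
  have g: "g > 0" using assms by (auto simp: g_def)
  obtain a' b' where ab: "a = g * a'" "b = g * b'"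
    unfolding g_def by (meson dvdE gcd_dvd1 gcd_dvd2)
  obtain u v where "u * a + v * b = g" unfolding g_def using bezout_int by blast
  then have "g * (u * a' + v * b') = g * 1" by (simp add: ab algebra_simps)
  then have bez: "u * a' + v * b' = 1" using g by (simp only: mult_cancel_left) simp
  define d where "d = a * a' - b * b'"
  define r where "r = a * v + b * u"
  have D: "a\<^sup>2 - b\<^sup>2 = g * d" by (simp add: d_def ab power2_eq_square algebra_simps)
  have "\<bar>b\<bar>\<^sup>2 < a\<^sup>2" using assms by (intro power_strict_mono) auto
  then have "g * d > 0" by (simp flip: D)
  then have d0: "d > 0" using g by (simp add: zero_less_mult_iff)
  note mem = circ_lattice_triangular[OF ab bez d_def r_def]
  show thesis
  proof (rule that[of "{0..<d} \<times> {0..<g}"])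
    show "card ({0..<d} \<times> {0..<g}) = nat (a\<^sup>2 - b\<^sup>2)"
      using g d0 by (simp add: card_cartesian_product D nat_mult_distrib mult.commute)
    fix p q :: int
    define t where "t = q div g"
    show "\<exists>!s. s \<in> {0..<d} \<times> {0..<g} \<and> (p - fst s, q - snd s) \<in> circ_lattice a b"
    proof (rule ex1I[of _ "((p - r * t) mod d, q mod g)"])
      have "q - q mod g = g * t" by (simp add: t_def minus_mod_eq_mult_div)
      moreover have "p - (p - r * t) mod d = r * t + d * ((p - r * t) div d)"
        using mult_div_mod_eq[of d "p - r * t"] by linarith
      ultimately show "((p - r * t) mod d, q mod g) \<in> {0..<d} \<times> {0..<g} \<and>
          (p - fst ((p - r * t) mod d, q mod g), q - snd ((p - r * t) mod d, q mod g)) \<in> circ_lattice a b"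
        using g d0 unfolding mem fst_conv snd_conv by auto
    next
      fix s assume s: "s \<in> {0..<d} \<times> {0..<g} \<and> (p - fst s, q - snd s) \<in> circ_lattice a b"
      then obtain t' j where tj: "q - snd s = g * t'" "p - fst s = r * t' + d * j"
        unfolding mem by blast
      have rng: "0 \<le> fst s" "fst s < d" "0 \<le> snd s" "snd s < g" using s by (auto simp: mem_Times_iff)
      have q: "q = snd s + g * t'" using tj by simp
      have "q mod g = snd s" using rng by (simp add: q)
      moreover have "t = t'" using rng g by (simp add: t_def q)
      moreover have "p - r * t' = fst s + d * j" using tj by simp
      then have "(p - r * t') mod d = fst s" using rng by simp
      ultimately show "s = ((p - r * t) mod d, q mod g)" by (simp add: prod_eq_iff)
    qed
  qed simp
qed

section \<open>Theta functions\<close>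

lemma summable_exp_weight: "(\<lambda>p. exp (- weight p)) summable_on UNIV"
proof -
  have nat: "(\<lambda>n::nat. exp (- real n)) summable_on UNIV"
  proof (rule norm_summable_imp_summable_on)
    have "summable (\<lambda>n. exp (-1 :: real) ^ n)" by (rule summable_geometric) simp
    then show "summable (\<lambda>n. norm (exp (- real n)))"
      by (simp add: exp_of_nat_mult[symmetric])
  qed
  have int: "(\<lambda>i::int. exp (- real_of_int \<bar>i\<bar>)) summable_on UNIV"
  proof -
    have u: "(UNIV :: int set) = range int \<union> range (\<lambda>n. - 1 - int n)"
    proof -
      have "i \<in> range int \<union> range (\<lambda>n. - 1 - int n)" for i
      proof (cases "i \<ge> 0")
        case True
        then have "i = int (nat i)" by simp
        then show ?thesis by blast
      next
        case False
        then have "i = - 1 - int (nat (- 1 - i))" by simp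
        then show ?thesis by blast
      qed
      then show ?thesis by blast
    qed
    have "(\<lambda>i::int. exp (- real_of_int \<bar>i\<bar>)) summable_on range int"
      by (subst summable_on_reindex) (auto simp: o_def nat)
    moreover have "(\<lambda>i::int. exp (- real_of_int \<bar>i\<bar>)) summable_on range (\<lambda>n. - 1 - int n)"
    proof (subst summable_on_reindex)
      have "(\<lambda>n::nat. exp (- 1) * exp (- real n)) summable_on UNIV"
        by (rule summable_on_cmult_right[OF nat])
      then show "((\<lambda>i::int. exp (- real_of_int \<bar>i\<bar>)) \<circ> (\<lambda>n. - 1 - int n)) summable_on UNIV"
        by (simp add: o_def exp_diff exp_minus field_simps exp_add[symmetric])
    qed (auto simp: inj_on_def)
    ultimately show ?thesis unfolding u by (rule summable_on_Un_disjoint) auto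
  qed
  have "(\<lambda>p. exp (- weight p)) summable_on (UNIV \<times> UNIV)"
  proof (rule summable_on_SigmaI)
    fix i :: int
    have "((\<lambda>j. exp (- real_of_int \<bar>i\<bar>) * exp (- real_of_int \<bar>j\<bar>)) has_sum
        (exp (- real_of_int \<bar>i\<bar>) * (\<Sum>\<^sub>\<infinity>j. exp (- real_of_int \<bar>j\<bar>)))) UNIV"
      by (rule has_sum_cmult_right[OF has_sum_infsum[OF int]])
    then show "((\<lambda>j. exp (- weight (i, j))) has_sum
        (exp (- real_of_int \<bar>i\<bar>) * (\<Sum>\<^sub>\<infinity>j. exp (- real_of_int \<bar>j\<bar>)))) UNIV"
      by (simp add: weight_def exp_diff exp_minus field_simps)
  next
    show "(\<lambda>i. exp (- real_of_int \<bar>i\<bar>) * (\<Sum>\<^sub>\<infinity>j. exp (- real_of_int \<bar>j\<bar>))) summable_on (UNIV :: int set)"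
      by (rule summable_on_cmult_left[OF int])
  qed simp
  then show ?thesis by simp
qed

text \<open>Completing the square, with one unit of linear decay left over for summability.\<close>

lemma gaussian_le:
  fixes c R x :: real
  assumes "c > 0"
  shows "- c * x\<^sup>2 + R * \<bar>x\<bar> \<le> (R + 1)\<^sup>2 / (4 * c) - \<bar>x\<bar>"
proof -
  have "0 \<le> (2 * c * \<bar>x\<bar> - (R + 1))\<^sup>2" by simp
  also have "\<dots> = 4 * c * (c * x\<^sup>2 - (R + 1) * \<bar>x\<bar>) + (R + 1)\<^sup>2"
    by (simp add: power2_eq_square algebra_simps)
  finally have "4 * c * ((R + 1) * \<bar>x\<bar> - c * x\<^sup>2) \<le> (R + 1)\<^sup>2"
    by (simp add: algebra_simps)
  then have "(R + 1) * \<bar>x\<bar> - c * x\<^sup>2 \<le> (R + 1)\<^sup>2 / (4 * c)"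
    using assms by (simp add: pos_le_divide_eq mult.commute)
  then show ?thesis by (simp add: algebra_simps)
qed

lemma rapid_gaussian:
  fixes C c :: real
  assumes c: "c > 0" and le: "\<And>p. cmod (b p) \<le> C * exp (- c * ((of_int (fst p))\<^sup>2 + (of_int (snd p))\<^sup>2))"
  shows "rapid b"
  unfolding rapid_def
proof
  fix R
  define K where "K = (R + 1)\<^sup>2 / (4 * c)"
  have C0: "0 \<le> C"
    using order_trans[OF norm_ge_zero le[of "(0, 0)"]] by simp
  show "(\<lambda>p. cmod (b p) * exp (R * weight p)) summable_on UNIV"
  proof (rule abs_summable_majorant(1))
    show "(\<lambda>p. C * exp (2 * K) * exp (- weight p)) summable_on UNIV"
      by (rule summable_on_cmult_right[OF summable_exp_weight])
    fix p :: "int \<times> int"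
    let ?x = "real_of_int (fst p)" and ?y = "real_of_int (snd p)"
    have "- c * (?x\<^sup>2 + ?y\<^sup>2) + R * weight p = (- c * ?x\<^sup>2 + R * \<bar>?x\<bar>) + (- c * ?y\<^sup>2 + R * \<bar>?y\<bar>)"
      by (simp add: weight_def distrib_left)
    also have "\<dots> \<le> (K - \<bar>?x\<bar>) + (K - \<bar>?y\<bar>)"
      unfolding K_def by (intro add_mono gaussian_le c)
    also have "\<dots> = 2 * K + - weight p" by (simp add: weight_def)
    finally have e: "exp (- c * (?x\<^sup>2 + ?y\<^sup>2)) * exp (R * weight p) \<le> exp (2 * K) * exp (- weight p)"
      unfolding exp_add[symmetric] by simp
    have "cmod (b p) * exp (R * weight p) \<le> C * exp (- c * (?x\<^sup>2 + ?y\<^sup>2)) * exp (R * weight p)"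
      by (intro mult_right_mono le) simp
    also have "\<dots> \<le> C * (exp (2 * K) * exp (- weight p))"
      unfolding mult.assoc by (intro mult_left_mono e C0)
    finally show "norm (cmod (b p) * exp (R * weight p)) \<le> C * exp (2 * K) * exp (- weight p)"
      by (simp add: mult.assoc)
  qed
qed

definition dotp :: "int \<times> int \<Rightarrow> complex^2 \<Rightarrow> complex" where
  "dotp p x = of_int (fst p) * x $ 1 + of_int (snd p) * x $ 2"

lemma echar_dotp: "echar p x = exp (2 * pi * \<i> * dotp p x)"
  by (simp add: echar_def dotp_def)

definition ivec :: "int \<times> int \<Rightarrow> complex^2" where
  "ivec n = vec2 (of_int (fst n)) (of_int (snd n))"

lemma echar_ivec [simp]: "echar p (ivec n) = 1"
proof -
  have "echar p (ivec n) = exp (2 * of_real pi * \<i> * of_int (fst p * fst n + snd p * snd n))"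
    unfolding echar_def ivec_def vec2_nth of_int_add of_int_mult of_real_mult by (simp only: of_real_numeral)
  then show ?thesis by (simp only: exp_2pi_int)
qed

text \<open>The imaginary part of \<open>\<Omega>\<close> times the matrix \<open>S = (2 1; 1 2)\<close> of \<open>H\<^sub>*\<close> is the circulant matrix
  \<open>M = (a b; b a)\<close>. The hypotheses of the theorem say that \<open>M\<close> is an integer matrix and that the
  imaginary part of \<open>\<Omega>\<close> is positive definite. Integer vectors are pairs.\<close>

locale theta_data =
  fixes \<tau> \<zeta> :: complex and a b :: int
  assumes im_less: "\<bar>Im \<zeta>\<bar> < Im \<tau>"
    and im_a: "Im (2 * \<tau> + \<zeta>) = of_int a" and im_b: "Im (\<tau> + 2 * \<zeta>) = of_int b"
begin

lemma a_eq: "real_of_int a = 2 * Im \<tau> + Im \<zeta>" and b_eq: "real_of_int b = Im \<tau> + 2 * Im \<zeta>"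
  using im_a im_b by simp_all

lemma b_less_a: "\<bar>b\<bar> < a"
proof -
  have "\<bar>real_of_int b\<bar> < real_of_int a" using im_less unfolding a_eq b_eq by linarith
  then show ?thesis by linarith
qed

lemma disc_eq: "(real_of_int a)\<^sup>2 - (real_of_int b)\<^sup>2 = 3 * ((Im \<tau>)\<^sup>2 - (Im \<zeta>)\<^sup>2)"
  unfolding a_eq b_eq by (simp add: power2_eq_square algebra_simps)

lemma disc_pos: "a\<^sup>2 - b\<^sup>2 > 0"
proof -
  have "\<bar>b\<bar>\<^sup>2 < a\<^sup>2" using b_less_a by (intro power_strict_mono) auto
  then show ?thesis by simp
qed

text \<open>The vector \<open>m\<Omega>\<close>; the lattice consists of the sums of such vectors and integer points \<open>ivec n\<close>.\<close>

definition Om :: "int \<times> int \<Rightarrow> complex^2" where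
  "Om m = vec2 (of_int (fst m) * \<tau> + of_int (snd m) * \<zeta>) (of_int (fst m) * \<zeta> + of_int (snd m) * \<tau>)"

text \<open>The integer vector \<open>mM\<close>: the values of the alternating form \<open>E\<^sub>*\<close> on \<open>m\<Omega>\<close> and \<open>\<int>\<^sup>2\<close>.\<close>

definition Mi :: "int \<times> int \<Rightarrow> int \<times> int" where
  "Mi m = (a * fst m + b * snd m, b * fst m + a * snd m)"

definition theta_factor :: "int \<times> int \<Rightarrow> complex^2 \<Rightarrow> complex" where
  "theta_factor m y = exp (- (2 * pi * \<i> * dotp (Mi m) y) - pi * \<i> * dotp (Mi m) (Om m))"

text \<open>The classical normalization of the sections of the \<open>k\<close>-th power of the line bundle: theta functions
  that are periodic under \<open>\<int>\<^sup>2\<close> and quasi-periodic under \<open>\<int>\<^sup>2\<Omega>\<close>, with trivial characters.\<close>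

definition theta_space :: "nat \<Rightarrow> (complex^2 \<Rightarrow> complex) set" where
  "theta_space k = {f. holomorphic2_on f UNIV \<and>
     (\<forall>m n y. f (y + Om m + ivec n) = theta_factor m y ^ k * f y)}"

text \<open>The entries of the symmetric circulant matrix \<open>N = \<Omega>M\<^sup>-\<^sup>1\<close>. Its imaginary part is
  \<open>S\<^sup>-\<^sup>1\<close>, independently of \<open>\<Omega>\<close>, hence positive definite.\<close>

definition \<nu> :: complex where "\<nu> = (of_int a * \<tau> - of_int b * \<zeta>) / of_int (a\<^sup>2 - b\<^sup>2)"
definition \<mu> :: complex where "\<mu> = (of_int a * \<zeta> - of_int b * \<tau>) / of_int (a\<^sup>2 - b\<^sup>2)"

lemma disc_ne0: "(of_int a)\<^sup>2 - (of_int b)\<^sup>2 \<noteq> (0 :: complex)"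
proof -
  have "of_int (a\<^sup>2 - b\<^sup>2) \<noteq> (0 :: complex)" using disc_pos by (simp only: of_int_eq_0_iff)
  then show ?thesis by simp
qed

lemma \<nu>\<mu>_tau: "of_int a * \<nu> + of_int b * \<mu> = \<tau>"
proof -
  have "of_int a * \<nu> + of_int b * \<mu> = (((of_int a)\<^sup>2 - (of_int b)\<^sup>2) * \<tau>) / ((of_int a)\<^sup>2 - (of_int b)\<^sup>2)"
    unfolding \<nu>_def \<mu>_def by (simp add: add_divide_distrib[symmetric] power2_eq_square algebra_simps)
  then show ?thesis using disc_ne0 by simp
qed

lemma \<nu>\<mu>_zeta: "of_int b * \<nu> + of_int a * \<mu> = \<zeta>"
proof -
  have "of_int b * \<nu> + of_int a * \<mu> = (((of_int a)\<^sup>2 - (of_int b)\<^sup>2) * \<zeta>) / ((of_int a)\<^sup>2 - (of_int b)\<^sup>2)"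
    unfolding \<nu>_def \<mu>_def by (simp add: add_divide_distrib[symmetric] power2_eq_square algebra_simps)
  then show ?thesis using disc_ne0 by simp
qed

lemma Im_\<nu>: "Im \<nu> = 2 / 3" and Im_\<mu>: "Im \<mu> = - 1 / 3"
proof -
  define D where "D = (Im \<tau>)\<^sup>2 - (Im \<zeta>)\<^sup>2"
  have h: "real_of_int (a\<^sup>2 - b\<^sup>2) = 3 * D" using disc_eq by (simp add: D_def)
  then have D: "D > 0" using disc_pos by linarith
  have "of_int (a\<^sup>2 - b\<^sup>2) = (of_real (of_int (a\<^sup>2 - b\<^sup>2)) :: complex)"
    by (rule of_real_of_int_eq[symmetric])
  also have "\<dots> = of_real (3 * D)" by (simp only: h)
  finally have "\<nu> = (of_int a * \<tau> - of_int b * \<zeta>) / of_real (3 * D)"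
      "\<mu> = (of_int a * \<zeta> - of_int b * \<tau>) / of_real (3 * D)"
    unfolding \<nu>_def \<mu>_def by (simp_all only:)
  then have "Im \<nu> = (of_int a * Im \<tau> - of_int b * Im \<zeta>) / (3 * D)"
    "Im \<mu> = (of_int a * Im \<zeta> - of_int b * Im \<tau>) / (3 * D)"
    by (simp_all only: Im_divide_of_real) simp_all
  moreover have "of_int a * Im \<tau> - of_int b * Im \<zeta> = 2 * D" "of_int a * Im \<zeta> - of_int b * Im \<tau> = - D"
    unfolding a_eq b_eq D_def by (simp_all add: power2_eq_square algebra_simps)
  ultimately show "Im \<nu> = 2 / 3" "Im \<mu> = - 1 / 3" using D by simp_all
qed

definition Nform :: "int \<times> int \<Rightarrow> int \<times> int \<Rightarrow> complex" where
  "Nform p q = of_int (fst p) * (\<nu> * of_int (fst q) + \<mu> * of_int (snd q))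
     + of_int (snd p) * (\<mu> * of_int (fst q) + \<nu> * of_int (snd q))"

lemma Nform_Mi: "Nform p (Mi m) = dotp p (Om m)"
proof -
  have "\<nu> * of_int (a * fst m + b * snd m) + \<mu> * of_int (b * fst m + a * snd m)
      = of_int (fst m) * (of_int a * \<nu> + of_int b * \<mu>) + of_int (snd m) * (of_int b * \<nu> + of_int a * \<mu>)"
    "\<mu> * of_int (a * fst m + b * snd m) + \<nu> * of_int (b * fst m + a * snd m)
      = of_int (fst m) * (of_int b * \<nu> + of_int a * \<mu>) + of_int (snd m) * (of_int a * \<nu> + of_int b * \<mu>)"
    by (simp_all add: algebra_simps)
  then show ?thesis
    unfolding Nform_def Mi_def dotp_def Om_def fst_conv snd_conv \<nu>\<mu>_tau \<nu>\<mu>_zeta vec2_nth by simp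
qed

text \<open>The quasi-periodicity of a theta function is a recursion for its Fourier coefficients along the
  cosets of \<open>kM\<int>\<^sup>2\<close>. This Gaussian is one solution, and all others are multiples of it by functions
  that are constant on the cosets.\<close>

definition gauss :: "nat \<Rightarrow> int \<times> int \<Rightarrow> complex" where
  "gauss k p = exp (pi * \<i> * Nform p p / of_nat k)"

lemma gauss_nonzero [simp]: "gauss k p \<noteq> 0" by (simp add: gauss_def)

definition mshift :: "nat \<Rightarrow> int \<times> int \<Rightarrow> int \<times> int \<Rightarrow> int \<times> int" where
  "mshift k p m = (fst p + int k * fst (Mi m), snd p + int k * snd (Mi m))"

lemma gauss_mshift:
  assumes k: "k > 0"
  shows "gauss k (mshift k p m) = gauss k p * (echar p (Om m) * exp (of_nat k * (pi * \<i> * dotp (Mi m) (Om m))))"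
proof -
  have "Nform (mshift k p m) (mshift k p m)
      = Nform p p + 2 * of_nat k * Nform p (Mi m) + (of_nat k)\<^sup>2 * Nform (Mi m) (Mi m)"
    by (simp add: Nform_def mshift_def algebra_simps power2_eq_square)
  then have "pi * \<i> * Nform (mshift k p m) (mshift k p m) / of_nat k
      = pi * \<i> * Nform p p / of_nat k + (2 * pi * \<i> * dotp p (Om m) + of_nat k * (pi * \<i> * dotp (Mi m) (Om m)))"
    using k unfolding Nform_Mi by (simp add: field_simps power2_eq_square)
  then show ?thesis unfolding gauss_def echar_dotp by (simp only: exp_add)
qed

lemma norm_gauss_le:
  assumes k: "k > 0"
  shows "cmod (gauss k p) \<le> exp (- (pi / (3 * real k)) * ((of_int (fst p))\<^sup>2 + (of_int (snd p))\<^sup>2))"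
proof -
  let ?x = "real_of_int (fst p)" and ?y = "real_of_int (snd p)"
  have "Im (Nform p p) = 2 / 3 * (?x\<^sup>2 + ?y\<^sup>2) - 2 / 3 * (?x * ?y)"
    by (simp add: Nform_def Im_\<nu> Im_\<mu> power2_eq_square algebra_simps)
  moreover have "0 \<le> (?x - ?y)\<^sup>2" by simp
  ultimately have "(?x\<^sup>2 + ?y\<^sup>2) / 3 \<le> Im (Nform p p)"
    by (simp add: power2_eq_square algebra_simps)
  then have "pi * ((?x\<^sup>2 + ?y\<^sup>2) / 3) / real k \<le> pi * Im (Nform p p) / real k"
    using k by (intro divide_right_mono mult_left_mono) auto
  moreover have "Re (pi * \<i> * Nform p p / of_nat k) = - (pi * Im (Nform p p) / real k)"
  proof -
    have "pi * \<i> * Nform p p / of_nat k = (pi * \<i> * Nform p p) / of_real (real k)" by simp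
    then show ?thesis by (simp only: Re_divide_of_real) simp
  qed
  ultimately have "Re (pi * \<i> * Nform p p / of_nat k) \<le> - (pi * ((?x\<^sup>2 + ?y\<^sup>2) / 3) / real k)"
    by linarith
  also have "\<dots> = - (pi / (3 * real k)) * (?x\<^sup>2 + ?y\<^sup>2)" by simp
  finally show ?thesis unfolding gauss_def norm_exp_eq_Re by simp
qed

lemma rapid_gauss:
  assumes k: "k > 0" and d: "\<And>p. cmod (d p) \<le> C"
  shows "rapid (\<lambda>p. d p * gauss k p)"
proof (rule rapid_gaussian)
  show "pi / (3 * real k) > 0" using k by simp
  fix p
  have "0 \<le> C" using order_trans[OF norm_ge_zero d] .
  then show "cmod (d p * gauss k p) \<le> C * exp (- (pi / (3 * real k)) * ((of_int (fst p))\<^sup>2 + (of_int (snd p))\<^sup>2))"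
    unfolding norm_mult by (intro mult_mono d norm_gauss_le k) auto
qed

definition Theta :: "nat \<Rightarrow> (int \<times> int \<Rightarrow> complex) \<Rightarrow> complex^2 \<Rightarrow> complex" where
  "Theta k d = expser (\<lambda>p. d p * gauss k p)"

lemma bij_mshift: "bij (\<lambda>p. mshift k p m)"
  by (rule bij_betw_byWitness[where f' = "\<lambda>p. (fst p - int k * fst (Mi m), snd p - int k * snd (Mi m))"])
     (auto simp: mshift_def)

lemma theta_factor_power:
  "theta_factor m y ^ k = exp (- (of_nat k * (2 * pi * \<i> * dotp (Mi m) y)) - of_nat k * (pi * \<i> * dotp (Mi m) (Om m)))"
  unfolding theta_factor_def exp_of_nat_mult[symmetric] by (simp add: algebra_simps)

lemma echar_mshift: "echar (mshift k p m) y = echar p y * exp (of_nat k * (2 * pi * \<i> * dotp (Mi m) y))"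
  unfolding echar_dotp exp_add[symmetric] by (simp add: dotp_def mshift_def algebra_simps)

text \<open>Adding \<open>m\<Omega>\<close> to the argument amounts, after completing the square, to the translation of the
  summation index by \<open>kmM\<close>, which leaves \<open>d\<close> unchanged.\<close>

lemma Theta_in_theta_space:
  assumes k: "k > 0" and d: "\<And>p. cmod (d p) \<le> C" and per: "\<And>p m. d (mshift k p m) = d p"
  shows "Theta k d \<in> theta_space k"
  unfolding theta_space_def
proof (intro CollectI conjI allI)
  note rap = rapid_gauss[OF k d]
  show "holomorphic2_on (Theta k d) UNIV" unfolding Theta_def by (rule holomorphic2_expser[OF rap])
  fix m n y
  let ?c = "\<lambda>p. d p * gauss k p"
  have "theta_factor m y ^ k * Theta k d y = (\<Sum>\<^sub>\<infinity>p. theta_factor m y ^ k * (?c p * echar p y))"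
    unfolding Theta_def expser_def by (rule infsum_cmult_right'[symmetric])
  also have "\<dots> = (\<Sum>\<^sub>\<infinity>p. theta_factor m y ^ k * (?c (mshift k p m) * echar (mshift k p m) y))"
    by (rule infsum_reindex_bij_betw[OF bij_mshift, symmetric])
  also have "\<dots> = (\<Sum>\<^sub>\<infinity>p. ?c p * echar p (y + Om m + ivec n))"
  proof (rule infsum_cong)
    fix p
    have "theta_factor m y ^ k * (exp (of_nat k * (pi * \<i> * dotp (Mi m) (Om m))) * exp (of_nat k * (2 * pi * \<i> * dotp (Mi m) y))) = 1"
      unfolding theta_factor_power exp_add[symmetric] by simp
    then show "theta_factor m y ^ k * (?c (mshift k p m) * echar (mshift k p m) y) = ?c p * echar p (y + Om m + ivec n)"
      unfolding per gauss_mshift[OF k] echar_mshift echar_add_vec echar_ivec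
      by (simp add: mult_ac)
  qed
  finally show "Theta k d (y + Om m + ivec n) = theta_factor m y ^ k * Theta k d y"
    unfolding Theta_def expser_def by simp
qed

lemma Om_0 [simp]: "Om (0, 0) = 0" and Mi_0 [simp]: "Mi (0, 0) = (0, 0)" and ivec_0 [simp]: "ivec (0, 0) = 0"
  by (simp_all add: Om_def Mi_def ivec_def vec_eq_iff forall_2)

lemma theta_space_ivec:
  assumes "f \<in> theta_space k" shows "f (y + ivec n) = f y"
proof -
  have "f (y + Om (0,0) + ivec n) = theta_factor (0,0) y ^ k * f y" using assms unfolding theta_space_def by blast
  then show ?thesis by (simp add: theta_factor_def dotp_def)
qed

lemma theta_space_Om:
  assumes "f \<in> theta_space k" shows "f (y + Om m) = theta_factor m y ^ k * f y"
proof -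
  have "f (y + Om m + ivec (0,0)) = theta_factor m y ^ k * f y" using assms unfolding theta_space_def by blast
  then show ?thesis by simp
qed

lemma theta_space_biperiodic:
  assumes "f \<in> theta_space k" shows "biperiodic f"
proof -
  have "vec2 (s + 1) t = vec2 s t + ivec (1, 0)" "vec2 s (t + 1) = vec2 s t + ivec (0, 1)" for s t
    by (simp_all add: ivec_def vec_eq_iff forall_2)
  then show ?thesis by (simp add: biperiodic_def theta_space_ivec[OF assms])
qed

lemma theta_space_holomorphic: "f \<in> theta_space k \<Longrightarrow> holomorphic2_on f UNIV"
  by (simp add: theta_space_def)

text \<open>The converse of the preceding computation, read off from the Fourier coefficients of
  \<open>f(y + m\<Omega>)\<close>, which are computed in two ways.\<close>

lemma theta_space_coeff:
  assumes k: "k > 0" and f: "f \<in> theta_space k"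
  shows "fcoeff2 (mshift k p m) f / gauss k (mshift k p m) = fcoeff2 p f / gauss k p"
proof -
  let ?e = "exp (of_nat k * (pi * \<i> * dotp (Mi m) (Om m)))"
  let ?q = "(- int k * fst (Mi m), - int k * snd (Mi m))"
  have "echar p (Om m) * fcoeff2 p f = fcoeff2 p (\<lambda>x. f (x + Om m))"
    by (rule fcoeff2_shift[OF theta_space_holomorphic[OF f] theta_space_biperiodic[OF f], symmetric])
  also have "(\<lambda>x. f (x + Om m)) = (\<lambda>x. inverse ?e * (echar ?q x * f x))"
  proof
    fix x
    have e: "echar ?q x = exp (- (of_nat k * (2 * pi * \<i> * dotp (Mi m) x)))"
      unfolding echar_dotp by (simp add: dotp_def algebra_simps)
    have "theta_factor m x ^ k = inverse ?e * echar ?q x"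
      unfolding theta_factor_power e exp_minus[symmetric] exp_add[symmetric]
      by (rule arg_cong[where f = exp]) simp
    then show "f (x + Om m) = inverse ?e * (echar ?q x * f x)"
      by (simp add: theta_space_Om[OF f] mult.assoc)
  qed
  also have "fcoeff2 p \<dots> = inverse ?e * fcoeff2 (mshift k p m) f"
    unfolding fcoeff2_cmult fcoeff2_mult_echar by (simp add: mshift_def)
  finally have "fcoeff2 (mshift k p m) f = echar p (Om m) * ?e * fcoeff2 p f"
    by (simp add: field_simps)
  then show ?thesis unfolding gauss_mshift[OF k] by (simp add: field_simps)
qed

definition coset_ind :: "nat \<Rightarrow> int \<times> int \<Rightarrow> int \<times> int \<Rightarrow> complex" where
  "coset_ind k r p = (if (fst p - fst r, snd p - snd r) \<in> circ_lattice (int k * a) (int k * b) then 1 else 0)"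

lemma circ_lattice_iff:
  "(fst p - fst r, snd p - snd r) \<in> circ_lattice (int k * a) (int k * b) \<longleftrightarrow> (\<exists>m. p = mshift k r m)"
proof
  assume "(fst p - fst r, snd p - snd r) \<in> circ_lattice (int k * a) (int k * b)"
  then obtain m n where "fst p - fst r = int k * a * m + int k * b * n" "snd p - snd r = int k * b * m + int k * a * n"
    by (auto simp: circ_lattice_def)
  then have "p = mshift k r (m, n)" by (simp add: mshift_def Mi_def prod_eq_iff algebra_simps)
  then show "\<exists>m. p = mshift k r m" by blast
next
  assume "\<exists>m. p = mshift k r m"
  then obtain m where p: "p = mshift k r m" by blast
  have "(fst p - fst r, snd p - snd r) = (int k * a * fst m + int k * b * snd m, int k * b * fst m + int k * a * snd m)"
    by (simp add: p mshift_def Mi_def algebra_simps)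
  then show "(fst p - fst r, snd p - snd r) \<in> circ_lattice (int k * a) (int k * b)"
    unfolding circ_lattice_def by blast
qed

lemma mshift_mshift: "mshift k (mshift k p m) n = mshift k p (fst m + fst n, snd m + snd n)"
  by (simp add: mshift_def Mi_def algebra_simps)

lemma coset_ind_mshift: "coset_ind k r (mshift k p m) = coset_ind k r p"
proof -
  have "(\<exists>n. mshift k p m = mshift k r n) \<longleftrightarrow> (\<exists>n. p = mshift k r n)"
  proof
    assume "\<exists>n. mshift k p m = mshift k r n"
    then obtain n where "mshift k p m = mshift k r n" by blast
    then have "p = mshift k r (fst n - fst m, snd n - snd m)"
      by (simp add: mshift_def Mi_def prod_eq_iff algebra_simps)
    then show "\<exists>n. p = mshift k r n" by blast
  next
    assume "\<exists>n. p = mshift k r n"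
    then show "\<exists>n. mshift k p m = mshift k r n" using mshift_mshift by blast
  qed
  then show ?thesis unfolding coset_ind_def circ_lattice_iff by simp
qed

lemma norm_coset_ind_le: "cmod (coset_ind k r p) \<le> 1"
  by (simp add: coset_ind_def)

definition theta_basis :: "nat \<Rightarrow> int \<times> int \<Rightarrow> complex^2 \<Rightarrow> complex" where
  "theta_basis k r = Theta k (coset_ind k r)"

lemma theta_basis_in: "k > 0 \<Longrightarrow> theta_basis k r \<in> theta_space k"
  unfolding theta_basis_def by (rule Theta_in_theta_space[OF _ norm_coset_ind_le coset_ind_mshift])

lemma fcoeff2_Theta:
  assumes "k > 0" "\<And>p. cmod (d p) \<le> C" shows "fcoeff2 p (Theta k d) = d p * gauss k p"
  unfolding Theta_def by (rule fcoeff2_expser[OF rapid_gauss[OF assms]])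

lemma fcoeff2_theta_basis: "k > 0 \<Longrightarrow> fcoeff2 p (theta_basis k r) = coset_ind k r p * gauss k p"
  unfolding theta_basis_def by (rule fcoeff2_Theta[OF _ norm_coset_ind_le])

text \<open>The Fourier coefficients of a theta function, divided by the Gaussian, form an arbitrary function on
  the finite set of cosets of \<open>kM\<int>\<^sup>2\<close>. Hence the theta series of the single cosets are a basis, and
  the dimension is the index \<open>k\<^sup>2 det M\<close>.\<close>

lemma theta_space_basis:
  assumes k: "k > 0"
  obtains R where "finite R" "card R = k\<^sup>2 * nat (a\<^sup>2 - b\<^sup>2)"
    "\<And>f. f \<in> theta_space k \<Longrightarrow> \<exists>d. \<forall>x. f x = (\<Sum>r\<in>R. d r * theta_basis k r x)"
    "\<And>d r. (\<And>x. (\<Sum>r\<in>R. d r * theta_basis k r x) = 0) \<Longrightarrow> r \<in> R \<Longrightarrow> d r = 0"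
proof -
  have "\<bar>int k * b\<bar> < int k * a" using b_less_a k by (simp add: abs_mult)
  then obtain R where fin: "finite R" and card: "card R = nat ((int k * a)\<^sup>2 - (int k * b)\<^sup>2)"
    and ex1: "\<And>p q. \<exists>!r. r \<in> R \<and> (p - fst r, q - snd r) \<in> circ_lattice (int k * a) (int k * b)"
    by (rule circ_lattice_reps) blast
  have ex1': "\<exists>!r. r \<in> R \<and> (\<exists>m. p = mshift k r m)" for p
    using ex1[of "fst p" "snd p"] unfolding circ_lattice_iff .
  note bas = fcoeff2_theta_basis[OF k]
  have hol: "holomorphic2_on (theta_basis k r) UNIV" for r
    by (rule theta_space_holomorphic[OF theta_basis_in[OF k]])
  have ind: "coset_ind k r p = (if r = r0 then 1 else 0)" if "r \<in> R" "r0 \<in> R" "p = mshift k r0 m" for r r0 p m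
  proof (cases "r = r0")
    case True
    then have "\<exists>m. p = mshift k r m" using that by blast
    then show ?thesis using True unfolding coset_ind_def circ_lattice_iff by simp
  next
    case False
    then have "\<not> (\<exists>m. p = mshift k r m)" using ex1'[of p] that by blast
    then show ?thesis using False unfolding coset_ind_def circ_lattice_iff by simp
  qed
  have self: "r = mshift k r (0, 0)" for r by (simp add: mshift_def)
  show thesis
  proof (rule that[OF fin])
    have "(int k * a)\<^sup>2 - (int k * b)\<^sup>2 = int (k\<^sup>2) * (a\<^sup>2 - b\<^sup>2)"
      by (simp add: power_mult_distrib algebra_simps)
    then show "card R = k\<^sup>2 * nat (a\<^sup>2 - b\<^sup>2)" unfolding card by (simp only: nat_mult_distrib of_nat_0_le_iff nat_int)
  next
    fix f assume f: "f \<in> theta_space k"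
    define d where "d r = fcoeff2 r f / gauss k r" for r
    define g where "g x = f x + (\<Sum>r\<in>R. (- d r) * theta_basis k r x)" for x
    have hs: "holomorphic2_on (\<lambda>x. \<Sum>r\<in>R. (- d r) * theta_basis k r x) UNIV"
      by (rule holomorphic2_sum[OF fin]) (rule holomorphic2_on_mult[OF holomorphic2_on_const hol])
    have g: "holomorphic2_on g UNIV" unfolding g_def
      by (rule holomorphic2_on_add[OF theta_space_holomorphic[OF f] hs])
    have gper: "biperiodic g"
      using theta_space_biperiodic[OF f] theta_space_biperiodic[OF theta_basis_in[OF k]]
      unfolding biperiodic_def g_def by simp
    have "fcoeff2 p g = 0" for p
    proof -
      obtain r0 m where r0: "r0 \<in> R" "p = mshift k r0 m" using ex1'[of p] by blast
      have "fcoeff2 p g = fcoeff2 p f + fcoeff2 p (\<lambda>x. \<Sum>r\<in>R. (- d r) * theta_basis k r x)"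
        unfolding g_def by (rule fcoeff2_add[OF theta_space_holomorphic[OF f] hs])
      also have "fcoeff2 p (\<lambda>x. \<Sum>r\<in>R. (- d r) * theta_basis k r x) = (\<Sum>r\<in>R. (- d r) * (coset_ind k r p * gauss k p))"
        by (simp only: fcoeff2_sum[OF fin hol] bas)
      also have "\<dots> = (\<Sum>r\<in>R. if r = r0 then (- d r) * gauss k p else 0)"
        by (rule sum.cong) (simp_all add: ind[OF _ r0])
      also have "\<dots> = - d r0 * gauss k p" using fin r0(1) by simp
      also have "d r0 = fcoeff2 p f / gauss k p"
        unfolding d_def r0(2) theta_space_coeff[OF k f] ..
      finally show ?thesis by simp
    qed
    then have "g x = 0" for x by (rule fcoeff2_eq_0_imp_eq_0[OF g gper])
    then have "f x = (\<Sum>r\<in>R. d r * theta_basis k r x)" for x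
      by (simp add: g_def sum_negf)
    then show "\<exists>d. \<forall>x. f x = (\<Sum>r\<in>R. d r * theta_basis k r x)" by blast
  next
    fix d r assume 0: "\<And>x. (\<Sum>r\<in>R. d r * theta_basis k r x) = 0" and r: "r \<in> R"
    have "0 = fcoeff2 r (\<lambda>x. \<Sum>r\<in>R. d r * theta_basis k r x)"
      unfolding 0 using fcoeff2_cmult[of r 0 "\<lambda>_. 0"] by simp
    also have "\<dots> = (\<Sum>s\<in>R. d s * (coset_ind k s r * gauss k r))"
      by (simp only: fcoeff2_sum[OF fin hol] bas)
    also have "\<dots> = (\<Sum>s\<in>R. if s = r then d s * gauss k r else 0)"
      by (rule sum.cong) (simp_all add: ind[OF _ r self])
    also have "\<dots> = d r * gauss k r" using fin r by simp
    finally show "d r = 0" by simp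
  qed
qed

end

section \<open>Separation of points and tangent vectors\<close>

lemma dotp_add: "dotp p (x + y) = dotp p x + dotp p y"
  and dotp_diff: "dotp p (x - y) = dotp p x - dotp p y"
  and dotp_scale: "dotp p (t *s x) = t * dotp p x"
  and dotp_0: "dotp p 0 = 0"
  by (simp_all add: dotp_def algebra_simps)

lemma dotp_diff_index: "dotp (fst p - fst q, snd p - snd q) x = dotp p x - dotp q x"
  by (simp add: dotp_def algebra_simps)

lemma holomorphic2_minus: "holomorphic2_on f UNIV \<Longrightarrow> holomorphic2_on (\<lambda>x. f (x - a)) UNIV"
  using holomorphic2_on_translate[of f "- a" UNIV] by simp

context theta_data begin

lemma theta_factor_diff: "theta_factor m (y - w) = theta_factor m y * exp (2 * pi * \<i> * dotp (Mi m) w)"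
  unfolding theta_factor_def exp_add[symmetric] dotp_diff by (simp add: algebra_simps)

lemma theta_factor_add: "theta_factor m (y + u) = theta_factor m y * exp (- (2 * pi * \<i> * dotp (Mi m) u))"
  unfolding theta_factor_def exp_add[symmetric] dotp_add by (simp add: algebra_simps)

lemma theta_factor_nonzero [simp]: "theta_factor m y \<noteq> 0" by (simp add: theta_factor_def)

text \<open>The translates of \<open>f\<close> are sections of translated line bundles; since the translations
  \<open>u\<close>, \<open>v\<close>, \<open>s - u - v\<close> and \<open>n - 3\<close> times \<open>c\<close> add up to zero, the exponential factors cancel in the
  product (the theorem of the square). The two free parameters \<open>u\<close> and \<open>v\<close> need three factors, which is
  where \<open>n \<ge> 3\<close> enters.\<close>

lemma theta_product_in:
  assumes f: "f \<in> theta_space 1" and n: "n \<ge> 3" and s: "s = - (of_nat (n - 3) *s c)"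
  shows "(\<lambda>y. f (y - u) * f (y - v) * f (y - (s - u - v)) * f (y - c) ^ (n - 3)) \<in> theta_space n"
  unfolding theta_space_def
proof (intro CollectI conjI allI)
  note h = holomorphic2_minus[OF theta_space_holomorphic[OF f]]
  show "holomorphic2_on (\<lambda>y. f (y - u) * f (y - v) * f (y - (s - u - v)) * f (y - c) ^ (n - 3)) UNIV"
    by (intro holomorphic2_on_mult h holomorphic2_on_power)
  fix m l y
  let ?A = "theta_factor m y" and ?e = "\<lambda>w. exp (2 * pi * \<i> * dotp (Mi m) w)"
  have tr: "f (y + Om m + ivec l - w) = ?A * ?e w * f (y - w)" for w
  proof -
    have "f ((y - w) + Om m + ivec l) = theta_factor m (y - w) ^ 1 * f (y - w)"
      using f unfolding theta_space_def by blast
    then show ?thesis by (simp add: theta_factor_diff algebra_simps)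
  qed
  have "dotp (Mi m) u + dotp (Mi m) v + dotp (Mi m) (s - u - v) + of_nat (n - 3) * dotp (Mi m) c
      = dotp (Mi m) (u + v + (s - u - v) + of_nat (n - 3) *s c)"
    by (simp only: dotp_add dotp_scale)
  also have "\<dots> = 0" by (simp add: s dotp_0)
  finally have z: "dotp (Mi m) u + dotp (Mi m) v + dotp (Mi m) (s - u - v) + of_nat (n - 3) * dotp (Mi m) c = 0" .
  have "?e u * ?e v * ?e (s - u - v) * ?e c ^ (n - 3)
      = exp (2 * pi * \<i> * (dotp (Mi m) u + dotp (Mi m) v + dotp (Mi m) (s - u - v) + of_nat (n - 3) * dotp (Mi m) c))"
    unfolding exp_of_nat_mult[symmetric] exp_add[symmetric] by (simp add: distrib_left mult_ac)
  then have e1: "?e u * ?e v * ?e (s - u - v) * ?e c ^ (n - 3) = 1" unfolding z by simp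
  have A: "?A ^ n = ?A * ?A * ?A * ?A ^ (n - 3)"
  proof -
    have "?A ^ n = ?A ^ (3 + (n - 3))" using n by simp
    then show ?thesis unfolding power_add by (simp add: power3_eq_cube)
  qed
  have "f (y + Om m + ivec l - u) * f (y + Om m + ivec l - v) * f (y + Om m + ivec l - (s - u - v)) *
      f (y + Om m + ivec l - c) ^ (n - 3)
      = (?A * ?A * ?A * ?A ^ (n - 3)) * (?e u * ?e v * ?e (s - u - v) * ?e c ^ (n - 3)) *
        (f (y - u) * f (y - v) * f (y - (s - u - v)) * f (y - c) ^ (n - 3))"
    unfolding tr power_mult_distrib by (simp only: mult_ac)
  then show "f (y + Om m + ivec l - u) * f (y + Om m + ivec l - v) * f (y + Om m + ivec l - (s - u - v)) *
      f (y + Om m + ivec l - c) ^ (n - 3)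
      = ?A ^ n * (f (y - u) * f (y - v) * f (y - (s - u - v)) * f (y - c) ^ (n - 3))"
    unfolding e1 A by simp
qed

lemma theta_space_line_holomorphic:
  "f \<in> theta_space k \<Longrightarrow> line_holomorphic f" "f \<in> theta_space k \<Longrightarrow> line_holomorphic (\<lambda>x. f (y - x))"
  using holomorphic2_imp_line_holomorphic[OF theta_space_holomorphic] line_holomorphic_reflect by blast+

text \<open>A theta function all of whose Fourier coefficients are nonzero.\<close>

definition theta_one :: "complex^2 \<Rightarrow> complex" where "theta_one = Theta 1 (\<lambda>_. 1)"

lemma theta_one_in: "theta_one \<in> theta_space 1"
  unfolding theta_one_def by (rule Theta_in_theta_space[where C = 1]) simp_all

lemma fcoeff2_theta_one: "fcoeff2 p theta_one = gauss 1 p"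
  unfolding theta_one_def using fcoeff2_Theta[of 1 "\<lambda>_. 1" 1 p] by simp

lemma nonzero_of_fcoeff2:
  assumes "fcoeff2 p f \<noteq> 0" shows "\<exists>x. f x \<noteq> 0"
proof (rule ccontr)
  assume "\<nexists>x. f x \<noteq> 0"
  then have "f = (\<lambda>x. 0 * 1)" by auto
  then have "fcoeff2 p f = 0" using fcoeff2_cmult[of p 0 "\<lambda>_. 1"] by simp
  with assms show False by simp
qed

lemma theta_one_nonzero: "\<exists>x. theta_one x \<noteq> 0"
  by (rule nonzero_of_fcoeff2[of "(0,0)"]) (simp add: fcoeff2_theta_one)

lemma theta_space_no_base_point:
  assumes n: "n \<ge> 3"
  shows "\<exists>f\<in>theta_space n. f y \<noteq> 0"
proof -
  obtain x where x: "theta_one x \<noteq> 0" using theta_one_nonzero by blast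
  \<comment> \<open>Two of the translations are \<open>c\<close> as well; only \<open>u\<close> remains to be chosen.\<close>
  define c where "c = y - x"
  define s where "s = - (of_nat (n - 3) *s c)"
  note lh = theta_space_line_holomorphic(2)[OF theta_one_in, of y]
  have c: "theta_one (y - c) \<noteq> 0" using x by (simp add: c_def)
  have "theta_one (y - (s - (s - c - c) - c)) \<noteq> 0" using c by simp
  from line_holomorphic_common_nonzero[OF lh line_holomorphic_reflect2[OF lh] c this]
  obtain u where "theta_one (y - u) \<noteq> 0" "theta_one (y - (s - u - c)) \<noteq> 0" by blast
  with c show ?thesis
    by (intro bexI[OF _ theta_product_in[OF theta_one_in n s_def, of u c]]) simp
qed

text \<open>If the sections of the \<open>n\<close>-th power do not distinguish \<open>y1\<close> from \<open>y2\<close>, the products of translates of a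
  theta function \<open>t\<close> satisfy the hypothesis of \<open>product_rigidity\<close>, so translation by \<open>y1 - y2\<close> multiplies \<open>t\<close> by
  the exponential of a linear form. Comparing the periods of both sides, this linear form is
  integral, and comparing the quasi-periods determines it by \<open>y1 - y2\<close>.\<close>

lemma theta_space_separate_aux:
  assumes n: "n \<ge> 3" and \<gamma>: "\<gamma> \<noteq> 0" and eq: "\<And>f. f \<in> theta_space n \<Longrightarrow> f y1 = \<gamma> * f y2"
    and t: "t \<in> theta_space 1" and nz: "\<exists>x. t x \<noteq> 0"
  shows "\<exists>C Q. C \<noteq> 0 \<and> (\<forall>w. t (w + (y1 - y2)) = C * echar Q w * t w)
    \<and> (\<forall>m. exp (2 * pi * \<i> * (dotp (Mi m) (y1 - y2) + dotp Q (Om m))) = 1)"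
proof -
  define F where "F x = t (y1 - x)" for x
  define G where "G x = t (y2 - x)" for x
  have F: "line_holomorphic F" and G: "line_holomorphic G"
    unfolding F_def G_def by (rule theta_space_line_holomorphic(2)[OF t])+
  obtain x where x: "t x \<noteq> 0" using nz by blast
  have F0: "F (y1 - x) \<noteq> 0" and G0: "G (y2 - x) \<noteq> 0" using x by (simp_all add: F_def G_def)
  from line_holomorphic_common_nonzero[OF F G this]
  obtain c where c: "F c \<noteq> 0" "G c \<noteq> 0" by blast
  define s where "s = - (of_nat (n - 3) *s c)"
  define l where "l = \<gamma> * G c ^ (n - 3) / F c ^ (n - 3)"
  have l: "l \<noteq> 0" using c \<gamma> by (simp add: l_def)
  have FG: "F a * F b * F (s - a - b) = l * (G a * G b * G (s - a - b))" for a b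
  proof -
    have "F a * F b * F (s - a - b) * F c ^ (n - 3) = \<gamma> * (G a * G b * G (s - a - b) * G c ^ (n - 3))"
      unfolding F_def G_def using eq[OF theta_product_in[OF t n s_def, of a b]] .
    then show ?thesis using c by (simp add: l_def field_simps)
  qed
  obtain C d1 d2 where C: "C \<noteq> 0" and Fx: "\<And>x. F x = C * exp (d1 * x$1 + d2 * x$2) * G x"
    using product_rigidity[where s = s, OF F F0 G G0 l FG] by blast
  define u where "u = y1 - y2"
  define C' where "C' = C * exp (d1 * y2$1 + d2 * y2$2)"
  have C': "C' \<noteq> 0" using C by (simp add: C'_def)
  have tw: "t (w + u) = C' * exp (- d1 * w$1 - d2 * w$2) * t w" for w
  proof -
    have "t (w + u) = F (y2 - w)" by (simp add: F_def u_def algebra_simps)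
    also have "\<dots> = C * exp (d1 * (y2 - w)$1 + d2 * (y2 - w)$2) * G (y2 - w)" by (rule Fx)
    also have "exp (d1 * (y2 - w)$1 + d2 * (y2 - w)$2)
        = exp (d1 * y2$1 + d2 * y2$2) * exp (- d1 * w$1 - d2 * w$2)"
      unfolding exp_add[symmetric] by (simp add: algebra_simps)
    finally show ?thesis by (simp add: G_def C'_def mult_ac)
  qed
  have per: "exp (- d1 * of_int (fst k) - d2 * of_int (snd k)) = 1" for k
  proof -
    have "t (x + u) = t ((x + ivec k) + u)"
      using theta_space_ivec[OF t, of "x + u" k] by (simp add: algebra_simps)
    also have "\<dots> = C' * exp (- d1 * (x + ivec k)$1 - d2 * (x + ivec k)$2) * t x"
      unfolding tw theta_space_ivec[OF t] ..
    also have "exp (- d1 * (x + ivec k)$1 - d2 * (x + ivec k)$2)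
        = exp (- d1 * x$1 - d2 * x$2) * exp (- d1 * of_int (fst k) - d2 * of_int (snd k))"
      unfolding exp_add[symmetric] ivec_def by (simp add: algebra_simps)
    finally have fin: "t (x + u) = C' * (exp (- d1 * x$1 - d2 * x$2) * exp (- d1 * of_int (fst k) - d2 * of_int (snd k))) * t x" .
    have "(C' * exp (- d1 * x$1 - d2 * x$2) * t x) * 1 = t (x + u)" by (simp add: tw)
    also note fin
    also have "C' * (exp (- d1 * x$1 - d2 * x$2) * exp (- d1 * of_int (fst k) - d2 * of_int (snd k))) * t x
        = (C' * exp (- d1 * x$1 - d2 * x$2) * t x) * exp (- d1 * of_int (fst k) - d2 * of_int (snd k))"
      by (simp only: mult_ac)
    finally have "(C' * exp (- d1 * x$1 - d2 * x$2) * t x) * 1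
        = (C' * exp (- d1 * x$1 - d2 * x$2) * t x) * exp (- d1 * of_int (fst k) - d2 * of_int (snd k))" .
    then show ?thesis using x C' unfolding mult_cancel_left by simp
  qed
  have int: "\<exists>q::int. - d = 2 * pi * \<i> * of_int q" if "exp (- d) = 1" for d
  proof -
    have "exp (2 * pi * \<i> * (- d / (2 * pi * \<i>))) = 1" using that by simp
    then have "- d / (2 * pi * \<i>) \<in> \<int>" by (simp only: exp_2pi_eq_1_iff)
    then obtain q where "- d / (2 * pi * \<i>) = of_int q" by (rule Ints_cases)
    then have "- d = 2 * pi * \<i> * of_int q" by (simp add: field_simps)
    then show ?thesis by blast
  qed
  obtain q1 q2 :: int where q: "- d1 = 2 * pi * \<i> * of_int q1" "- d2 = 2 * pi * \<i> * of_int q2"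
    using int[of d1] int[of d2] per[of "(1,0)"] per[of "(0,1)"] by auto
  define Q where "Q = (q1, q2)"
  have tQ: "t (w + u) = C' * echar Q w * t w" for w
  proof -
    have "- d1 * w$1 - d2 * w$2 = 2 * pi * \<i> * (of_int q1 * w$1 + of_int q2 * w$2)"
      unfolding diff_conv_add_uminus minus_mult_left q by (simp add: algebra_simps)
    then show ?thesis unfolding tw echar_def Q_def by simp
  qed
  have "exp (2 * pi * \<i> * (dotp (Mi m) u + dotp Q (Om m))) = 1" for m
  proof -
    have "theta_factor m (x + u) * t (x + u) = t ((x + Om m) + u)"
      using theta_space_Om[OF t, of "x + u" m] by (simp add: algebra_simps)
    also have "\<dots> = C' * echar Q (x + Om m) * (theta_factor m x * t x)"
      unfolding tQ using theta_space_Om[OF t, of x m] by simp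
    finally have "theta_factor m x * (C' * echar Q x * t x) * exp (- (2 * pi * \<i> * dotp (Mi m) u))
        = theta_factor m x * (C' * echar Q x * t x) * echar Q (Om m)"
      unfolding tQ theta_factor_add echar_add_vec by (simp only: mult_ac)
    then have e: "exp (- (2 * pi * \<i> * dotp (Mi m) u)) = echar Q (Om m)"
      using x C' by simp
    have "exp (2 * pi * \<i> * (dotp (Mi m) u + dotp Q (Om m))) = exp (2 * pi * \<i> * dotp (Mi m) u) * echar Q (Om m)"
      unfolding echar_dotp exp_add[symmetric] by (simp add: distrib_left)
    also have "\<dots> = 1" unfolding e[symmetric] exp_add[symmetric] by simp
    finally show ?thesis .
  qed
  note Om1 = this
  show ?thesis
  proof (intro exI conjI allI)
    show "C' \<noteq> 0" by (rule C')
    show "t (w + (y1 - y2)) = C' * echar Q w * t w" for w using tQ[of w] by (simp only: u_def)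
    show "exp (2 * pi * \<i> * (dotp (Mi m) (y1 - y2) + dotp Q (Om m))) = 1" for m
      using Om1[of m] by (simp only: u_def)
  qed
qed

text \<open>The imaginary part of \<open>q\<Omega>\<close> vanishes, and that of \<open>\<Omega>\<close> is invertible.\<close>

lemma dotp_Om_real_imp_0:
  assumes "\<And>m. exp (2 * pi * \<i> * dotp q (Om m)) = 1"
  shows "q = (0, 0)"
proof -
  have "Im (dotp q (Om m)) = 0" for m
    using assms[of m] unfolding exp_2pi_eq_1_iff by (auto elim!: Ints_cases)
  from this[of "(1,0)"] this[of "(0,1)"]
  have 1: "of_int (fst q) * Im \<tau> + of_int (snd q) * Im \<zeta> = 0" "of_int (fst q) * Im \<zeta> + of_int (snd q) * Im \<tau> = 0"
    by (simp_all add: dotp_def Om_def)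
  have "(real_of_int (fst q) + of_int (snd q)) * (Im \<tau> + Im \<zeta>) = 0"
    "(real_of_int (fst q) - of_int (snd q)) * (Im \<tau> - Im \<zeta>) = 0"
    using 1 by (simp_all add: algebra_simps)
  moreover have "Im \<tau> + Im \<zeta> \<noteq> 0" "Im \<tau> - Im \<zeta> \<noteq> 0" using im_less by linarith+
  ultimately have "real_of_int (fst q) + of_int (snd q) = 0" "real_of_int (fst q) - of_int (snd q) = 0"
    by simp_all
  then have "real_of_int (fst q) = 0" "real_of_int (snd q) = 0" by linarith+
  then show ?thesis by (simp add: prod_eq_iff)
qed

text \<open>Write \<open>u = y1 - y2\<close>. Translation by \<open>u\<close> shifts the Fourier coefficients of every theta
  function by the same integer vector \<open>Q\<close>. The theta series of the coset \<open>M\<int>\<^sup>2\<close>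
  shows that \<open>Q = mM\<close>, so translation by \<open>u + m\<Omega>\<close> multiplies a theta function by a
  constant; for one with nonzero coefficients this makes all characters equal at
  \<open>u + m\<Omega>\<close>, which is therefore an integer point.\<close>

lemma theta_space_separates_points:
  assumes n: "n \<ge> 3" and \<gamma>: "\<gamma> \<noteq> 0" and eq: "\<And>f. f \<in> theta_space n \<Longrightarrow> f y1 = \<gamma> * f y2"
  shows "\<exists>m l. y1 - y2 = Om m + ivec l"
proof -
  define u where "u = y1 - y2"
  have aux: "\<exists>C Q. C \<noteq> 0 \<and> (\<forall>w. t (w + u) = C * echar Q w * t w)
    \<and> (\<forall>m. exp (2 * pi * \<i> * (dotp (Mi m) u + dotp Q (Om m))) = 1)"
    if "t \<in> theta_space 1" "\<exists>x. t x \<noteq> 0" for t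
    unfolding u_def by (rule theta_space_separate_aux[OF n \<gamma> _ that]) (rule eq)
  define t0 where "t0 = theta_basis 1 (0, 0)"
  have t0: "t0 \<in> theta_space 1" unfolding t0_def by (rule theta_basis_in) simp
  have c0: "fcoeff2 p t0 = coset_ind 1 (0, 0) p * gauss 1 p" for p
    unfolding t0_def by (rule fcoeff2_theta_basis) simp
  have self: "coset_ind 1 (0, 0) (0, 0) = 1"
  proof -
    have "(0, 0) = mshift 1 (0, 0) (0, 0)" by (simp add: mshift_def)
    then have "\<exists>m. (0, 0) = mshift 1 (0, 0) m" by blast
    then show ?thesis unfolding coset_ind_def circ_lattice_iff by simp
  qed
  have "fcoeff2 (0, 0) t0 \<noteq> 0" unfolding c0 self by simp
  then have "\<exists>x. t0 x \<noteq> 0" by (rule nonzero_of_fcoeff2)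
  from aux[OF t0 this]
  obtain C Q where C: "C \<noteq> 0" "\<And>w. t0 (w + u) = C * echar Q w * t0 w"
    and Q: "\<And>m. exp (2 * pi * \<i> * (dotp (Mi m) u + dotp Q (Om m))) = 1" by blast
  have "echar Q u * fcoeff2 Q t0 = fcoeff2 Q (\<lambda>w. t0 (w + u))"
    by (rule fcoeff2_shift[OF theta_space_holomorphic[OF t0] theta_space_biperiodic[OF t0], symmetric])
  also have "\<dots> = C * fcoeff2 (0, 0) t0"
    unfolding C(2) mult.assoc fcoeff2_cmult fcoeff2_mult_echar by simp
  finally have "coset_ind 1 (0, 0) Q \<noteq> 0"
    using C(1) unfolding c0 self by auto
  then obtain m where m: "Q = mshift 1 (0, 0) m"
    unfolding coset_ind_def circ_lattice_iff by (auto split: if_splits)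
  then have Qm: "Q = Mi m" by (simp add: mshift_def)
  from aux[OF theta_one_in theta_one_nonzero]
  obtain C' Q' where C': "C' \<noteq> 0" "\<And>w. theta_one (w + u) = C' * echar Q' w * theta_one w"
    and Q': "\<And>m. exp (2 * pi * \<i> * (dotp (Mi m) u + dotp Q' (Om m))) = 1" by blast
  have "exp (2 * pi * \<i> * dotp (fst Q - fst Q', snd Q - snd Q') (Om m)) = 1" for m
  proof -
    have "exp (2 * pi * \<i> * dotp (fst Q - fst Q', snd Q - snd Q') (Om m))
      = exp (2 * pi * \<i> * (dotp (Mi m) u + dotp Q (Om m))) / exp (2 * pi * \<i> * (dotp (Mi m) u + dotp Q' (Om m)))"
      unfolding exp_diff[symmetric] dotp_diff_index by (simp add: algebra_simps)
    then show ?thesis unfolding Q Q' by simp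
  qed
  from dotp_Om_real_imp_0[OF this] have QQ': "Q' = Q" by (simp add: prod_eq_iff)
  \<comment> \<open>Moving the translation by a quasi-period removes the exponential factor.\<close>
  define K where "K = exp (- (2 * pi * \<i> * dotp (Mi m) u) - pi * \<i> * dotp (Mi m) (Om m)) * C'"
  have shift: "theta_one (w + (u + Om m)) = K * theta_one w" for w
  proof -
    have "theta_one (w + (u + Om m)) = theta_factor m (w + u) * theta_one (w + u)"
      using theta_space_Om[OF theta_one_in, of "w + u" m] by (simp add: add.assoc)
    also have "\<dots> = (theta_factor m (w + u) * echar (Mi m) w) * C' * theta_one w"
      unfolding C'(2) QQ' Qm by (simp only: mult_ac)
    also have "theta_factor m (w + u) * echar (Mi m) w
        = exp (- (2 * pi * \<i> * dotp (Mi m) u) - pi * \<i> * dotp (Mi m) (Om m))"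
      unfolding theta_factor_def echar_dotp exp_add[symmetric] dotp_add
      by (rule arg_cong[where f = exp]) (simp add: algebra_simps)
    finally show ?thesis by (simp add: K_def mult_ac)
  qed
  have K: "echar p (u + Om m) = K" for p
  proof -
    have "echar p (u + Om m) * fcoeff2 p theta_one = fcoeff2 p (\<lambda>w. theta_one (w + (u + Om m)))"
      by (rule fcoeff2_shift[OF theta_space_holomorphic[OF theta_one_in] theta_space_biperiodic[OF theta_one_in], symmetric])
    also have "\<dots> = K * fcoeff2 p theta_one" unfolding shift fcoeff2_cmult ..
    finally show ?thesis unfolding fcoeff2_theta_one by simp
  qed
  have K1: "K = 1" using K[of "(0,0)"] by (simp add: echar_def)
  have "(u + Om m) $ 1 \<in> \<int>" "(u + Om m) $ 2 \<in> \<int>"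
    using K[of "(1,0)"] K[of "(0,1)"]
    unfolding K1 echar_def exp_2pi_eq_1_iff fst_conv snd_conv of_int_1 of_int_0 mult_1 mult_zero_left add_0_left add_0_right by blast+
  then obtain l1 l2 where "(u + Om m) $ 1 = of_int l1" "(u + Om m) $ 2 = of_int l2" by (auto elim!: Ints_cases)
  then have "u + Om m = ivec (l1, l2)" by (simp add: ivec_def vec_eq_iff forall_2)
  then have "u = Om (- fst m, - snd m) + ivec (l1, l2)"
    by (simp add: Om_def vec_eq_iff forall_2 algebra_simps)
  then show ?thesis unfolding u_def by blast
qed

text \<open>The derivative \<open>D\<close> of a theta function in the direction \<open>v\<close> is \<open>g\<close> times the function, with \<open>g\<close> affine
  by \<open>derivation_rigidity\<close>. The periods in \<open>\<int>\<^sup>2\<close> make \<open>g\<close> constant, whereas the quasi-periods add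
  \<open>-2\<pi>i mM\<cdot>v\<close> to it; so \<open>Mv = 0\<close>.\<close>

lemma theta_space_separates_tangents:
  assumes n: "n \<ge> 3"
    and eq: "\<And>f. f \<in> theta_space n \<Longrightarrow> ((\<lambda>t. f (y + t *s v)) has_field_derivative l * f y) (at 0)"
  shows "v = 0"
proof -
  have rap: "rapid (\<lambda>p. 1 * gauss 1 p)" by (rule rapid_gauss[where C = 1]) simp_all
  let ?c = "\<lambda>p. 1 * gauss 1 p"
  define D where "D x = v $ 1 * expser (\<lambda>p. 2 * pi * \<i> * of_int (fst p) * ?c p) x
      + v $ 2 * expser (\<lambda>p. 2 * pi * \<i> * of_int (snd p) * ?c p) x" for x
  have Dder: "((\<lambda>t. theta_one (x + t *s v)) has_field_derivative D x) (at 0)" for x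
  proof -
    have "(theta_one has_derivative (\<lambda>v. v $ 1 * expser (\<lambda>p. 2 * pi * \<i> * of_int (fst p) * ?c p) x
      + v $ 2 * expser (\<lambda>p. 2 * pi * \<i> * of_int (snd p) * ?c p) x)) (at (x + 0 *s v))"
      unfolding theta_one_def Theta_def using expser_has_derivative[OF rap, of x] by simp
    from holomorphic2_along_line[OF this] show ?thesis
      unfolding D_def by (simp add: algebra_simps)
  qed
  have "holomorphic2_on D UNIV" unfolding D_def
    by (intro holomorphic2_on_add holomorphic2_on_mult holomorphic2_on_const
        holomorphic2_expser[OF rapid_index(1)[OF rap]] holomorphic2_expser[OF rapid_index(2)[OF rap]])
  then have D: "line_holomorphic D" by (rule holomorphic2_imp_line_holomorphic)
  obtain x where x: "theta_one x \<noteq> 0" using theta_one_nonzero by blast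
  define F where "F a = theta_one (y - a)" for a
  have F: "line_holomorphic F" unfolding F_def by (rule theta_space_line_holomorphic(2)[OF theta_one_in])
  have D': "line_holomorphic (\<lambda>a. D (y - a))" by (rule line_holomorphic_reflect[OF D])
  define c where "c = y - x"
  have c: "F c \<noteq> 0" using x by (simp add: F_def c_def)
  define s where "s = - (of_nat (n - 3) *s c)"
  \<comment> \<open>For \<open>n = 3\<close> the exponent is truncated, but then the factor \<open>n - 3\<close> is zero.\<close>
  define K' where "K' = of_nat (n - 3) * (F c ^ (n - 3 - 1) * D (y - c))"
  have Fd: "((\<lambda>t. theta_one (y + t *s v - a)) has_field_derivative D (y - a)) (at 0)" for a
    using Dder[of "y - a"] by (simp add: algebra_simps)
  have Kd: "((\<lambda>t. theta_one (y + t *s v - c) ^ (n - 3)) has_field_derivative K') (at 0)"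
    using DERIV_power[OF Fd[of c], of "n - 3"] by (simp add: K'_def F_def mult_ac)
  define l' where "l' = l - K' / F c ^ (n - 3)"
  have rel: "D (y - a) * F b * F (s - a - b) + F a * D (y - b) * F (s - a - b) + F a * F b * D (y - (s - a - b))
      = l' * (F a * F b * F (s - a - b))" for a b
  proof -
    have "((\<lambda>t. theta_one (y + t *s v - a) * theta_one (y + t *s v - b) * theta_one (y + t *s v - (s - a - b))
          * theta_one (y + t *s v - c) ^ (n - 3)) has_field_derivative
        ((D (y - a) * F b + D (y - b) * F a) * F (s - a - b) + D (y - (s - a - b)) * (F a * F b)) * F c ^ (n - 3)
          + K' * (F a * F b * F (s - a - b))) (at 0)"
      using DERIV_mult[OF DERIV_mult[OF DERIV_mult[OF Fd[of a] Fd[of b]] Fd[of "s - a - b"]] Kd]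
      by (simp add: F_def)
    moreover have "((\<lambda>t. theta_one (y + t *s v - a) * theta_one (y + t *s v - b) * theta_one (y + t *s v - (s - a - b))
          * theta_one (y + t *s v - c) ^ (n - 3)) has_field_derivative l * (F a * F b * F (s - a - b) * F c ^ (n - 3))) (at 0)"
      unfolding F_def using eq[OF theta_product_in[OF theta_one_in n s_def, of a b]] .
    ultimately have "((D (y - a) * F b + D (y - b) * F a) * F (s - a - b) + D (y - (s - a - b)) * (F a * F b)) * F c ^ (n - 3)
          + K' * (F a * F b * F (s - a - b)) = l * (F a * F b * F (s - a - b) * F c ^ (n - 3))"
      by (rule DERIV_unique)
    then have "((D (y - a) * F b + D (y - b) * F a) * F (s - a - b) + D (y - (s - a - b)) * (F a * F b)) * F c ^ (n - 3)
        = (l' * (F a * F b * F (s - a - b))) * F c ^ (n - 3)"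
      using c by (simp add: l'_def algebra_simps)
    then have "(D (y - a) * F b + D (y - b) * F a) * F (s - a - b) + D (y - (s - a - b)) * (F a * F b)
        = l' * (F a * F b * F (s - a - b))" using c by simp
    then show ?thesis by (simp add: algebra_simps)
  qed
  obtain c0 d1 d2 where DF: "\<And>a. D (y - a) = (c0 + d1 * a$1 + d2 * a$2) * F a"
    using derivation_rigidity[where s = s and l = l', OF F c D' rel] by blast
  define g where "g w = c0 + d1 * (y$1 - w$1) + d2 * (y$2 - w$2)" for w :: "complex^2"
  have Dg: "D w = g w * theta_one w" for w using DF[of "y - w"] by (simp add: F_def g_def)
  have Dper: "D (w + ivec k) = D w" for w k
  proof (rule DERIV_unique[OF Dder])
    have "theta_one (w + ivec k + t *s v) = theta_one (w + t *s v)" for t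
      using theta_space_ivec[OF theta_one_in, of "w + t *s v" k] by (simp add: algebra_simps)
    then show "((\<lambda>t. theta_one (w + ivec k + t *s v)) has_field_derivative D w) (at 0)"
      using Dder[of w] by simp
  qed
  have gper: "g (x + ivec k) = g x" for k
    using Dper[of x k] x unfolding Dg theta_space_ivec[OF theta_one_in] by simp
  have d0: "d1 = 0" "d2 = 0"
    using gper[of "(1,0)"] gper[of "(0,1)"] by (simp_all add: g_def ivec_def algebra_simps)
  have Dc: "D w = c0 * theta_one w" for w using Dg[of w] by (simp add: g_def d0)
  have M0: "dotp (Mi m) v = 0" for m
  proof -
    have "((\<lambda>t. theta_factor m (x + t *s v)) has_field_derivative theta_factor m x * (- (2 * pi * \<i> * dotp (Mi m) v))) (at 0)"
      unfolding theta_factor_add dotp_scale by (auto intro!: derivative_eq_intros)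
    from DERIV_mult[OF this Dder[of x]]
    have "((\<lambda>t. theta_factor m (x + t *s v) * theta_one (x + t *s v)) has_field_derivative
        theta_factor m x * (- (2 * pi * \<i> * dotp (Mi m) v)) * theta_one x + D x * theta_factor m x) (at 0)"
      by simp
    moreover have "theta_factor m (x + t *s v) * theta_one (x + t *s v) = theta_one (x + Om m + t *s v)" for t
      using theta_space_Om[OF theta_one_in, of "x + t *s v" m] by (simp add: algebra_simps)
    ultimately have "((\<lambda>t. theta_one (x + Om m + t *s v)) has_field_derivative
        theta_factor m x * (- (2 * pi * \<i> * dotp (Mi m) v)) * theta_one x + D x * theta_factor m x) (at 0)"
      by simp
    from DERIV_unique[OF Dder this]
    have "theta_factor m x * (- (2 * pi * \<i> * dotp (Mi m) v)) * theta_one x = 0"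
      unfolding Dc using theta_space_Om[OF theta_one_in, of x m] by (simp add: mult_ac)
    then show ?thesis using x by simp
  qed
  have e: "of_int a * v$1 + of_int b * v$2 = 0" "of_int b * v$1 + of_int a * v$2 = 0"
    using M0[of "(1,0)"] M0[of "(0,1)"] by (simp_all add: dotp_def Mi_def)
  have "((of_int a)\<^sup>2 - (of_int b)\<^sup>2) * v$1 = of_int a * (of_int a * v$1 + of_int b * v$2) - of_int b * (of_int b * v$1 + of_int a * v$2)"
    "((of_int a)\<^sup>2 - (of_int b)\<^sup>2) * v$2 = of_int a * (of_int b * v$1 + of_int a * v$2) - of_int b * (of_int a * v$1 + of_int b * v$2)"
    by (simp_all add: power2_eq_square algebra_simps)
  then have "v$1 = 0" "v$2 = 0" unfolding e using disc_ne0 by simp_all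
  then show ?thesis by (simp add: vec_eq_iff forall_2)
qed

end

section \<open>Maps from a torus to projective space\<close>

lemma topspace_quotient_top [simp]: "topspace (quotient_top X q) = q ` topspace X"
proof
  have "openin (quotient_top X q) (topspace (quotient_top X q))" by simp
  then show "topspace (quotient_top X q) \<subseteq> q ` topspace X" unfolding openin_quotient_top by blast
  have "{x \<in> topspace X. q x \<in> q ` topspace X} = topspace X" by blast
  then have "openin (quotient_top X q) (q ` topspace X)" unfolding openin_quotient_top by simp
  then show "q ` topspace X \<subseteq> topspace (quotient_top X q)" by (rule openin_subset)
qed

lemma continuous_map_quotient_proj: "continuous_map X (quotient_top X q) q"
  unfolding continuous_map_def by (auto simp: openin_quotient_top)

lemma continuous_map_quotient_lift:
  assumes "continuous_map X Y (\<lambda>x. f (q x))"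
  shows "continuous_map (quotient_top X q) Y f"
  unfolding continuous_map_def
proof (intro conjI allI impI)
  show "f \<in> topspace (quotient_top X q) \<rightarrow> topspace Y"
    using assms by (auto simp: continuous_map_def)
  fix U assume "openin Y U"
  then have "openin X {x \<in> topspace X. f (q x) \<in> U}"
    using assms by (auto simp: continuous_map_def)
  moreover have "{x \<in> topspace X. q x \<in> {y \<in> topspace (quotient_top X q). f y \<in> U}}
      = {x \<in> topspace X. f (q x) \<in> U}" by auto
  ultimately show "openin (quotient_top X q) {y \<in> topspace (quotient_top X q). f y \<in> U}"
    unfolding openin_quotient_top by auto
qed

lemma proj_point_scale:
  assumes "c \<noteq> 0" shows "proj_point (\<lambda>i. c * x i) = proj_point x"
proof -
  have "\<exists>e. (\<lambda>i. d * (c * x i)) = (\<lambda>i. e * x i) \<and> e \<noteq> 0" if "d \<noteq> 0" for d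
    by (rule exI[of _ "d * c"]) (use that assms in \<open>simp add: mult.assoc\<close>)
  moreover have "\<exists>e. (\<lambda>i. d * x i) = (\<lambda>i. e * (c * x i)) \<and> e \<noteq> 0" if "d \<noteq> 0" for d
    by (rule exI[of _ "d / c"]) (use that assms in simp)
  ultimately show ?thesis unfolding proj_point_def by blast
qed

lemma self_in_proj_point: "x \<in> proj_point x"
  unfolding proj_point_def by (intro CollectI exI[of _ 1]) simp

lemma proj_point_eqD:
  assumes "proj_point x = proj_point y"
  shows "\<exists>c. c \<noteq> 0 \<and> (\<forall>i. x i = c * y i)"
proof -
  have "x \<in> proj_point y" using self_in_proj_point[of x] assms by simp
  then show ?thesis unfolding proj_point_def by auto
qed

text \<open>Functions separating the points of projective space: the matrix entries of the orthogonal
  projection to the line spanned by \<open>x\<close>.\<close>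

definition proj_entry :: "nat \<Rightarrow> nat \<Rightarrow> nat \<Rightarrow> (nat \<Rightarrow> complex) \<Rightarrow> complex" where
  "proj_entry N i j x = x i * cnj (x j) / (\<Sum>k\<le>N. x k * cnj (x k))"

lemma sum_norm_nonzero:
  assumes "x \<in> hom_coords N" shows "(\<Sum>k\<le>N. x k * cnj (x k)) \<noteq> 0"
proof -
  obtain i where i: "i \<le> N" "x i \<noteq> 0" using assms by (auto simp: hom_coords_def)
  have "(\<Sum>k\<le>N. x k * cnj (x k)) = of_real (\<Sum>k\<le>N. (cmod (x k))\<^sup>2)"
    by (simp only: complex_norm_square of_real_sum)
  moreover have "(\<Sum>k\<le>N. (cmod (x k))\<^sup>2) > 0"
    by (rule sum_pos2[of _ i]) (use i in auto)
  ultimately show ?thesis by (simp only: of_real_eq_0_iff)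
qed

lemma proj_entry_scale:
  assumes "c \<noteq> 0" shows "proj_entry N i j (\<lambda>k. c * x k) = proj_entry N i j x"
proof -
  have e: "(\<Sum>k\<le>N. c * x k * cnj (c * x k)) = (c * cnj c) * (\<Sum>k\<le>N. x k * cnj (x k))"
    "c * x i * cnj (c * x j) = (c * cnj c) * (x i * cnj (x j))"
    by (simp_all add: sum_distrib_left mult_ac)
  have "c * cnj c \<noteq> 0" using assms by simp
  then show ?thesis unfolding proj_entry_def e by (rule mult_divide_mult_cancel_left)
qed

lemma continuous_proj_entry: "continuous_on (hom_coords N) (proj_entry N i j)"
proof -
  have c: "continuous_on S (\<lambda>x::nat \<Rightarrow> complex. x k)" for S k
    by (rule continuous_on_subset[OF continuous_on_product_coordinates]) simp
  show ?thesis
    unfolding proj_entry_def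
    by (intro continuous_on_divide continuous_on_mult continuous_on_cnj continuous_on_sum c ballI sum_norm_nonzero)
qed

lemma proj_entry_separates:
  assumes x: "x \<in> hom_coords N" and y: "y \<in> hom_coords N"
    and eq: "\<And>i j. i \<le> N \<Longrightarrow> j \<le> N \<Longrightarrow> proj_entry N i j x = proj_entry N i j y"
  shows "proj_point x = proj_point y"
proof -
  let ?X = "\<Sum>k\<le>N. x k * cnj (x k)" and ?Y = "\<Sum>k\<le>N. y k * cnj (y k)"
  have X: "?X \<noteq> 0" and Y: "?Y \<noteq> 0" using sum_norm_nonzero x y by blast+
  obtain j where j: "j \<le> N" "y j \<noteq> 0" using y by (auto simp: hom_coords_def)
  have "y j * cnj (y j) / ?Y \<noteq> 0" using j Y by simp
  then have "x j * cnj (x j) / ?X \<noteq> 0" using eq[OF j(1) j(1)] by (simp add: proj_entry_def)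
  then have xj: "x j \<noteq> 0" by auto
  define c where "c = cnj (y j) / ?Y * (?X / cnj (x j))"
  have c: "c \<noteq> 0" using xj j X Y by (simp add: c_def)
  have "x i = c * y i" for i
  proof (cases "i \<le> N")
    case True
    have "x i = x i * cnj (x j) / ?X * (?X / cnj (x j))" using xj X by simp
    also have "x i * cnj (x j) / ?X = y i * cnj (y j) / ?Y"
      using eq[OF True j(1)] by (simp add: proj_entry_def)
    finally show ?thesis by (simp add: c_def)
  next
    case False
    then show ?thesis using x y by (simp add: hom_coords_def)
  qed
  then have "x = (\<lambda>i. c * y i)" by (rule ext)
  then show ?thesis using proj_point_scale[OF c, of y] by simp
qed

lemma topspace_proj_space: "topspace (proj_space N) = proj_point ` hom_coords N"
  by (simp add: proj_space_def)

text \<open>The functions \<open>proj_entry N i j\<close> are continuous on the quotient and separate its points.\<close>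

lemma Hausdorff_proj_space: "Hausdorff_space (proj_space N)"
  unfolding Hausdorff_space_def
proof (intro allI impI)
  fix p q assume pq: "p \<in> topspace (proj_space N) \<and> q \<in> topspace (proj_space N) \<and> p \<noteq> q"
  then obtain x y where x: "x \<in> hom_coords N" "p = proj_point x" and y: "y \<in> hom_coords N" "q = proj_point y"
    unfolding topspace_proj_space by blast
  have "\<exists>i j. proj_entry N i j x \<noteq> proj_entry N i j y"
    using proj_entry_separates[OF x(1) y(1)] pq x(2) y(2) by blast
  then obtain i j where ij: "proj_entry N i j x \<noteq> proj_entry N i j y" by blast
  define \<phi> where "\<phi> P = proj_entry N i j (SOME x. x \<in> P)" for P
  have \<phi>: "\<phi> (proj_point x) = proj_entry N i j x" for x
  proof -
    have "(SOME u. u \<in> proj_point x) \<in> proj_point x"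
      using someI[of "\<lambda>u. u \<in> proj_point x" x] self_in_proj_point by blast
    then obtain c where c: "c \<noteq> 0" "(SOME u. u \<in> proj_point x) = (\<lambda>i. c * x i)"
      unfolding proj_point_def by blast
    show ?thesis unfolding \<phi>_def c(2) by (rule proj_entry_scale[OF c(1)])
  qed
  have "continuous_map (top_of_set (hom_coords N)) euclidean (\<lambda>x. \<phi> (proj_point x))"
    unfolding \<phi> using continuous_proj_entry by simp
  then have cont: "continuous_map (proj_space N) euclidean \<phi>"
    unfolding proj_space_def by (rule continuous_map_quotient_lift)
  obtain U V where UV: "open U" "open V" "\<phi> p \<in> U" "\<phi> q \<in> V" "U \<inter> V = {}"
    using separation_t2[of "\<phi> p" "\<phi> q"] ij unfolding x(2) y(2) \<phi> by blast
  let ?P = "\<lambda>W. {u \<in> topspace (proj_space N). \<phi> u \<in> W}"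
  have "openin (proj_space N) (?P U)" "openin (proj_space N) (?P V)"
    using openin_continuous_map_preimage[OF cont] UV(1,2) by (simp_all add: open_openin[symmetric])
  moreover have "p \<in> ?P U" "q \<in> ?P V" "disjnt (?P U) (?P V)"
    using pq UV by (auto simp: disjnt_def)
  ultimately show "\<exists>U V. openin (proj_space N) U \<and> openin (proj_space N) V \<and> p \<in> U \<and> q \<in> V \<and> disjnt U V"
    by blast
qed

lemma holomorphic2_on_transform_open:
  assumes "holomorphic2_on g S" "open S" "\<And>x. x \<in> S \<Longrightarrow> g x = f x"
  shows "holomorphic2_on f S"
  unfolding holomorphic2_on_def
proof
  fix x assume x: "x \<in> S"
  then obtain D where D: "(g has_derivative D) (at x)" "\<forall>c v. D (c *s v) = c * D v"
    using assms(1) unfolding holomorphic2_on_def by blast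
  have "(f has_derivative D) (at x)"
    by (rule has_derivative_transform_within_open[OF D(1) assms(2) x]) (rule assms(3))
  then show "\<exists>D. (f has_derivative D) (at x) \<and> (\<forall>c v. D (c *s v) = c * D v)"
    using D(2) by blast
qed

lemma torus_point_eq_iff:
  assumes 0: "0 \<in> L" and add: "\<And>\<alpha> \<beta>. \<alpha> \<in> L \<Longrightarrow> \<beta> \<in> L \<Longrightarrow> \<alpha> + \<beta> \<in> L" and neg: "\<And>\<alpha>. \<alpha> \<in> L \<Longrightarrow> - \<alpha> \<in> L"
  shows "torus_point L z = torus_point L w \<longleftrightarrow> z - w \<in> L"
proof
  assume "torus_point L z = torus_point L w"
  moreover have "z + 0 \<in> torus_point L z" using 0 unfolding torus_point_def by blast
  ultimately obtain \<alpha> where "\<alpha> \<in> L" "z + 0 = w + \<alpha>" unfolding torus_point_def by blast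
  then show "z - w \<in> L" by (simp add: algebra_simps)
next
  assume L: "z - w \<in> L"
  have "z + \<alpha> \<in> torus_point L w" if "\<alpha> \<in> L" for \<alpha>
  proof -
    have "z + \<alpha> = w + ((z - w) + \<alpha>)" by simp
    then show ?thesis using add[OF L that] unfolding torus_point_def by blast
  qed
  moreover have "w + \<alpha> \<in> torus_point L z" if "\<alpha> \<in> L" for \<alpha>
  proof -
    have "w + \<alpha> = z + (- (z - w) + \<alpha>)" by simp
    then show ?thesis using add[OF neg[OF L] that] unfolding torus_point_def by blast
  qed
  ultimately show "torus_point L z = torus_point L w" unfolding torus_point_def by blast
qed

lemma compact_space_torus:
  assumes L: "0 \<in> L" "\<And>\<alpha> \<beta>. \<alpha> \<in> L \<Longrightarrow> \<beta> \<in> L \<Longrightarrow> \<alpha> + \<beta> \<in> L" "\<And>\<alpha>. \<alpha> \<in> L \<Longrightarrow> - \<alpha> \<in> L"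
    and cov: "\<And>x. \<exists>\<alpha>\<in>L. norm (x + \<alpha>) \<le> R"
  shows "compact_space (torus L)"
proof -
  have "range (torus_point L) = torus_point L ` cball 0 R"
  proof -
    have "torus_point L x \<in> torus_point L ` cball 0 R" for x
    proof -
      obtain \<alpha> where \<alpha>: "\<alpha> \<in> L" "norm (x + \<alpha>) \<le> R" using cov by blast
      have "x - (x + \<alpha>) \<in> L" using L(3)[OF \<alpha>(1)] by simp
      then have "torus_point L x = torus_point L (x + \<alpha>)" using torus_point_eq_iff[OF L] by blast
      then show ?thesis using \<alpha>(2) by auto
    qed
    then show ?thesis by blast
  qed
  moreover have "compactin (torus L) (torus_point L ` cball 0 R)"
    unfolding torus_def by (rule image_compactin[OF _ continuous_map_quotient_proj]) simp
  ultimately show ?thesis unfolding compact_space_def torus_def by simp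
qed

lemma affine_coord_proj_point:
  assumes "x i \<noteq> 0" shows "affine_coord i j (proj_point x) = x j / x i"
  unfolding affine_coord_def
proof (rule the_equality)
  show "\<forall>u\<in>proj_point x. u j / u i = x j / x i" using assms by (auto simp: proj_point_def)
  fix c assume "\<forall>u\<in>proj_point x. u j / u i = c"
  from bspec[OF this self_in_proj_point] show "c = x j / x i" by simp
qed

lemma affine_patch_iff:
  assumes "x \<in> hom_coords N"
  shows "proj_point x \<in> affine_patch N i \<longleftrightarrow> x i \<noteq> 0"
proof
  assume "proj_point x \<in> affine_patch N i"
  then obtain y where y: "y i \<noteq> 0" "proj_point x = proj_point y" unfolding affine_patch_def by blast
  from proj_point_eqD[OF y(2)] show "x i \<noteq> 0" using y(1) by auto
next
  assume "x i \<noteq> 0" then show "proj_point x \<in> affine_patch N i" using assms unfolding affine_patch_def by blast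
qed

text \<open>A continuous injective map from a compact space to a Hausdorff space is a closed embedding. For the
  immersion property, note that \<open>\<theta>\<^sub>j = (\<theta>\<^sub>j / \<theta>\<^sub>i) \<theta>\<^sub>i\<close>: if all the affine coordinates \<open>\<theta>\<^sub>j / \<theta>\<^sub>i\<close> have
  derivative zero along \<open>v\<close>, then all \<open>\<theta>\<^sub>j\<close> have the same logarithmic derivative along \<open>v\<close>.\<close>

lemma closed_embedding_criterion:
  fixes \<theta> :: "nat \<Rightarrow> complex^2 \<Rightarrow> complex"
  assumes L: "0 \<in> L" "\<And>\<alpha> \<beta>. \<alpha> \<in> L \<Longrightarrow> \<beta> \<in> L \<Longrightarrow> \<alpha> + \<beta> \<in> L" "\<And>\<alpha>. \<alpha> \<in> L \<Longrightarrow> - \<alpha> \<in> L"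
    and cov: "\<And>x. \<exists>\<alpha>\<in>L. norm (x + \<alpha>) \<le> R"
    and hol: "\<And>k. k \<le> N \<Longrightarrow> holomorphic2_on (\<theta> k) UNIV"
    and nz: "\<And>z. \<exists>k\<le>N. \<theta> k z \<noteq> 0"
    and aut: "\<And>\<alpha> z. \<alpha> \<in> L \<Longrightarrow> \<exists>c. c \<noteq> 0 \<and> (\<forall>k\<le>N. \<theta> k (z + \<alpha>) = c * \<theta> k z)"
    and sep: "\<And>z w c. c \<noteq> 0 \<Longrightarrow> (\<forall>k\<le>N. \<theta> k z = c * \<theta> k w) \<Longrightarrow> z - w \<in> L"
    and tan: "\<And>z v l. (\<forall>k\<le>N. ((\<lambda>t. \<theta> k (z + t *s v)) has_field_derivative l * \<theta> k z) (at 0)) \<Longrightarrow> v = 0"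
  shows "\<exists>f. (\<forall>z. f (torus_point L z) = proj_point (\<lambda>k. if k \<le> N then \<theta> k z else 0)) \<and> closed_embedding L N f"
proof -
  define Th where "Th z = (\<lambda>k. if k \<le> N then \<theta> k z else 0)" for z
  have Th_hom: "Th z \<in> hom_coords N" for z
    using nz[of z] unfolding hom_coords_def Th_def by auto
  define f where "f P = proj_point (Th (SOME z. torus_point L z = P))" for P
  note tp = torus_point_eq_iff[OF L]
  have f: "f (torus_point L z) = proj_point (Th z)" for z
  proof -
    define w where "w = (SOME w. torus_point L w = torus_point L z)"
    have "torus_point L w = torus_point L z" unfolding w_def by (rule someI) (rule refl)
    then have "w - z \<in> L" using tp by blast
    from aut[OF this, of z] obtain c where c: "c \<noteq> 0" "\<forall>k\<le>N. \<theta> k w = c * \<theta> k z" by auto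
    then have "Th w = (\<lambda>k. c * Th z k)" by (auto simp: Th_def fun_eq_iff)
    then show ?thesis unfolding f_def w_def[symmetric] using proj_point_scale[OF c(1), of "Th z"] by simp
  qed
  have Th_cont: "continuous_on UNIV Th"
  proof (rule continuous_on_coordinatewise_then_product)
    fix i
    show "continuous_on UNIV (\<lambda>z. Th z i)"
      unfolding Th_def using holomorphic2_on_imp_continuous_on[OF hol] by (cases "i \<le> N") simp_all
  qed
  have f_cont: "continuous_map (torus L) (proj_space N) f"
  proof -
    have "continuous_map euclidean (top_of_set (hom_coords N)) Th"
      using Th_cont Th_hom by (auto simp: continuous_map_in_subtopology)
    then have "continuous_map euclidean (proj_space N) (proj_point \<circ> Th)"
      unfolding proj_space_def by (rule continuous_map_compose[OF _ continuous_map_quotient_proj])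
    then have "continuous_map euclidean (proj_space N) (\<lambda>z. f (torus_point L z))"
      by (simp add: f o_def)
    then show ?thesis unfolding torus_def by (rule continuous_map_quotient_lift)
  qed
  have f_inj: "inj_on f (topspace (torus L))"
  proof (rule inj_onI)
    fix P Q assume "P \<in> topspace (torus L)" "Q \<in> topspace (torus L)" and eq: "f P = f Q"
    then obtain z w where P: "P = torus_point L z" and Q: "Q = torus_point L w" by (auto simp: torus_def)
    from eq have "proj_point (Th z) = proj_point (Th w)" unfolding P Q f .
    from proj_point_eqD[OF this] obtain c where c: "c \<noteq> 0" "\<forall>i. Th z i = c * Th w i" by blast
    have "\<theta> k z = c * \<theta> k w" if "k \<le> N" for k
      using c(2)[rule_format, of k] that by (simp add: Th_def)
    then have "\<forall>k\<le>N. \<theta> k z = c * \<theta> k w" by blast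
    from sep[OF c(1) this] show "P = Q" by (simp only: P Q tp)
  qed
  have f_closed: "closed_map (torus L) (proj_space N) f"
    by (rule T1_Spaces.continuous_imp_closed_map[OF f_cont compact_space_torus[OF L cov] Hausdorff_proj_space])
  have patch: "f (torus_point L z) \<in> affine_patch N i \<longleftrightarrow> \<theta> i z \<noteq> 0" if "i \<le> N" for i z
    unfolding f affine_patch_iff[OF Th_hom] using that by (simp add: Th_def)
  have lift: "lift_coord L f i j z = \<theta> j z / \<theta> i z" if "i \<le> N" "j \<le> N" "\<theta> i z \<noteq> 0" for i j z
    using affine_coord_proj_point[of "Th z" i j] that unfolding lift_coord_def f by (simp add: Th_def)
  have opn: "open {z. \<theta> i z \<noteq> 0}" if "i \<le> N" for i
    by (rule open_Collect_neq) (use holomorphic2_on_imp_continuous_on[OF hol[OF that]] in auto)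
  have lift_hol: "holomorphic2_on (lift_coord L f i j) {z. \<theta> i z \<noteq> 0}" if ij: "i \<le> N" "j \<le> N" for i j
  proof (rule holomorphic2_on_transform_open[OF _ opn[OF ij(1)]])
    show "holomorphic2_on (\<lambda>z. \<theta> j z / \<theta> i z) {z. \<theta> i z \<noteq> 0}"
      by (rule holomorphic2_on_divide[OF holomorphic2_on_subset[OF hol[OF ij(2)]] holomorphic2_on_subset[OF hol[OF ij(1)]]])
         simp_all
    show "\<theta> j z / \<theta> i z = lift_coord L f i j z" if "z \<in> {z. \<theta> i z \<noteq> 0}" for z
      using lift[OF ij] that by simp
  qed
  have "holomorphic_map L N f"
    unfolding holomorphic_map_def using f_cont lift_hol patch by simp
  moreover have "immersive L N f"
    unfolding immersive_def
  proof (intro allI impI)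
    fix z i v
    assume i: "i \<le> N" and "f (torus_point L z) \<in> affine_patch N i"
      and v: "\<forall>j\<le>N. frechet_derivative (lift_coord L f i j) (at z) v = 0"
    then have iz: "\<theta> i z \<noteq> 0" using patch by blast
    obtain Di where Di: "(\<theta> i has_derivative Di) (at z)" "\<And>c v. Di (c *s v) = c * Di v"
      using hol[OF i] unfolding holomorphic2_on_def by blast
    have "((\<lambda>t. \<theta> j (z + t *s v)) has_field_derivative (Di v / \<theta> i z) * \<theta> j z) (at 0)" if j: "j \<le> N" for j
    proof -
      obtain Dj where Dj: "(\<theta> j has_derivative Dj) (at z)" "\<And>c v. Dj (c *s v) = c * Dj v"
        using hol[OF j] unfolding holomorphic2_on_def by blast
      obtain E where E: "(lift_coord L f i j has_derivative E) (at z)"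
        using lift_hol[OF i j] iz unfolding holomorphic2_on_def by blast
      have Ev: "E v = 0" using frechet_derivative_at[OF E] v j by simp
      have "((\<lambda>w. lift_coord L f i j w * \<theta> i w) has_derivative (\<lambda>h. lift_coord L f i j z * Di h + E h * \<theta> i z)) (at z)"
        by (rule has_derivative_mult[OF E Di(1)])
      then have "(\<theta> j has_derivative (\<lambda>h. lift_coord L f i j z * Di h + E h * \<theta> i z)) (at z)"
        by (rule has_derivative_transform_within_open[OF _ opn[OF i]]) (use iz lift[OF i j] in auto)
      from has_derivative_unique[OF Dj(1) this]
      have "Dj v = lift_coord L f i j z * Di v + E v * \<theta> i z" by (rule fun_cong)
      then have Djv: "Dj v = (Di v / \<theta> i z) * \<theta> j z" using lift[OF i j iz] Ev by simp
      have "(\<theta> j has_derivative Dj) (at (z + 0 *s v))" using Dj(1) by simp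
      from holomorphic2_along_line[OF this Dj(2)] show ?thesis unfolding Djv .
    qed
    then show "v = 0" using tan by blast
  qed
  moreover have "embedding_map (torus L) (proj_space N) f"
    by (rule injective_closed_imp_embedding_map[OF f_cont f_closed f_inj])
  moreover have "closedin (proj_space N) (f ` topspace (torus L))"
    using f_closed unfolding closed_map_def by simp
  ultimately have "closed_embedding L N f" unfolding closed_embedding_def by blast
  then show ?thesis using f unfolding Th_def by blast
qed

section \<open>Determinants of alternating forms on a lattice\<close>

lemma det_4:
  "det (A::'a::comm_ring_1^4^4) =
    A$1$1 * (A$2$2 * (A$3$3 * A$4$4 - A$3$4 * A$4$3) - A$2$3 * (A$3$2 * A$4$4 - A$3$4 * A$4$2) + A$2$4 * (A$3$2 * A$4$3 - A$3$3 * A$4$2))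
  - A$1$2 * (A$2$1 * (A$3$3 * A$4$4 - A$3$4 * A$4$3) - A$2$3 * (A$3$1 * A$4$4 - A$3$4 * A$4$1) + A$2$4 * (A$3$1 * A$4$3 - A$3$3 * A$4$1))
  + A$1$3 * (A$2$1 * (A$3$2 * A$4$4 - A$3$4 * A$4$2) - A$2$2 * (A$3$1 * A$4$4 - A$3$4 * A$4$1) + A$2$4 * (A$3$1 * A$4$2 - A$3$2 * A$4$1))
  - A$1$4 * (A$2$1 * (A$3$2 * A$4$3 - A$3$3 * A$4$2) - A$2$2 * (A$3$1 * A$4$3 - A$3$3 * A$4$1) + A$2$3 * (A$3$1 * A$4$2 - A$3$2 * A$4$1))"
proof -
  have f1: "finite {2::4, 3, 4}" "1 \<notin> {2::4, 3, 4}" by auto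
  have f2: "finite {3::4, 4}" "2 \<notin> {3::4, 4}" by auto
  have f3: "finite {4::4}" "3 \<notin> {4::4}" by auto
  show ?thesis
    unfolding det_def UNIV_4
    unfolding sum_over_permutations_insert[OF f1]
    unfolding sum_over_permutations_insert[OF f2]
    unfolding sum_over_permutations_insert[OF f3]
    unfolding permutes_sing
    by (simp add: sign_swap_id permutation_swap_id permutation_compose sign_compose sign_id swap_id_eq algebra_simps)
qed

lemma det_of_int_Ints: "det (\<chi> i j. real_of_int (P $ i $ j) :: real^'n^'n) \<in> \<int>"
  unfolding det_def by (auto intro!: Ints_sum Ints_mult Ints_prod simp: sign_def)

lemma E_star_add: "E_star (x + y) w = E_star x w + E_star y w" "E_star w (x + y) = E_star w x + E_star w y"
  by (simp_all add: E_star_def H_star_def algebra_simps)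

lemma E_star_scale: "E_star (of_int c *s x) w = of_int c * E_star x w" "E_star w (of_int c *s x) = of_int c * E_star w x"
  by (simp_all add: E_star_def H_star_def algebra_simps)

lemma E_star_0: "E_star 0 w = 0" "E_star w 0 = 0"
  by (simp_all add: E_star_def H_star_def)

lemma E_star_sum: "finite A \<Longrightarrow> E_star (\<Sum>i\<in>A. x i) w = (\<Sum>i\<in>A. E_star (x i) w)"
  by (induction A rule: finite_induct) (simp_all add: E_star_add E_star_0)

lemma E_star_sum_right: "finite A \<Longrightarrow> E_star w (\<Sum>i\<in>A. x i) = (\<Sum>i\<in>A. E_star w (x i))"
  by (induction A rule: finite_induct) (simp_all add: E_star_add E_star_0)

text \<open>Two bases differ by an integer matrix whose inverse is also an integer matrix; its determinant is a
  unit of \<open>\<int>\<close>, and it enters the Gram determinant squared.\<close>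

lemma det_gram_matrix_basis_change:
  assumes e: "z_basis L e" and e': "z_basis L e'"
  shows "det (gram_matrix E_star e') = det (gram_matrix E_star e)"
proof -
  define T where "T e c = (\<Sum>i\<in>UNIV. of_int (c $ i) *s (e $ i))" for e :: "(complex^2)^4" and c :: "int^4"
  have bij: "bij_betw (T e) UNIV L" "bij_betw (T e') UNIV L"
    using e e' unfolding z_basis_def T_def by simp_all
  have axis: "T e (axis i 1) = e $ i" for e i
  proof -
    have "T e (axis i 1) = (\<Sum>j\<in>UNIV. if j = i then e $ j else 0)"
      unfolding T_def by (rule sum.cong) (simp_all add: axis_def)
    then show ?thesis by simp
  qed
  have surj: "range (T e) = L" "range (T e') = L"
    using bij_betw_imp_surj_on[OF bij(1)] bij_betw_imp_surj_on[OF bij(2)] by simp_all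
  have "e' $ i \<in> range (T e)" "e $ i \<in> range (T e')" for i
    unfolding surj using rangeI[of "T e'" "axis i 1"] rangeI[of "T e" "axis i 1"] by (simp_all only: axis surj)
  then have "\<forall>i. \<exists>c. e' $ i = T e c" "\<forall>i. \<exists>c. e $ i = T e' c" by (simp_all only: image_iff) blast+
  from choice[OF this(1)] choice[OF this(2)]
  obtain P0 Q0 where P0: "\<And>i. e' $ i = T e (P0 i)" and Q0: "\<And>i. e $ i = T e' (Q0 i)" by blast
  define P Q :: "real^4^4" where "P = (\<chi> i j. real_of_int ((\<chi> i. P0 i) $ i $ j))"
    and "Q = (\<chi> i j. real_of_int ((\<chi> i. Q0 i) $ i $ j))"
  have comp: "(\<Sum>j\<in>UNIV. Q0 i $ j * P0 j $ k) = (if i = k then 1 else 0)" for i k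
  proof -
    define c where "c = (\<chi> k. \<Sum>j\<in>UNIV. Q0 i $ j * P0 j $ k)"
    have "T e (axis i 1) = T e' (Q0 i)" unfolding axis by (rule Q0)
    also have "\<dots> = (\<Sum>j\<in>UNIV. \<Sum>k\<in>UNIV. of_int (Q0 i $ j * P0 j $ k) *s (e $ k))"
      unfolding T_def[of e'] P0 unfolding T_def
      by (simp add: vec_eq_iff sum_distrib_left mult.assoc)
    also have "\<dots> = (\<Sum>k\<in>UNIV. \<Sum>j\<in>UNIV. of_int (Q0 i $ j * P0 j $ k) *s (e $ k))" by (rule sum.swap)
    also have "\<dots> = T e c"
      unfolding T_def c_def by (simp add: vec_eq_iff sum_distrib_right)
    finally have "axis i 1 = c" using bij_betw_imp_inj_on[OF bij(1)] by (simp add: inj_on_def)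
    then have "axis i 1 $ k = c $ k" by simp
    then show ?thesis by (auto simp: c_def axis_def)
  qed
  have "Q ** P = mat 1"
    unfolding matrix_matrix_mult_def mat_def P_def Q_def vec_eq_iff vec_lambda_beta
  proof (intro allI)
    fix i k
    have "(\<Sum>j\<in>UNIV. real_of_int (Q0 i $ j) * real_of_int (P0 j $ k)) = of_int (\<Sum>j\<in>UNIV. Q0 i $ j * P0 j $ k)"
      by (simp only: of_int_sum of_int_mult)
    then show "(\<Sum>j\<in>UNIV. real_of_int (Q0 i $ j) * real_of_int (P0 j $ k)) = (if i = k then 1 else 0)"
      unfolding comp by simp
  qed
  then have "det (Q ** P) = 1" by simp
  then have QP: "det Q * det P = 1" by (simp only: det_mul)
  have "det P \<in> \<int>" "det Q \<in> \<int>" unfolding P_def Q_def by (rule det_of_int_Ints)+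
  then obtain p q :: int where pq: "det P = of_int p" "det Q = of_int q" by (auto elim!: Ints_cases)
  have "real_of_int (q * p) = of_int 1" using QP unfolding pq by simp
  then have "q * p = 1" by (simp only: of_int_eq_iff)
  then have "p\<^sup>2 = 1" by (auto simp: zmult_eq_1_iff)
  then have P2: "det P * det P = 1" unfolding pq by (simp add: power2_eq_square of_int_mult[symmetric] del: of_int_mult)
  have "gram_matrix E_star e' = P ** gram_matrix E_star e ** transpose P"
  proof -
    have "E_star (e' $ i) (e' $ j) = (\<Sum>k\<in>UNIV. (\<Sum>l\<in>UNIV. of_int (P0 i $ l) * E_star (e $ l) (e $ k)) * of_int (P0 j $ k))" for i j
      unfolding P0 T_def
      unfolding E_star_sum[OF finite] E_star_sum_right[OF finite] E_star_scale
      by (intro sum.cong refl) (rule mult.commute)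
    then show ?thesis
      by (simp add: gram_matrix_def matrix_matrix_mult_def transpose_def vec_eq_iff P_def)
  qed
  then have "det (gram_matrix E_star e') = det P * det (gram_matrix E_star e) * det P"
    by (simp add: det_mul det_transpose)
  also have "\<dots> = det (gram_matrix E_star e) * (det P * det P)" by (simp only: mult_ac)
  finally show ?thesis unfolding P2 by simp
qed

lemma det_gram_matrix_period_basis:
  "det (gram_matrix E_star (vector [vector [\<tau>, z], vector [z, \<tau>], vector [1, 0], vector [0, 1]]))
    = ((Im (2 * \<tau> + z))\<^sup>2 - (Im (\<tau> + 2 * z))\<^sup>2)\<^sup>2"
proof -
  define e :: "(complex^2)^4" where "e = vector [vector [\<tau>, z], vector [z, \<tau>], vector [1, 0], vector [0, 1]]"
  have e: "e $ 1 = vector [\<tau>, z]" "e $ 2 = vector [z, \<tau>]" "e $ 3 = vector [1, 0]" "e $ 4 = vector [0, 1]"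
    by (simp_all add: e_def vector_def)
  define a b where "a = Im (2 * \<tau> + z)" and "b = Im (\<tau> + 2 * z)"
  have E: "E_star (e$1) (e$1) = 0" "E_star (e$1) (e$2) = 0" "E_star (e$1) (e$3) = a" "E_star (e$1) (e$4) = b"
     "E_star (e$2) (e$1) = 0" "E_star (e$2) (e$2) = 0" "E_star (e$2) (e$3) = b" "E_star (e$2) (e$4) = a"
     "E_star (e$3) (e$1) = - a" "E_star (e$3) (e$2) = - b" "E_star (e$3) (e$3) = 0" "E_star (e$3) (e$4) = 0"
     "E_star (e$4) (e$1) = - b" "E_star (e$4) (e$2) = - a" "E_star (e$4) (e$3) = 0" "E_star (e$4) (e$4) = 0"
    by (simp_all add: e E_star_def H_star_def a_def b_def)
  have "det (gram_matrix E_star e) = (a\<^sup>2 - b\<^sup>2)\<^sup>2"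
    unfolding det_4 gram_matrix_def vec_lambda_beta E by (simp add: power2_eq_square algebra_simps)
  then show ?thesis unfolding e_def a_def b_def .
qed

section \<open>Bases of spaces of functions\<close>

lemma sum_fun_apply: "(\<Sum>r\<in>R. F r) x = (\<Sum>r\<in>R. F r x)" for F :: "'i \<Rightarrow> 'a \<Rightarrow> complex"
  by (induction R rule: infinite_finite_induct) simp_all

lemma subspace_sections: "cfun.subspace (sections L J)"
proof (rule cfun.subspaceI)
  have "holomorphic2_on (0 :: complex^2 \<Rightarrow> complex) UNIV"
    using holomorphic2_on_const[of 0 UNIV] by (simp add: zero_fun_def)
  then show "0 \<in> sections L J" by (simp add: sections_def)
next
  fix f g assume "f \<in> sections L J" "g \<in> sections L J"
  then show "f + g \<in> sections L J"
    using holomorphic2_on_add[of f UNIV g] by (simp add: sections_def plus_fun_def distrib_left)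
next
  fix c f assume "f \<in> sections L J"
  then show "scale_fun c f \<in> sections L J"
    using holomorphic2_on_mult[OF holomorphic2_on_const, of f UNIV c] by (simp add: sections_def scale_fun_def)
qed

lemma family_is_basis:
  fixes g :: "'i \<Rightarrow> 'a \<Rightarrow> complex"
  assumes R: "finite R" and g: "\<And>r. r \<in> R \<Longrightarrow> g r \<in> S" and S: "cfun.subspace S"
    and gen: "\<And>s. s \<in> S \<Longrightarrow> \<exists>d. \<forall>x. s x = (\<Sum>r\<in>R. d r * g r x)"
    and ind: "\<And>d. \<forall>x. (\<Sum>r\<in>R. d r * g r x) = 0 \<Longrightarrow> \<forall>r\<in>R. d r = 0"
  shows "inj_on g R" "cfun.independent (g ` R)" "cfun.span (g ` R) = S"
proof -
  show inj: "inj_on g R"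
  proof (rule inj_onI, rule ccontr)
    fix r s assume r: "r \<in> R" and s: "s \<in> R" and eq: "g r = g s" and ne: "r \<noteq> s"
    define d :: "'i \<Rightarrow> complex" where "d t = (if t = r then 1 else 0) + (if t = s then - 1 else 0)" for t
    have "(\<Sum>t\<in>R. d t * g t x) = 0" for x
    proof -
      have "(\<Sum>t\<in>R. d t * g t x) = (\<Sum>t\<in>R. (if t = r then g t x else 0) + (if t = s then - g t x else 0))"
        by (rule sum.cong) (auto simp: d_def)
      also have "\<dots> = g r x + (- g s x)" unfolding sum.distrib using R r s by simp
      finally show ?thesis using eq by simp
    qed
    then have "\<forall>t\<in>R. d t = 0" by (intro ind allI)
    from bspec[OF this r] ne show False by (simp add: d_def)
  qed
  show "cfun.independent (g ` R)"
  proof (rule cfun.independent_if_scalars_zero)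
    show "finite (g ` R)" using R by simp
    fix u h assume 0: "(\<Sum>h\<in>g ` R. scale_fun (u h) h) = 0" and "h \<in> g ` R"
    then obtain r where r: "r \<in> R" "h = g r" by blast
    have "(\<Sum>r\<in>R. scale_fun (u (g r)) (g r)) = 0" using 0 by (simp add: sum.reindex[OF inj])
    then have "(\<Sum>r\<in>R. scale_fun (u (g r)) (g r)) x = 0" for x by simp
    then have "(\<Sum>r\<in>R. u (g r) * g r x) = 0" for x
      unfolding sum_fun_apply scale_fun_def .
    then have "\<forall>r\<in>R. u (g r) = 0" by (intro ind[of "\<lambda>r. u (g r)"] allI)
    from bspec[OF this r(1)] show "u h = 0" unfolding r(2) .
  qed
  show "cfun.span (g ` R) = S"
  proof
    show "cfun.span (g ` R) \<subseteq> S" by (rule cfun.span_minimal[OF _ S]) (use g in blast)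
    show "S \<subseteq> cfun.span (g ` R)"
    proof
      fix s assume "s \<in> S"
      then obtain d where d: "\<forall>x. s x = (\<Sum>r\<in>R. d r * g r x)" using gen by blast
      have "s = (\<Sum>r\<in>R. scale_fun (d r) (g r))"
        by (rule ext) (simp add: sum_fun_apply scale_fun_def d)
      moreover have "(\<Sum>r\<in>R. scale_fun (d r) (g r)) \<in> cfun.span (g ` R)"
        by (intro cfun.span_sum cfun.span_scale cfun.span_base) blast
      ultimately show "s \<in> cfun.span (g ` R)" by simp
    qed
  qed
qed

lemma span_eval_relation:
  assumes "\<phi> \<in> cfun.span B" "\<forall>b\<in>B. b x = c * b y"
  shows "\<phi> x = c * \<phi> y"
  using assms(1)
proof (induction rule: cfun.span_induct)
  case base
  show ?case by (rule cfun.subspaceI) (auto simp: scale_fun_def algebra_simps)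
qed (use assms(2) in blast)

lemma span_line_derivative:
  fixes B :: "(complex^2 \<Rightarrow> complex) set"
  assumes "\<phi> \<in> cfun.span B"
    "\<forall>b\<in>B. ((\<lambda>t. b (x + t *s v)) has_field_derivative l * b x) (at 0)"
  shows "((\<lambda>t. \<phi> (x + t *s v)) has_field_derivative l * \<phi> x) (at 0)"
  using assms(1)
proof (induction rule: cfun.span_induct)
  case base
  show ?case
  proof (rule cfun.subspaceI)
    fix f g
    assume "f \<in> {f. ((\<lambda>t. f (x + t *s v)) has_field_derivative l * f x) (at 0)}"
      and "g \<in> {f. ((\<lambda>t. f (x + t *s v)) has_field_derivative l * f x) (at 0)}"
    then have "((\<lambda>t. f (x + t *s v) + g (x + t *s v)) has_field_derivative l * f x + l * g x) (at 0)"
      by (simp add: DERIV_add)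
    then show "f + g \<in> {f. ((\<lambda>t. f (x + t *s v)) has_field_derivative l * f x) (at 0)}"
      by (simp add: distrib_left)
  next
    fix c f assume "f \<in> {f. ((\<lambda>t. f (x + t *s v)) has_field_derivative l * f x) (at 0)}"
    then have "((\<lambda>t. c * f (x + t *s v)) has_field_derivative c * (l * f x)) (at 0)"
      by (simp add: DERIV_cmult)
    then show "scale_fun c f \<in> {f. ((\<lambda>t. f (x + t *s v)) has_field_derivative l * f x) (at 0)}"
      by (simp add: scale_fun_def mult_ac)
  qed simp
qed (use assms(2) in blast)

section \<open>From line bundles to theta functions\<close>

text \<open>The complex bilinear form that agrees with \<open>H\<^sub>*\<close> when the second argument is real.\<close>

definition bform :: "complex^2 \<Rightarrow> complex^2 \<Rightarrow> complex" where
  "bform x y = 2 * x$1 * y$1 + 2 * x$2 * y$2 + x$1 * y$2 + x$2 * y$1"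

definition cdot :: "complex^2 \<Rightarrow> complex^2 \<Rightarrow> complex" where
  "cdot x y = x$1 * y$1 + x$2 * y$2"

definition idot :: "int \<times> int \<Rightarrow> int \<times> int \<Rightarrow> int" where
  "idot p q = fst p * fst q + snd p * snd q"

lemma int_exponential:
  fixes \<phi> :: "int \<Rightarrow> complex"
  assumes mult: "\<And>i j. \<phi> (i + j) = \<phi> i * \<phi> j" and nz: "\<phi> 1 \<noteq> 0"
  shows "\<phi> j = exp (of_int j * Ln (\<phi> 1))"
proof -
  have 0: "\<phi> 0 = 1" using mult[of 1 0] nz by simp
  have nat: "\<phi> (int n) = exp (of_nat n * Ln (\<phi> 1))" for n
  proof (induction n)
    case (Suc n)
    have "\<phi> (int (Suc n)) = \<phi> (int n) * \<phi> 1" using mult[of "int n" 1] by (simp add: add.commute)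
    also have "\<dots> = exp (of_nat n * Ln (\<phi> 1)) * exp (Ln (\<phi> 1))" using nz by (simp add: Suc.IH)
    also have "\<dots> = exp (of_nat (Suc n) * Ln (\<phi> 1))" by (simp add: exp_add[symmetric] distrib_right add.commute)
    finally show ?case .
  qed (simp add: 0)
  show ?thesis
  proof (cases "j \<ge> 0")
    case True
    then show ?thesis using nat[of "nat j"] by simp
  next
    case False
    define n where "n = nat (- j)"
    have j: "j = - int n" using False by (simp add: n_def)
    have "\<phi> j * \<phi> (int n) = 1" using mult[of j "int n"] 0 by (simp add: j)
    then have "\<phi> j * exp (of_nat n * Ln (\<phi> 1)) = 1" by (simp only: nat)
    then show ?thesis unfolding j by (simp add: exp_minus field_simps)
  qed
qed

context theta_data begin

definition Lat :: "(complex^2) set" where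
  "Lat = period_lattice (period_matrix \<tau> \<zeta>)"

lemma Lat_iff: "x \<in> Lat \<longleftrightarrow> (\<exists>m n. x = Om m + ivec n)"
proof
  assume "x \<in> Lat"
  then obtain m n :: "complex^2" where x: "x = m v* period_matrix \<tau> \<zeta> + n"
    and "\<forall>i. m $ i \<in> \<int>" "\<forall>i. n $ i \<in> \<int>" unfolding Lat_def period_lattice_def by blast
  then have "m $ 1 \<in> \<int>" "m $ 2 \<in> \<int>" "n $ 1 \<in> \<int>" "n $ 2 \<in> \<int>" by blast+
  then obtain m1 m2 n1 n2 where "m$1 = of_int m1" "m$2 = of_int m2" "n$1 = of_int n1" "n$2 = of_int n2"
    by (elim Ints_cases)
  then have "x = Om (m1, m2) + ivec (n1, n2)"
    by (simp add: vec_eq_iff forall_2 x Om_def ivec_def period_matrix_def vector_matrix_mult_def sum_2 algebra_simps)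
  then show "\<exists>m n. x = Om m + ivec n" by blast
next
  assume "\<exists>m n. x = Om m + ivec n"
  then obtain m n where x: "x = Om m + ivec n" by blast
  have "x = ivec m v* period_matrix \<tau> \<zeta> + ivec n"
    by (simp add: vec_eq_iff forall_2 x Om_def ivec_def period_matrix_def vector_matrix_mult_def sum_2 algebra_simps)
  moreover have "\<forall>i. ivec m $ i \<in> \<int>" for m by (simp add: ivec_def forall_2)
  ultimately show "x \<in> Lat" unfolding Lat_def period_lattice_def by blast
qed

lemma Om_add: "Om (fst m + fst m', snd m + snd m') = Om m + Om m'"
  and ivec_add: "ivec (fst n + fst n', snd n + snd n') = ivec n + ivec n'"
  and Om_neg: "Om (- fst m, - snd m) = - Om m" and ivec_neg: "ivec (- fst n, - snd n) = - ivec n"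
  by (simp_all add: Om_def ivec_def vec_eq_iff forall_2 algebra_simps)

lemma Om_in_Lat: "Om m + ivec n \<in> Lat" unfolding Lat_iff by blast

lemma Lat_0: "0 \<in> Lat" using Om_in_Lat[of "(0,0)" "(0,0)"] by simp

lemma Lat_add: assumes "\<alpha> \<in> Lat" "\<beta> \<in> Lat" shows "\<alpha> + \<beta> \<in> Lat"
proof -
  obtain m n m' n' where "\<alpha> = Om m + ivec n" "\<beta> = Om m' + ivec n'" using assms unfolding Lat_iff by blast
  then have "\<alpha> + \<beta> = Om (fst m + fst m', snd m + snd m') + ivec (fst n + fst n', snd n + snd n')"
    unfolding Om_add ivec_add by simp
  then show ?thesis using Om_in_Lat by simp
qed

lemma Lat_neg: assumes "\<alpha> \<in> Lat" shows "- \<alpha> \<in> Lat"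
proof -
  obtain m n where "\<alpha> = Om m + ivec n" using assms unfolding Lat_iff by blast
  then have "- \<alpha> = Om (- fst m, - snd m) + ivec (- fst n, - snd n)" unfolding Om_neg ivec_neg by simp
  then show ?thesis using Om_in_Lat by simp
qed

text \<open>Subtracting \<open>m\<Omega>\<close> bounds the imaginary parts of the coordinates, subtracting an integer point then
  bounds the real parts.\<close>

lemma Lat_cocompact: "\<exists>\<alpha>\<in>Lat. norm (x + \<alpha>) \<le> 2 * (1 + (\<bar>Im \<tau>\<bar> + \<bar>Im \<zeta>\<bar>))"
proof -
  define D where "D = (Im \<tau>)\<^sup>2 - (Im \<zeta>)\<^sup>2"
  have "real_of_int (a\<^sup>2 - b\<^sup>2) > 0" using disc_pos by (simp only: of_int_0_less_iff)
  then have D: "D \<noteq> 0" using disc_eq by (simp add: D_def)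
  \<comment> \<open>The real solution of \<open>(s1, s2) Im \<Omega> = Im x\<close>, by Cramer's rule.\<close>
  define s1 where "s1 = (Im \<tau> * Im (x$1) - Im \<zeta> * Im (x$2)) / D"
  define s2 where "s2 = (Im \<tau> * Im (x$2) - Im \<zeta> * Im (x$1)) / D"
  have "s1 * Im \<tau> + s2 * Im \<zeta> = D * Im (x$1) / D" "s1 * Im \<zeta> + s2 * Im \<tau> = D * Im (x$2) / D"
    unfolding s1_def s2_def D_def by (simp_all add: add_divide_distrib[symmetric] power2_eq_square algebra_simps)
  then have s: "s1 * Im \<tau> + s2 * Im \<zeta> = Im (x$1)" "s1 * Im \<zeta> + s2 * Im \<tau> = Im (x$2)" using D by simp_all
  define y where "y = x + Om (- \<lfloor>s1\<rfloor>, - \<lfloor>s2\<rfloor>)"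
  have fr: "0 \<le> t - of_int \<lfloor>t\<rfloor>" "t - of_int \<lfloor>t\<rfloor> \<le> 1" for t :: real by linarith+
  have bd: "\<bar>(t - of_int \<lfloor>t\<rfloor>) * u\<bar> \<le> \<bar>u\<bar>" for t u :: real
    using mult_right_mono[OF fr(2), of "\<bar>u\<bar>" t] fr(1)[of t] by (simp add: abs_mult)
  have "Im (y$1) = (s1 - of_int \<lfloor>s1\<rfloor>) * Im \<tau> + (s2 - of_int \<lfloor>s2\<rfloor>) * Im \<zeta>"
    "Im (y$2) = (s1 - of_int \<lfloor>s1\<rfloor>) * Im \<zeta> + (s2 - of_int \<lfloor>s2\<rfloor>) * Im \<tau>"
    by (simp_all add: y_def Om_def s[symmetric] algebra_simps)
  then have im: "\<bar>Im (y$1)\<bar> \<le> \<bar>Im \<tau>\<bar> + \<bar>Im \<zeta>\<bar>" "\<bar>Im (y$2)\<bar> \<le> \<bar>Im \<tau>\<bar> + \<bar>Im \<zeta>\<bar>"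
    using bd[of s1 "Im \<tau>"] bd[of s2 "Im \<zeta>"] bd[of s1 "Im \<zeta>"] bd[of s2 "Im \<tau>"] by linarith+
  define u where "u = y + ivec (- \<lfloor>Re (y$1)\<rfloor>, - \<lfloor>Re (y$2)\<rfloor>)"
  have uim: "Im (u$1) = Im (y$1)" "Im (u$2) = Im (y$2)" by (simp_all add: u_def ivec_def)
  have ure: "\<bar>Re (u$1)\<bar> \<le> 1" "\<bar>Re (u$2)\<bar> \<le> 1"
    using fr[of "Re (y$1)"] fr[of "Re (y$2)"] by (simp_all add: u_def ivec_def)
  have "cmod (u$1) \<le> 1 + (\<bar>Im \<tau>\<bar> + \<bar>Im \<zeta>\<bar>)" "cmod (u$2) \<le> 1 + (\<bar>Im \<tau>\<bar> + \<bar>Im \<zeta>\<bar>)"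
    using cmod_le[of "u$1"] cmod_le[of "u$2"] im ure unfolding uim by linarith+
  moreover have "norm u \<le> (\<Sum>i\<in>UNIV. cmod (u $ i))" unfolding norm_vec_def by (rule L2_set_le_sum) simp
  ultimately have "norm u \<le> (1 + (\<bar>Im \<tau>\<bar> + \<bar>Im \<zeta>\<bar>)) + (1 + (\<bar>Im \<tau>\<bar> + \<bar>Im \<zeta>\<bar>))"
    unfolding sum_2 by (meson add_mono order_trans)
  then have "norm u \<le> 2 * (1 + (\<bar>Im \<tau>\<bar> + \<bar>Im \<zeta>\<bar>))" by simp
  then show ?thesis unfolding u_def y_def
    by (intro bexI[OF _ Om_in_Lat[of "(- \<lfloor>s1\<rfloor>, - \<lfloor>s2\<rfloor>)" "(- \<lfloor>Re (y$1)\<rfloor>, - \<lfloor>Re (y$2)\<rfloor>)"]])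
       (simp add: add.assoc y_def)
qed

lemma Lat_coordinates_unique:
  assumes "Om m + ivec n = Om m' + ivec n'"
  shows "m = m' \<and> n = n'"
proof -
  have d: "Om (fst m - fst m', snd m - snd m') = ivec (fst n' - fst n, snd n' - snd n)"
    using assms by (simp add: Om_def ivec_def vec_eq_iff forall_2 algebra_simps)
  have "exp (2 * pi * \<i> * dotp (fst m - fst m', snd m - snd m') (Om l)) = 1" for l
  proof -
    have "dotp (fst m - fst m', snd m - snd m') (Om l) = dotp l (Om (fst m - fst m', snd m - snd m'))"
      by (simp add: dotp_def Om_def algebra_simps)
    also have "\<dots> = dotp l (ivec (fst n' - fst n, snd n' - snd n))" by (simp only: d)
    also have "\<dots> = of_int (idot l (fst n' - fst n, snd n' - snd n))" by (simp add: dotp_def ivec_def idot_def)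
    finally show ?thesis unfolding exp_2pi_eq_1_iff by simp
  qed
  from dotp_Om_real_imp_0[OF this] have m: "m = m'" by (simp add: prod_eq_iff)
  then have "ivec (fst n' - fst n, snd n' - snd n) = 0" using d by simp
  then have "n = n'" by (simp add: ivec_def vec_eq_iff forall_2 prod_eq_iff)
  with m show ?thesis by blast
qed

text \<open>The two forms differ by \<open>-2i\<close> times the bilinear form with the imaginary part of the lattice
  vector; for \<open>m\<Omega> + n\<close> the latter is multiplication by \<open>mM\<close>.\<close>

lemma H_star_Lat: "H_star x (Om m + ivec n) = bform x (Om m + ivec n) - 2 * \<i> * dotp (Mi m) x"
proof -
  have c: "cnj w = w - 2 * \<i> * of_real (Im w)" for w by (simp add: complex_eq_iff)
  have a: "of_int a = complex_of_real (2 * Im \<tau> + Im \<zeta>)" and b: "of_int b = complex_of_real (Im \<tau> + 2 * Im \<zeta>)"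
    unfolding a_eq[symmetric] b_eq[symmetric] by simp_all
  show ?thesis
    unfolding H_star_def bform_def dotp_def Mi_def Om_def ivec_def
    by (simp add: c[of \<tau>] c[of \<zeta>] a b algebra_simps)
qed

lemma E_star_Lat: "E_star (Om m + ivec n) (Om m' + ivec n') = of_int (idot n' (Mi m) - idot n (Mi m'))"
  unfolding E_star_def H_star_def
  by (simp add: Om_def ivec_def idot_def Mi_def a_eq b_eq algebra_simps)

text \<open>\<open>E\<^sub>*\<close> vanishes on \<open>\<int>\<^sup>2\<Omega>\<close> and on \<open>\<int>\<^sup>2\<close>, so on each of these a semi-character is a character, that is
  the exponential of a linear form.\<close>

lemma semi_character_Lat:
  assumes "semi_character Lat E_star \<psi>"
  shows "\<exists>\<epsilon> \<delta>. \<forall>m n. \<psi> (Om m + ivec n) = exp (2 * pi * \<i> * (dotp m \<epsilon> + dotp n \<delta>) + pi * \<i> * of_int (idot n (Mi m)))"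
proof -
  have mult: "\<psi> ((Om m + ivec n) + (Om m' + ivec n'))
      = \<psi> (Om m + ivec n) * \<psi> (Om m' + ivec n') * exp (pi * \<i> * of_int (idot n' (Mi m) - idot n (Mi m')))" for m n m' n'
  proof -
    have "\<psi> ((Om m + ivec n) + (Om m' + ivec n'))
      = \<psi> (Om m + ivec n) * \<psi> (Om m' + ivec n') * exp (\<i> * of_real pi * of_real (E_star (Om m + ivec n) (Om m' + ivec n')))"
      using assms Om_in_Lat unfolding semi_character_def by blast
    then show ?thesis unfolding E_star_Lat by (simp only: of_real_of_int_eq mult_ac)
  qed
  have nz: "\<psi> (Om m + ivec n) \<noteq> 0" for m n
  proof -
    have "cmod (\<psi> (Om m + ivec n)) = 1" using assms Om_in_Lat unfolding semi_character_def by blast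
    then show ?thesis by auto
  qed
  have O: "\<psi> (Om m + Om m') = \<psi> (Om m) * \<psi> (Om m')" for m m'
    using mult[of m "(0,0)" m' "(0,0)"] by (simp add: idot_def)
  have I: "\<psi> (ivec n + ivec n') = \<psi> (ivec n) * \<psi> (ivec n')" for n n'
    using mult[of "(0,0)" n "(0,0)" n'] by (simp add: idot_def)
  have O1: "\<psi> (Om (j, 0)) = exp (of_int j * Ln (\<psi> (Om (1, 0))))" for j
    by (rule int_exponential[of "\<lambda>j. \<psi> (Om (j, 0))"])
       (use O[of "(_,0)" "(_,0)"] Om_add[of "(_,0)" "(_,0)"] nz[of "(1,0)" "(0,0)"] in simp_all)
  have O2: "\<psi> (Om (0, j)) = exp (of_int j * Ln (\<psi> (Om (0, 1))))" for j
    by (rule int_exponential[of "\<lambda>j. \<psi> (Om (0, j))"])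
       (use O[of "(0,_)" "(0,_)"] Om_add[of "(0,_)" "(0,_)"] nz[of "(0,1)" "(0,0)"] in simp_all)
  have I1: "\<psi> (ivec (j, 0)) = exp (of_int j * Ln (\<psi> (ivec (1, 0))))" for j
    by (rule int_exponential[of "\<lambda>j. \<psi> (ivec (j, 0))"])
       (use I[of "(_,0)" "(_,0)"] ivec_add[of "(_,0)" "(_,0)"] nz[of "(0,0)" "(1,0)"] in simp_all)
  have I2: "\<psi> (ivec (0, j)) = exp (of_int j * Ln (\<psi> (ivec (0, 1))))" for j
    by (rule int_exponential[of "\<lambda>j. \<psi> (ivec (0, j))"])
       (use I[of "(0,_)" "(0,_)"] ivec_add[of "(0,_)" "(0,_)"] nz[of "(0,0)" "(0,1)"] in simp_all)
  define \<epsilon> where "\<epsilon> = vec2 (Ln (\<psi> (Om (1, 0))) / (2 * pi * \<i>)) (Ln (\<psi> (Om (0, 1))) / (2 * pi * \<i>))"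
  define \<delta> where "\<delta> = vec2 (Ln (\<psi> (ivec (1, 0))) / (2 * pi * \<i>)) (Ln (\<psi> (ivec (0, 1))) / (2 * pi * \<i>))"
  have c: "2 * pi * \<i> * (k * (u / (2 * pi * \<i>)) + l * (v / (2 * pi * \<i>))) = k * u + l * v" for k u l v :: complex
    by (simp add: field_simps)
  have "\<psi> (Om m + ivec n) = exp (2 * pi * \<i> * (dotp m \<epsilon> + dotp n \<delta>) + pi * \<i> * of_int (idot n (Mi m)))" for m n
  proof -
    have "\<psi> (Om m) = \<psi> (Om (fst m, 0)) * \<psi> (Om (0, snd m))"
      using O[of "(fst m, 0)" "(0, snd m)"] Om_add[of "(fst m, 0)" "(0, snd m)"] by simp
    also have "\<dots> = exp (2 * pi * \<i> * dotp m \<epsilon>)"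
      unfolding O1[of "fst m"] O2[of "snd m"] exp_add[symmetric] dotp_def \<epsilon>_def vec2_nth c ..
    finally have Om: "\<psi> (Om m) = exp (2 * pi * \<i> * dotp m \<epsilon>)" .
    have "\<psi> (ivec n) = \<psi> (ivec (fst n, 0)) * \<psi> (ivec (0, snd n))"
      using I[of "(fst n, 0)" "(0, snd n)"] ivec_add[of "(fst n, 0)" "(0, snd n)"] by simp
    also have "\<dots> = exp (2 * pi * \<i> * dotp n \<delta>)"
      unfolding I1[of "fst n"] I2[of "snd n"] exp_add[symmetric] dotp_def \<delta>_def vec2_nth c ..
    finally have iv: "\<psi> (ivec n) = exp (2 * pi * \<i> * dotp n \<delta>)" .
    have "\<psi> (Om m + ivec n) = \<psi> (Om m) * \<psi> (ivec n) * exp (pi * \<i> * of_int (idot n (Mi m)))"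
      using mult[of m "(0,0)" "(0,0)" n] by (simp add: idot_def)
    then show ?thesis unfolding Om iv exp_add[symmetric] by (simp only: distrib_left)
  qed
  then show ?thesis by blast
qed

text \<open>The function \<open>m\<Omega> + n \<mapsto> (-1)\<^bsup>n\<cdot>mM\<^esup>\<close> works, since \<open>E\<^sub>*\<close> is congruent modulo 2 to the polarization of
  the quadratic form in the exponent.\<close>

lemma semi_character_exists: "\<exists>\<psi>. semi_character Lat E_star \<psi>"
proof -
  define co where "co \<alpha> = (SOME mn. \<alpha> = Om (fst mn) + ivec (snd mn))" for \<alpha>
  have co: "co (Om m + ivec n) = (m, n)" for m n
  proof -
    have "Om m + ivec n = Om (fst (co (Om m + ivec n))) + ivec (snd (co (Om m + ivec n)))"
      unfolding co_def by (rule someI[of "\<lambda>mn. Om m + ivec n = Om (fst mn) + ivec (snd mn)" "(m, n)"]) simp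
    from Lat_coordinates_unique[OF this] show ?thesis by (simp add: prod_eq_iff)
  qed
  define \<psi> where "\<psi> \<alpha> = exp (pi * \<i> * of_int (idot (snd (co \<alpha>)) (Mi (fst (co \<alpha>)))))" for \<alpha>
  have \<psi>: "\<psi> (Om m + ivec n) = exp (pi * \<i> * of_int (idot n (Mi m)))" for m n
    unfolding \<psi>_def co by simp
  have "semi_character Lat E_star \<psi>"
    unfolding semi_character_def
  proof (intro conjI ballI)
    fix \<alpha> assume "\<alpha> \<in> Lat"
    show "cmod (\<psi> \<alpha>) = 1" unfolding \<psi>_def by simp
    fix \<beta> assume "\<beta> \<in> Lat"
    with \<open>\<alpha> \<in> Lat\<close> obtain m n m' n' where \<alpha>: "\<alpha> = Om m + ivec n" and \<beta>: "\<beta> = Om m' + ivec n'"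
      unfolding Lat_iff by blast
    have "\<alpha> + \<beta> = Om (fst m + fst m', snd m + snd m') + ivec (fst n + fst n', snd n + snd n')"
      unfolding \<alpha> \<beta> Om_add ivec_add by simp
    then have "\<psi> (\<alpha> + \<beta>) = exp (pi * \<i> * of_int (idot (fst n + fst n', snd n + snd n') (Mi (fst m + fst m', snd m + snd m'))))"
      by (simp only: \<psi>)
    also have "idot (fst n + fst n', snd n + snd n') (Mi (fst m + fst m', snd m + snd m'))
        = idot n (Mi m) + idot n' (Mi m') + (idot n' (Mi m) - idot n (Mi m')) + 2 * idot n (Mi m')"
      by (simp add: idot_def Mi_def algebra_simps)
    also have "exp (pi * \<i> * of_int \<dots>) = exp (pi * \<i> * of_int (idot n (Mi m))) * exp (pi * \<i> * of_int (idot n' (Mi m')))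
        * exp (pi * \<i> * of_int (idot n' (Mi m) - idot n (Mi m'))) * exp (2 * of_real pi * \<i> * of_int (idot n (Mi m')))"
      unfolding exp_add[symmetric] by (rule arg_cong[where f = exp]) (simp add: algebra_simps)
    also have "exp (2 * of_real pi * \<i> * of_int (idot n (Mi m'))) = 1" by (rule exp_2pi_int)
    finally show "\<psi> (\<alpha> + \<beta>) = \<psi> \<alpha> * \<psi> \<beta> * exp (\<i> * of_real pi * of_real (E_star \<alpha> \<beta>))"
      unfolding \<alpha> \<beta> \<psi> E_star_Lat by (simp only: of_real_of_int_eq mult_1_right mult.commute[of \<i>])
  qed
  then show ?thesis by blast
qed

text \<open>The exponential of a quadratic polynomial that turns the automorphy factor of the line bundle into
  the one of classical theta functions. The linear term absorbs the semi-character on \<open>\<int>\<^sup>2\<close>; the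
  semi-character on \<open>\<int>\<^sup>2\<Omega>\<close> is absorbed by a translation.\<close>

definition trivializer :: "complex^2 \<Rightarrow> complex^2 \<Rightarrow> complex" where
  "trivializer \<delta> x = exp (pi / 2 * bform x x + 2 * pi * \<i> * cdot \<delta> x)"

lemma trivializer_nonzero [simp]: "trivializer \<delta> x \<noteq> 0" by (simp add: trivializer_def)

lemma holomorphic2_trivializer: "holomorphic2_on (trivializer \<delta>) S"
  unfolding trivializer_def bform_def cdot_def
  by (intro holomorphic2_on_exp holomorphic2_on_add holomorphic2_on_mult holomorphic2_on_const holomorphic2_on_nth)

text \<open>The exponents on both sides differ by \<open>2\<pi>i (m\<cdot>\<epsilon> - \<delta>\<cdot>m\<Omega> - mM\<cdot>w)\<close>, so that
  \<open>w = (\<epsilon> - \<delta>\<Omega>)M\<^sup>-\<^sup>1\<close> is the required translation.\<close>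

lemma auto_factor_trivialized:
  assumes "semi_character Lat E_star \<psi>"
  shows "\<exists>\<delta> w. \<forall>m n y. auto_factor H_star \<psi> (Om m + ivec n) (y + w) * trivializer \<delta> (y + w)
     = trivializer \<delta> (y + w + (Om m + ivec n)) * theta_factor m y"
proof -
  from semi_character_Lat[OF assms] obtain \<epsilon> \<delta> where
    \<psi>: "\<And>m n. \<psi> (Om m + ivec n) = exp (2 * pi * \<i> * (dotp m \<epsilon> + dotp n \<delta>) + pi * \<i> * of_int (idot n (Mi m)))"
    by blast
  define r1 where "r1 = \<epsilon>$1 - (\<tau> * \<delta>$1 + \<zeta> * \<delta>$2)"
  define r2 where "r2 = \<epsilon>$2 - (\<zeta> * \<delta>$1 + \<tau> * \<delta>$2)"
  define D :: complex where "D = (of_int a)\<^sup>2 - (of_int b)\<^sup>2"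
  have D: "D \<noteq> 0" unfolding D_def by (rule disc_ne0)
  define w where "w = vec2 ((of_int a * r1 - of_int b * r2) / D) ((of_int a * r2 - of_int b * r1) / D)"
  have Mw: "of_int a * w$1 + of_int b * w$2 = r1" "of_int b * w$1 + of_int a * w$2 = r2"
  proof -
    have "of_int a * w$1 + of_int b * w$2 = (D * r1) / D" "of_int b * w$1 + of_int a * w$2 = (D * r2) / D"
      unfolding w_def vec2_nth D_def by (simp_all add: add_divide_distrib[symmetric] power2_eq_square algebra_simps)
    then show "of_int a * w$1 + of_int b * w$2 = r1" "of_int b * w$1 + of_int a * w$2 = r2" using D by simp_all
  qed
  have w: "dotp (Mi m) w = dotp m \<epsilon> - cdot \<delta> (Om m)" for m
  proof -
    have "dotp (Mi m) w = of_int (fst m) * (of_int a * w$1 + of_int b * w$2) + of_int (snd m) * (of_int b * w$1 + of_int a * w$2)"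
      by (simp add: dotp_def Mi_def algebra_simps)
    then show ?thesis unfolding Mw by (simp add: r1_def r2_def dotp_def cdot_def Om_def algebra_simps)
  qed
  have bf: "bform (x + y) (x + y) = bform x x + 2 * bform x y + bform y y" for x y
    by (simp add: bform_def algebra_simps)
  have cd: "cdot \<delta> (x + y) = cdot \<delta> x + cdot \<delta> y" for x y by (simp add: cdot_def algebra_simps)
  have cdi: "cdot \<delta> (ivec n) = dotp n \<delta>" for n by (simp add: cdot_def dotp_def ivec_def algebra_simps)
  have dpi: "dotp p (ivec n) = of_int (idot n p)" for p n by (simp add: dotp_def ivec_def idot_def algebra_simps)
  have "auto_factor H_star \<psi> (Om m + ivec n) (y + w) * trivializer \<delta> (y + w)
     = trivializer \<delta> (y + w + (Om m + ivec n)) * theta_factor m y" for m n y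
  proof -
    let ?\<alpha> = "Om m + ivec n" and ?x = "y + w"
    have al: "dotp (Mi m) ?\<alpha> = dotp (Mi m) (Om m) + of_int (idot n (Mi m))" by (simp only: dotp_add dpi)
    have ex: "2 * pi * \<i> * (dotp m \<epsilon> + dotp n \<delta>) + pi * \<i> * of_int (idot n (Mi m))
        + (pi * H_star ?x ?\<alpha> + pi / 2 * H_star ?\<alpha> ?\<alpha>) + (pi / 2 * bform ?x ?x + 2 * pi * \<i> * cdot \<delta> ?x)
      = (pi / 2 * bform (?x + ?\<alpha>) (?x + ?\<alpha>) + 2 * pi * \<i> * cdot \<delta> (?x + ?\<alpha>))
        + (- (2 * pi * \<i> * dotp (Mi m) y) - pi * \<i> * dotp (Mi m) (Om m))"
      unfolding H_star_Lat bf[of ?x] al dotp_add[of "Mi m" y w] w cd[of ?x] cd[of "Om m"] cdi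
      by (simp add: algebra_simps)
    have "auto_factor H_star \<psi> ?\<alpha> ?x * trivializer \<delta> ?x
      = exp (2 * pi * \<i> * (dotp m \<epsilon> + dotp n \<delta>) + pi * \<i> * of_int (idot n (Mi m))
        + (pi * H_star ?x ?\<alpha> + pi / 2 * H_star ?\<alpha> ?\<alpha>) + (pi / 2 * bform ?x ?x + 2 * pi * \<i> * cdot \<delta> ?x))"
      unfolding auto_factor_def \<psi> trivializer_def exp_add by simp
    also have "\<dots> = trivializer \<delta> (?x + ?\<alpha>) * theta_factor m y"
      unfolding ex trivializer_def theta_factor_def exp_add[symmetric] ..
    finally show ?thesis .
  qed
  then show ?thesis by blast
qed

end

section \<open>The line bundle of \<open>H\<^sub>*\<close>\<close>

lemma H_star_diag: "H_star x x = of_real ((cmod (x$1))\<^sup>2 + (cmod (x$2))\<^sup>2 + (cmod (x$1 + x$2))\<^sup>2)"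
proof -
  have "H_star x x = x$1 * cnj (x$1) + x$2 * cnj (x$2) + (x$1 + x$2) * cnj (x$1 + x$2)"
    unfolding H_star_def by (simp add: algebra_simps)
  then show ?thesis by (simp only: complex_norm_square of_real_add)
qed

lemma pos_definite_H_star: "pos_definite H_star"
  unfolding pos_definite_def
proof (intro allI impI)
  fix x :: "complex^2" assume "x \<noteq> 0"
  then have "x$1 \<noteq> 0 \<or> x$2 \<noteq> 0" by (auto simp: vec_eq_iff forall_2)
  then have "(cmod (x$1))\<^sup>2 + (cmod (x$2))\<^sup>2 > 0"
    by (auto intro: add_pos_nonneg add_nonneg_pos)
  then have "(cmod (x$1))\<^sup>2 + (cmod (x$2))\<^sup>2 + (cmod (x$1 + x$2))\<^sup>2 > 0"
    by (rule add_pos_nonneg) simp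
  then show "H_star x x \<in> \<real> \<and> Re (H_star x x) > 0"
    unfolding H_star_diag by (simp only: Re_complex_of_real Reals_of_real simp_thms)
qed

lemma hermitian_form_H_star: "hermitian_form H_star"
  unfolding hermitian_form_def H_star_def by (simp add: algebra_simps)

context theta_data begin

lemma riemann_form_H_star: "riemann_form Lat H_star"
  unfolding riemann_form_def
proof (intro conjI allI impI ballI)
  show "hermitian_form H_star" by (rule hermitian_form_H_star)
next
  fix x assume "\<forall>w. H_star x w = 0"
  then have "Re (H_star x x) = 0" by simp
  then show "x = 0" using pos_definite_H_star unfolding pos_definite_def by force
next
  fix \<alpha> \<beta> assume "\<alpha> \<in> Lat" "\<beta> \<in> Lat"
  then obtain m n m' n' where "\<alpha> = Om m + ivec n" "\<beta> = Om m' + ivec n'" unfolding Lat_iff by blast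
  then have "Im (H_star \<alpha> \<beta>) = of_int (idot n' (Mi m) - idot n (Mi m'))"
    using E_star_Lat by (simp only: E_star_def)
  then show "Im (H_star \<alpha> \<beta>) \<in> \<int>" by simp
qed

lemma auto_factor_nonzero:
  assumes "semi_character Lat E_star \<psi>" "\<alpha> \<in> Lat" shows "auto_factor H_star \<psi> \<alpha> z \<noteq> 0"
proof -
  have "cmod (\<psi> \<alpha>) = 1" using assms unfolding semi_character_def by blast
  then show ?thesis unfolding auto_factor_def by auto
qed

definition trivializes :: "(complex^2 \<Rightarrow> complex) \<Rightarrow> complex^2 \<Rightarrow> complex^2 \<Rightarrow> bool" where
  "trivializes \<psi> \<delta> w \<longleftrightarrow> (\<forall>m n y. auto_factor H_star \<psi> (Om m + ivec n) (y + w) * trivializer \<delta> (y + w)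
     = trivializer \<delta> (y + w + (Om m + ivec n)) * theta_factor m y)"

lemma section_to_theta:
  assumes T: "trivializes \<psi> \<delta> w"
    and s: "s \<in> sections Lat (tensor_power (auto_factor H_star \<psi>) k)"
  shows "(\<lambda>y. s (y + w) / trivializer \<delta> (y + w) ^ k) \<in> theta_space k"
  unfolding theta_space_def
proof (intro CollectI conjI allI)
  have hs: "holomorphic2_on s UNIV" using s by (simp add: sections_def)
  show "holomorphic2_on (\<lambda>y. s (y + w) / trivializer \<delta> (y + w) ^ k) UNIV"
    by (rule holomorphic2_on_divide[OF holomorphic2_on_translate[OF hs]
          holomorphic2_on_power[OF holomorphic2_on_translate[OF holomorphic2_trivializer]]]) simp
  fix m n y
  let ?\<alpha> = "Om m + ivec n"
  let ?t = "trivializer \<delta> (y + w)" and ?t' = "trivializer \<delta> (y + w + ?\<alpha>)" and ?J = "auto_factor H_star \<psi> ?\<alpha> (y + w)"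
  have sJ: "s (y + w + ?\<alpha>) = ?J ^ k * s (y + w)"
    using s Om_in_Lat unfolding sections_def tensor_power_def by blast
  have "?J * ?t = ?t' * theta_factor m y" using T unfolding trivializes_def by blast
  then have "?J ^ k * ?t ^ k = ?t' ^ k * theta_factor m y ^ k"
    by (simp only: power_mult_distrib[symmetric])
  then have JA: "?J ^ k / ?t' ^ k = theta_factor m y ^ k / ?t ^ k"
    by (simp add: frac_eq_eq mult.commute)
  have arg: "y + Om m + ivec n + w = y + w + ?\<alpha>" by (simp add: algebra_simps)
  have "s (y + w + ?\<alpha>) / ?t' ^ k = (?J ^ k / ?t' ^ k) * s (y + w)" by (simp add: sJ)
  also have "\<dots> = theta_factor m y ^ k * (s (y + w) / ?t ^ k)" unfolding JA by simp
  finally show "s (y + Om m + ivec n + w) / trivializer \<delta> (y + Om m + ivec n + w) ^ k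
      = theta_factor m y ^ k * (s (y + w) / ?t ^ k)"
    unfolding arg .
qed

lemma theta_to_section:
  assumes T: "trivializes \<psi> \<delta> w" and f: "f \<in> theta_space k"
  shows "(\<lambda>x. trivializer \<delta> x ^ k * f (x - w)) \<in> sections Lat (tensor_power (auto_factor H_star \<psi>) k)"
  unfolding sections_def
proof (intro CollectI conjI ballI allI)
  show "holomorphic2_on (\<lambda>x. trivializer \<delta> x ^ k * f (x - w)) UNIV"
    by (rule holomorphic2_on_mult[OF holomorphic2_on_power[OF holomorphic2_trivializer]
          holomorphic2_minus[OF theta_space_holomorphic[OF f]]])
  fix \<alpha> x assume "\<alpha> \<in> Lat"
  then obtain m n where \<alpha>: "\<alpha> = Om m + ivec n" unfolding Lat_iff by blast
  have "f ((x - w) + Om m + ivec n) = theta_factor m (x - w) ^ k * f (x - w)"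
    using f unfolding theta_space_def by blast
  then have "f (x + \<alpha> - w) = theta_factor m (x - w) ^ k * f (x - w)" by (simp add: \<alpha> algebra_simps)
  moreover have "auto_factor H_star \<psi> \<alpha> (x - w + w) * trivializer \<delta> (x - w + w)
      = trivializer \<delta> (x - w + w + \<alpha>) * theta_factor m (x - w)"
    using T unfolding trivializes_def \<alpha> by blast
  then have "auto_factor H_star \<psi> \<alpha> x * trivializer \<delta> x = trivializer \<delta> (x + \<alpha>) * theta_factor m (x - w)"
    by simp
  then have "auto_factor H_star \<psi> \<alpha> x ^ k * trivializer \<delta> x ^ k = trivializer \<delta> (x + \<alpha>) ^ k * theta_factor m (x - w) ^ k"
    by (simp only: power_mult_distrib[symmetric])
  ultimately show "trivializer \<delta> (x + \<alpha>) ^ k * f (x + \<alpha> - w)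
      = tensor_power (auto_factor H_star \<psi>) k \<alpha> x * (trivializer \<delta> x ^ k * f (x - w))"
    unfolding tensor_power_def by (simp only: mult.assoc[symmetric])
qed

lemma trivializes_exists:
  assumes "semi_character Lat E_star \<psi>" shows "\<exists>\<delta> w. trivializes \<psi> \<delta> w"
  unfolding trivializes_def by (rule auto_factor_trivialized[OF assms])

lemma sections_basis:
  assumes \<psi>: "semi_character Lat E_star \<psi>" and k: "k > 0"
  shows "\<exists>(R :: (int \<times> int) set) g. finite R \<and> card R = k\<^sup>2 * nat (a\<^sup>2 - b\<^sup>2) \<and> inj_on g R \<and> cfun.independent (g ` R)
     \<and> cfun.span (g ` R) = sections Lat (tensor_power (auto_factor H_star \<psi>) k)"
proof -
  obtain \<delta> w where T: "trivializes \<psi> \<delta> w" using trivializes_exists[OF \<psi>] by blast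
  let ?S = "sections Lat (tensor_power (auto_factor H_star \<psi>) k)"
  obtain R where R: "finite R" "card R = k\<^sup>2 * nat (a\<^sup>2 - b\<^sup>2)"
    and gen: "\<And>f. f \<in> theta_space k \<Longrightarrow> \<exists>d. \<forall>x. f x = (\<Sum>r\<in>R. d r * theta_basis k r x)"
    and ind: "\<And>d r. (\<And>x. (\<Sum>r\<in>R. d r * theta_basis k r x) = 0) \<Longrightarrow> r \<in> R \<Longrightarrow> d r = 0"
    by (rule theta_space_basis[OF k]) blast
  define g where "g r = (\<lambda>x. trivializer \<delta> x ^ k * theta_basis k r (x - w))" for r
  have sum_g: "(\<Sum>r\<in>R. d r * g r x) = trivializer \<delta> x ^ k * (\<Sum>r\<in>R. d r * theta_basis k r (x - w))" for d x
    unfolding g_def sum_distrib_left by (intro sum.cong refl) (simp only: mult_ac)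
  have gS: "g r \<in> ?S" for r
    unfolding g_def by (rule theta_to_section[OF T theta_basis_in[OF k]])
  have genS: "\<exists>d. \<forall>x. s x = (\<Sum>r\<in>R. d r * g r x)" if s: "s \<in> ?S" for s
  proof -
    obtain d where d: "\<forall>y. s (y + w) / trivializer \<delta> (y + w) ^ k = (\<Sum>r\<in>R. d r * theta_basis k r y)"
      using gen[OF section_to_theta[OF T s]] by blast
    have "s x = (\<Sum>r\<in>R. d r * g r x)" for x
      using spec[OF d, of "x - w"] unfolding sum_g by (simp add: field_simps)
    then show ?thesis by blast
  qed
  have indS: "\<forall>r\<in>R. d r = 0" if 0: "\<forall>x. (\<Sum>r\<in>R. d r * g r x) = 0" for d
  proof
    fix r assume r: "r \<in> R"
    show "d r = 0"
    proof (rule ind[OF _ r])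
      show "(\<Sum>r\<in>R. d r * theta_basis k r x) = 0" for x
        using spec[OF 0, of "x + w"] unfolding sum_g by simp
    qed
  qed
  note basis = family_is_basis[where R = R and g = g and S = ?S, OF R(1) gS subspace_sections genS indS]
  have "inj_on g R" by (rule basis(1))
  moreover have "cfun.independent (g ` R)" by (rule basis(2))
  moreover have "cfun.span (g ` R) = ?S" by (rule basis(3))
  ultimately show ?thesis using R by blast
qed

lemma tensor_power_1: "tensor_power J 1 = J"
  by (simp add: fun_eq_iff tensor_power_def)

lemma dim_sections:
  assumes \<psi>: "semi_character Lat E_star \<psi>"
  shows "cfun.dim (sections Lat (auto_factor H_star \<psi>)) = nat (a\<^sup>2 - b\<^sup>2)"
proof -
  from sections_basis[OF \<psi>, of 1] obtain R :: "(int \<times> int) set" and g where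
    R: "finite R" "card R = nat (a\<^sup>2 - b\<^sup>2)" "inj_on g R" "cfun.independent (g ` R)"
    and sp: "cfun.span (g ` R) = sections Lat (auto_factor H_star \<psi>)"
    unfolding tensor_power_1 by auto
  have "cfun.dim (cfun.span (g ` R)) = card (g ` R)"
    by (rule cfun.dim_eq_card[OF _ R(4)]) (simp add: cfun.span_span)
  then show ?thesis unfolding sp card_image[OF R(3)] R(2) .
qed

lemma section_basis_exists:
  assumes \<psi>: "semi_character Lat E_star \<psi>" and k: "k > 0"
  shows "\<exists>N \<theta>. section_basis Lat (tensor_power (auto_factor H_star \<psi>) k) N \<theta>"
proof -
  obtain R :: "(int \<times> int) set" and g where
    R: "finite R" "card R = k\<^sup>2 * nat (a\<^sup>2 - b\<^sup>2)" "inj_on g R" "cfun.independent (g ` R)"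
    and sp: "cfun.span (g ` R) = sections Lat (tensor_power (auto_factor H_star \<psi>) k)"
    using sections_basis[OF \<psi> k] by blast
  have "card R > 0" unfolding R(2) using k disc_pos by simp
  then have N: "{..card R - 1} = {0..<card R}" by auto
  obtain h where h: "bij_betw h {0..<card R} R" using ex_bij_betw_nat_finite[OF R(1)] by blast
  have im: "(\<lambda>i. g (h i)) ` {..card R - 1} = g ` R"
    unfolding N using bij_betw_imp_surj_on[OF h] by (simp only: image_image[symmetric])
  have "inj_on (\<lambda>i. g (h i)) {..card R - 1}"
    unfolding N using comp_inj_on[OF bij_betw_imp_inj_on[OF h]] R(3) bij_betw_imp_surj_on[OF h]
    by (simp add: o_def)
  then have "section_basis Lat (tensor_power (auto_factor H_star \<psi>) k) (card R - 1) (\<lambda>i. g (h i))"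
    unfolding section_basis_def im using R(4) sp by blast
  then show ?thesis by blast
qed

text \<open>Everything is transported to theta functions: a relation between the values, or between the values and
  the derivatives, of a basis of the sections extends to their span, and there the nowhere vanishing
  trivializer only changes the constants of proportionality.\<close>

lemma sections_embed_tensor_power:
  assumes \<psi>: "semi_character Lat E_star \<psi>" and n: "n \<ge> 3"
  shows "sections_embed Lat (tensor_power (auto_factor H_star \<psi>) n)"
  unfolding sections_embed_def
proof (intro conjI allI impI)
  let ?J = "tensor_power (auto_factor H_star \<psi>) n"
  show "\<exists>N \<theta>. section_basis Lat ?J N \<theta>" using section_basis_exists[OF \<psi>, of n] n by simp
  fix N \<theta> assume "section_basis Lat ?J N \<theta>"
  then have span: "cfun.span (\<theta> ` {..N}) = sections Lat ?J" by (simp add: section_basis_def)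
  obtain \<delta> w where T: "trivializes \<psi> \<delta> w" using trivializes_exists[OF \<psi>] by blast
  have \<theta>: "\<theta> k \<in> sections Lat ?J" if "k \<le> N" for k
    unfolding span[symmetric] by (rule cfun.span_base) (use that in simp)
  have th: "(\<lambda>x. trivializer \<delta> x ^ n * f (x - w)) \<in> cfun.span (\<theta> ` {..N})" if "f \<in> theta_space n" for f
    unfolding span by (rule theta_to_section[OF T that])
  show nz: "\<exists>k\<le>N. \<theta> k z \<noteq> 0" for z
  proof (rule ccontr)
    assume "\<not> (\<exists>k\<le>N. \<theta> k z \<noteq> 0)"
    \<comment> \<open>A common zero is a linear relation, with constant \<open>0\<close>, that extends to all sections.\<close>
    then have 0: "\<forall>b\<in>\<theta> ` {..N}. b z = 0 * b z" by auto
    obtain f where f: "f \<in> theta_space n" "f (z - w) \<noteq> 0" using theta_space_no_base_point[OF n] by blast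
    from span_eval_relation[OF th[OF f(1)] 0] show False using f(2) by simp
  qed
  show "\<exists>f. (\<forall>z. f (torus_point Lat z) = proj_point (\<lambda>k. if k \<le> N then \<theta> k z else 0)) \<and> closed_embedding Lat N f"
  proof (rule closed_embedding_criterion[OF Lat_0 Lat_add Lat_neg Lat_cocompact])
    show "holomorphic2_on (\<theta> k) UNIV" if "k \<le> N" for k using \<theta>[OF that] by (simp add: sections_def)
    show "\<exists>k\<le>N. \<theta> k z \<noteq> 0" for z by (rule nz)
  next
    fix \<alpha> z assume \<alpha>: "\<alpha> \<in> Lat"
    have "?J \<alpha> z \<noteq> 0" unfolding tensor_power_def using auto_factor_nonzero[OF \<psi> \<alpha>] by simp
    moreover have "\<theta> k (z + \<alpha>) = ?J \<alpha> z * \<theta> k z" if "k \<le> N" for k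
      using \<theta>[OF that] \<alpha> by (simp add: sections_def)
    ultimately show "\<exists>c. c \<noteq> 0 \<and> (\<forall>k\<le>N. \<theta> k (z + \<alpha>) = c * \<theta> k z)" by blast
  next
    fix z u c assume c: "c \<noteq> (0::complex)" and eq: "\<forall>k\<le>N. \<theta> k z = c * \<theta> k u"
    then have b: "\<forall>b\<in>\<theta> ` {..N}. b z = c * b u" by auto
    define \<gamma> where "\<gamma> = c * trivializer \<delta> u ^ n / trivializer \<delta> z ^ n"
    have \<gamma>: "\<gamma> \<noteq> 0" using c by (simp add: \<gamma>_def)
    have f\<gamma>: "f (z - w) = \<gamma> * f (u - w)" if "f \<in> theta_space n" for f
      using span_eval_relation[OF th[OF that] b] by (simp add: \<gamma>_def field_simps)
    have "\<exists>m l. (z - w) - (u - w) = Om m + ivec l"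
      by (rule theta_space_separates_points[OF n \<gamma>]) (rule f\<gamma>)
    then obtain m l where "(z - w) - (u - w) = Om m + ivec l" by blast
    then show "z - u \<in> Lat" using Om_in_Lat by simp
  next
    fix z v l assume eq: "\<forall>k\<le>N. ((\<lambda>t. \<theta> k (z + t *s v)) has_field_derivative l * \<theta> k z) (at 0)"
    then have b: "\<forall>b\<in>\<theta> ` {..N}. ((\<lambda>t. b (z + t *s v)) has_field_derivative l * b z) (at 0)"
      by auto
    let ?t = "\<lambda>x. trivializer \<delta> x ^ n"
    have "holomorphic2_on ?t UNIV" by (intro holomorphic2_on_power holomorphic2_trivializer)
    then have "\<exists>D. (?t has_derivative D) (at (z + 0 *s v)) \<and> (\<forall>c v. D (c *s v) = c * D v)"
      unfolding holomorphic2_on_def by blast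
    then obtain D where "(?t has_derivative D) (at (z + 0 *s v))" "\<And>c v. D (c *s v) = c * D v" by blast
    from holomorphic2_along_line[OF this] have td: "((\<lambda>t. ?t (z + t *s v)) has_field_derivative D v) (at 0)" .
    define e where "e = D v / ?t z"
    have fd: "((\<lambda>t. f (z - w + t *s v)) has_field_derivative (l - e) * f (z - w)) (at 0)" if f: "f \<in> theta_space n" for f
    proof -
      have "((\<lambda>t. ?t (z + t *s v) * f (z + t *s v - w)) has_field_derivative l * (?t z * f (z - w))) (at 0)"
        by (rule span_line_derivative[OF th[OF f] b])
      from DERIV_divide[OF this td]
      have "((\<lambda>t. ?t (z + t *s v) * f (z + t *s v - w) / ?t (z + t *s v)) has_field_derivative
          (l * (?t z * f (z - w)) * ?t z - ?t z * f (z - w) * D v) / (?t z * ?t z)) (at 0)"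
        by simp
      moreover have "(l * (?t z * f (z - w)) * ?t z - ?t z * f (z - w) * D v) / (?t z * ?t z) = (l - e) * f (z - w)"
        unfolding e_def by (simp add: divide_simps) (simp add: algebra_simps)
      moreover have "z + t *s v - w = z - w + t *s v" for t by simp
      ultimately show ?thesis by simp
    qed
    show "v = 0" by (rule theta_space_separates_tangents[OF n]) (rule fd)
  qed
qed

end

theorem theorem3p4:
  fixes \<tau> z :: complex and L :: "(complex^2) set"
  assumes "Im \<tau> > \<bar>Im z\<bar>" and "\<bar>Im z\<bar> \<ge> 0"
    and "Im (2 * \<tau> + z) \<in> \<int>" and "Im (\<tau> + 2 * z) \<in> \<int>"
    and "L = period_lattice (period_matrix \<tau> z)"
  shows "(riemann_form L H_star \<and> pos_definite H_star) \<and>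
    (\<exists>\<psi>. semi_character L E_star \<psi>) \<and>
    (\<forall>\<psi>. semi_character L E_star \<psi> \<longrightarrow>
       (ample L (auto_factor H_star \<psi>) \<and>
        (\<forall>n\<ge>3. sections_embed L (tensor_power (auto_factor H_star \<psi>) n))) \<and>
       (\<forall>e. z_basis L e \<longrightarrow>
          real (cfun.dim (sections L (auto_factor H_star \<psi>))) = sqrt (det (gram_matrix E_star e)) \<and>
          sqrt (det (gram_matrix E_star e)) = 3 * ((Im \<tau>)\<^sup>2 - (Im z)\<^sup>2)))"
proof -
  obtain a b where ab: "Im (2 * \<tau> + z) = of_int a" "Im (\<tau> + 2 * z) = of_int b"
    using assms(3,4) by (elim Ints_cases)
  interpret theta_data \<tau> z a b by unfold_locales (use assms(1) ab in auto)
  have L: "L = Lat" by (simp add: Lat_def assms(5))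
  have "real (cfun.dim (sections Lat (auto_factor H_star \<psi>))) = sqrt (det (gram_matrix E_star e)) \<and>
      sqrt (det (gram_matrix E_star e)) = 3 * ((Im \<tau>)\<^sup>2 - (Im z)\<^sup>2)"
    if \<psi>: "semi_character Lat E_star \<psi>" and e: "z_basis Lat e" for \<psi> e
  proof -
    have D: "real_of_int (a\<^sup>2 - b\<^sup>2) = 3 * ((Im \<tau>)\<^sup>2 - (Im z)\<^sup>2)" using disc_eq by simp
    have "det (gram_matrix E_star e) = ((Im (2 * \<tau> + z))\<^sup>2 - (Im (\<tau> + 2 * z))\<^sup>2)\<^sup>2"
      using det_gram_matrix_basis_change[OF z_basis_period(1)[OF assms(1)] e[unfolded Lat_def]]
      unfolding det_gram_matrix_period_basis .
    also have "\<dots> = (real_of_int (a\<^sup>2 - b\<^sup>2))\<^sup>2" unfolding ab by simp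
    finally have "sqrt (det (gram_matrix E_star e)) = \<bar>real_of_int (a\<^sup>2 - b\<^sup>2)\<bar>" by simp
    also have "\<dots> = real_of_int (a\<^sup>2 - b\<^sup>2)" using disc_pos by linarith
    finally have s: "sqrt (det (gram_matrix E_star e)) = real_of_int (a\<^sup>2 - b\<^sup>2)" .
    have "real (cfun.dim (sections Lat (auto_factor H_star \<psi>))) = real_of_int (a\<^sup>2 - b\<^sup>2)"
      unfolding dim_sections[OF \<psi>] using disc_pos by (simp only: of_nat_nat less_imp_le)
    then show ?thesis using s D by simp
  qed
  then show ?thesis
    unfolding L ample_def
    using riemann_form_H_star pos_definite_H_star semi_character_exists sections_embed_tensor_power by blast
qed

end
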